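(* Let $m\ge 1$. For every $n\ge 1$, the cut-and-join operators $\mathcal{CJ}_0,\dots,\mathcal{CJ}_{m-1}$ of the group $G(m,1,n)$, acting on $\mathbb{C}[\mathbf p]_n$, are given by (the restrictions to $\mathbb{C}[\mathbf p]_n$ of) the differential operators $$\mathcal{CJ}_0=\frac12\sum_{\substack{i,j\ge 1\\ \alpha,\gamma\in\mathbb{Z}/m\mathbb{Z}}}\left((i+j)\,p^{(\alpha)}_i p^{(\gamma)}_j\frac{\partial}{\partial p^{(\alpha+\gamma)}_{i+j}}+m\,ij\,p^{(\alpha+\gamma)}_{i+j}\frac{\partial^2}{\partial p^{(\alpha)}_i\,\partial p^{(\gamma)}_j}\right)$$ and $$\mathcal{CJ}_k=\sum_{\substack{i\ge 1\\ \alpha\in\mathbb{Z}/m\mathbb{Z}}} i\,p^{(\alpha+k)}_i\frac{\partial}{\partial p^{(\alpha)}_i}\qquad (k=1,\dots,m-1),$$ where upper indices are taken modulo $m$.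
   Context: $G(m,1,n)$ is the group of $n\times n$ monomial matrices whose non-zero entries are $m$-th roots of unity. For $z\in G(m,1,n)$ write $z e_k=\exp(2\pi \sqrt{-1}\,g_k/m)\,e_{u(k)}$ with $u\in S_n$ and $g_k\in\mathbb{Z}/m\mathbb{Z}$. An $m$-colored partition of $n$ is a tuple $\overline\lambda=\lambda_0|\dots|\lambda_{m-1}$ of partitions with $|\overline\lambda|:=|\lambda_0|+\dots+|\lambda_{m-1}|=n$. The set $C_{\overline\lambda}\subset G(m,1,n)$ consists of those $z$ such that, for every $r\in\mathbb{Z}/m\mathbb{Z}$, the parts of $\lambda_r$ are the lengths of those cycles $(i_1\dots i_k)$ of $u$ for which $g_{i_1}+\dots+g_{i_k}=r$; the sets $C_{\overline\lambda}$ are exactly the conjugacy classes of $G(m,1,n)$. $\mathcal R$ is the class $C_{(2,1^{n-2})|\emptyset|\dots|\emptyset}$ (empty if $n=1$), and for $k=1,\dots,m-1$, $\mathcal L^k$ is the class $C_{\overline\lambda}$ with $\lambda_0=1^{n-1}$, $\lambda_k=(1)$ and all other $\lambda_i$ empty; together these classes contain all reflections of $G(m,1,n)$. Let $Z[G(m,1,n)]$ be the center of the group algebra $\mathbb{C}[G(m,1,n)]$, with basis $\mathcal C_{\overline\lambda}=\frac{1}{\#C_{\overline\lambda}}\sum_{x\in C_{\overline\lambda}}x$. Let $\mathcal T_0=\sum_{x\in\mathcal R}x$ and $\mathcal T_k=\sum_{x\in\mathcal L^k}x$ for $1\le k\le m-1$, and let $T_i$ be the operator of multiplication by $\mathcal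 T_i$ on $Z[G(m,1,n)]$, $i=0,\dots,m-1$. $\mathbb{C}[\mathbf p]$ is the polynomial ring in the variables $p^{(\alpha)}_k$ ($\alpha\in\mathbb{Z}/m\mathbb{Z}$, $k\ge1$), graded by $\deg p^{(\alpha)}_k=k$, with degree-$n$ component $\mathbb{C}[\mathbf p]_n$. For a partition $\lambda=(\ell_1,\dots,\ell_s)$ put $p^{(\alpha)}_\lambda=p^{(\alpha)}_{\ell_1}\cdots p^{(\alpha)}_{\ell_s}$, and $\mathbf p_{\overline\lambda}=p^{(0)}_{\lambda_0}p^{(1)}_{\lambda_1}\cdots p^{(m-1)}_{\lambda_{m-1}}$. The linear isomorphism $\Theta: Z[G(m,1,n)]\to\mathbb{C}[\mathbf p]_n$ is given by $\Theta(\mathcal C_{\overline\lambda})=\mathbf p_{\overline\lambda}$. The cut-and-join operators are defined by $\mathcal{CJ}_i=\Theta\circ T_i\circ\Theta^{-1}$, $i=0,\dots,m-1$. *)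

theory Defs
  imports
    Complex_Main
    "HOL-Library.Multiset"
    "HOL-Library.Poly_Mapping"
    "HOL-Combinatorics.Orbits"
    "HOL-Algebra.Group"
    "Jordan_Normal_Form.Matrix"
begin

section \<open>The group $G(m,1,n)$\<close>

definition monomial_mat :: "complex mat \<Rightarrow> bool" where
  "monomial_mat A \<longleftrightarrow>
     (\<forall>i<dim_row A. \<exists>!j. j < dim_col A \<and> A $$ (i, j) \<noteq> 0) \<and>
     (\<forall>j<dim_col A. \<exists>!i. i < dim_row A \<and> A $$ (i, j) \<noteq> 0)"

definition Gm1n :: "nat \<Rightarrow> nat \<Rightarrow> complex mat monoid" where
  "Gm1n m n =
     \<lparr>carrier = {A \<in> carrier_mat n n. monomial_mat A \<and>
                  (\<forall>i<n. \<forall>j<n. A $$ (i, j) \<noteq> 0 \<longrightarrow> A $$ (i, j) ^ m = 1)},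
      mult = (*),
      one = 1\<^sub>m n\<rparr>"

text \<open>Basis vectors are numbered \<open>0, \<dots>, n - 1\<close>, and elements of $\mathbb{Z}/m\mathbb{Z}$ are
  represented by \<open>0, \<dots>, m - 1\<close>. For \<open>z\<close> in the group, \<open>z e\<^sub>k = exp (2 \<pi> \<i> g\<^sub>k / m) e\<^bsub>u k\<^esub>\<close>
  with \<open>u = perm_of z\<close> and \<open>g = colour_of m z\<close>.\<close>

definition perm_of :: "complex mat \<Rightarrow> nat \<Rightarrow> nat" where
  "perm_of z k =
     (if k < dim_col z then (THE i. i < dim_row z \<and> z $$ (i, k) \<noteq> 0) else k)"

definition colour_of :: "nat \<Rightarrow> complex mat \<Rightarrow> nat \<Rightarrow> nat" where
  "colour_of m z k =
     (THE g. g < m \<and>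
        z $$ (perm_of z k, k) = exp (2 * complex_of_real pi * \<i> * of_nat g / of_nat m))"

section \<open>Coloured partitions and the classes\<close>

text \<open>A partition is the multiset of its (positive) parts.\<close>

definition coloured_partition :: "nat \<Rightarrow> nat \<Rightarrow> nat multiset list \<Rightarrow> bool" where
  "coloured_partition m n \<Lambda> \<longleftrightarrow>
     length \<Lambda> = m \<and> (\<forall>r<m. 0 \<notin># \<Lambda> ! r) \<and> (\<Sum>r<m. \<Sum>\<^sub># (\<Lambda> ! r)) = n"

text \<open>A cycle of the permutation is identified with its set of points; fixed points are
  cycles of length 1.\<close>

definition cycles_of_colour :: "nat \<Rightarrow> nat \<Rightarrow> complex mat \<Rightarrow> nat \<Rightarrow> nat set set" where
  "cycles_of_colour m n z r =
     {c \<in> orbit (perm_of z) ` {..<n}. (\<Sum>i\<in>c. colour_of m z i) mod m = r}"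

definition conj_class :: "nat \<Rightarrow> nat \<Rightarrow> nat multiset list \<Rightarrow> complex mat set" where
  "conj_class m n \<Lambda> =
     {z \<in> carrier (Gm1n m n).
        \<forall>r<m. \<Lambda> ! r = image_mset card (mset_set (cycles_of_colour m n z r))}"

definition class_R :: "nat \<Rightarrow> nat \<Rightarrow> complex mat set" where
  "class_R m n =
     (if n = 1 then {}
      else conj_class m n ((replicate m {#})[0 := add_mset 2 (replicate_mset (n - 2) 1)]))"

definition class_L :: "nat \<Rightarrow> nat \<Rightarrow> nat \<Rightarrow> complex mat set" where
  "class_L m n k = conj_class m n ((replicate m {#})[0 := replicate_mset (n - 1) 1, k := {#1#}])"

section \<open>The group algebra and its centre\<close>

definition scale :: "complex \<Rightarrow> ('a \<Rightarrow>\<^sub>0 complex) \<Rightarrow> ('a \<Rightarrow>\<^sub>0 complex)" (infixr \<open>*\<^sub>C\<close> 75) where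
  "c *\<^sub>C f = Poly_Mapping.map ((*) c) f"

text \<open>The group algebra consists of the finite formal combinations of group elements. Since the
  product depends on the group structure carried by the record, it is not the product of the
  type \<open>_ \<Rightarrow>\<^sub>0 _\<close> (which is used for polynomials below).\<close>

definition group_algebra :: "('g, 'b) monoid_scheme \<Rightarrow> ('g \<Rightarrow>\<^sub>0 complex) set" where
  "group_algebra G = {a. Poly_Mapping.keys a \<subseteq> carrier G}"

definition ga_mult ::
  "('g, 'b) monoid_scheme \<Rightarrow> ('g \<Rightarrow>\<^sub>0 complex) \<Rightarrow> ('g \<Rightarrow>\<^sub>0 complex) \<Rightarrow> ('g \<Rightarrow>\<^sub>0 complex)" where
  "ga_mult G a b =
     (\<Sum>x\<in>Poly_Mapping.keys a. \<Sum>y\<in>Poly_Mapping.keys b.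
        Poly_Mapping.single (x \<otimes>\<^bsub>G\<^esub> y) (Poly_Mapping.lookup a x * Poly_Mapping.lookup b y))"

definition ga_centre :: "('g, 'b) monoid_scheme \<Rightarrow> ('g \<Rightarrow>\<^sub>0 complex) set" where
  "ga_centre G =
     {a \<in> group_algebra G. \<forall>b \<in> group_algebra G. ga_mult G a b = ga_mult G b a}"

definition set_sum :: "'g set \<Rightarrow> ('g \<Rightarrow>\<^sub>0 complex)" where
  "set_sum X = (\<Sum>x\<in>X. Poly_Mapping.single x 1)"

definition class_avg :: "nat \<Rightarrow> nat \<Rightarrow> nat multiset list \<Rightarrow> (complex mat \<Rightarrow>\<^sub>0 complex)" where
  "class_avg m n \<Lambda> =
     (1 / of_nat (card (conj_class m n \<Lambda>))) *\<^sub>C set_sum (conj_class m n \<Lambda>)"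

definition refl_sum :: "nat \<Rightarrow> nat \<Rightarrow> nat \<Rightarrow> (complex mat \<Rightarrow>\<^sub>0 complex)" where
  "refl_sum m n k = set_sum (if k = 0 then class_R m n else class_L m n k)"

definition T_op ::
  "nat \<Rightarrow> nat \<Rightarrow> nat \<Rightarrow> (complex mat \<Rightarrow>\<^sub>0 complex) \<Rightarrow> (complex mat \<Rightarrow>\<^sub>0 complex)" where
  "T_op m n k z = ga_mult (Gm1n m n) (refl_sum m n k) z"

section \<open>Polynomials\<close>

text \<open>The pair \<open>(\<alpha>, k)\<close> stands for the variable $p^{(\alpha)}_k$, a monomial is the finitely
  supported map of its exponents. The ring $\mathbb{C}[\mathbf{p}]$ is the subset of the type
  below in which only variables with \<open>\<alpha> < m\<close> and \<open>k \<ge> 1\<close> occur.\<close>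

type_synonym pmonom = "nat \<times> nat \<Rightarrow>\<^sub>0 nat"
type_synonym ppoly = "pmonom \<Rightarrow>\<^sub>0 complex"

definition pvar :: "nat \<Rightarrow> nat \<Rightarrow> ppoly" where
  "pvar \<alpha> k = Poly_Mapping.single (Poly_Mapping.single (\<alpha>, k) 1) 1"

definition monom_deg :: "pmonom \<Rightarrow> nat" where
  "monom_deg \<mu> = (\<Sum>(\<alpha>, k)\<in>Poly_Mapping.keys \<mu>. k * Poly_Mapping.lookup \<mu> (\<alpha>, k))"

definition poly_component :: "nat \<Rightarrow> nat \<Rightarrow> ppoly set" where
  "poly_component m n =
     {f. \<forall>\<mu>\<in>Poly_Mapping.keys f.
           (\<forall>(\<alpha>, k)\<in>Poly_Mapping.keys \<mu>. \<alpha> < m \<and> 1 \<le> k) \<and> monom_deg \<mu> = n}"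

text \<open>In the derivative, the truncated difference of exponents only matters for monomials
  containing the variable, as the coefficient is 0 otherwise.\<close>

definition pdiff :: "nat \<Rightarrow> nat \<Rightarrow> ppoly \<Rightarrow> ppoly" where
  "pdiff \<alpha> k f =
     (\<Sum>\<mu>\<in>Poly_Mapping.keys f.
        Poly_Mapping.single (\<mu> - Poly_Mapping.single (\<alpha>, k) 1)
          (of_nat (Poly_Mapping.lookup \<mu> (\<alpha>, k)) * Poly_Mapping.lookup f \<mu>))"

definition p_part :: "nat \<Rightarrow> nat multiset list \<Rightarrow> ppoly" where
  "p_part m \<Lambda> = (\<Prod>r<m. \<Prod>l\<in>#\<Lambda> ! r. pvar r l)"

section \<open>Cut-and-join operators\<close>

definition linear_iso_on ::
  "('a \<Rightarrow>\<^sub>0 complex) set \<Rightarrow> ('b \<Rightarrow>\<^sub>0 complex) set \<Rightarrow> (('a \<Rightarrow>\<^sub>0 complex) \<Rightarrow> ('b \<Rightarrow>\<^sub>0 complex)) \<Rightarrow> bool"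
where
  "linear_iso_on V W \<phi> \<longleftrightarrow>
     bij_betw \<phi> V W \<and>
     (\<forall>x\<in>V. \<forall>y\<in>V. \<phi> (x + y) = \<phi> x + \<phi> y) \<and>
     (\<forall>c. \<forall>x\<in>V. \<phi> (c *\<^sub>C x) = c *\<^sub>C \<phi> x)"

text \<open>The conditions determine the map on the centre, because the class averages span it; the
  values elsewhere are arbitrary and play no role.\<close>

definition Theta :: "nat \<Rightarrow> nat \<Rightarrow> (complex mat \<Rightarrow>\<^sub>0 complex) \<Rightarrow> ppoly" where
  "Theta m n =
     (SOME \<Theta>. linear_iso_on (ga_centre (Gm1n m n)) (poly_component m n) \<Theta> \<and>
              (\<forall>\<Lambda>. coloured_partition m n \<Lambda> \<longrightarrow> \<Theta> (class_avg m n \<Lambda>) = p_part m \<Lambda>))"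

definition CJ :: "nat \<Rightarrow> nat \<Rightarrow> nat \<Rightarrow> ppoly \<Rightarrow> ppoly" where
  "CJ m n k f =
     Theta m n (T_op m n k (the_inv_into (ga_centre (Gm1n m n)) (Theta m n) f))"

end

theory Submission
  imports Defs "HOL-Number_Theory.Cong"
begin

text \<open>Attach to a group element \<open>z\<close> the monomial of its type: the product, over the cycles of its
  permutation, of the variables whose lower index is the length of the cycle and whose upper index
  is its colour, the sum of the colours of its points. Let \<open>type_map\<close> be the linear extension of
  this map to the group algebra. Two elements are conjugate if and only if they have the same type,
  and every monomial of degree \<open>n\<close> is a type (\<open>type_monom_conjugate\<close>, \<open>conjugate_of_type_monom_eq\<close>,
  \<open>type_monom_surj\<close>). Hence the elements of the centre are the functions of the type,
  and \<open>type_map\<close> is a linear isomorphism on the centre that sends class averages to monomials. So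
  it is \<open>Theta\<close> there (\<open>Theta_eq_type_map\<close>).

  Now let \<open>f\<close> be the image of the central element \<open>\<Sum>\<^sub>z a\<^sub>z z\<close>. The cut-and-join operator sends \<open>f\<close> to
  the sum of \<open>a\<^sub>z\<close> times the monomial of \<open>x z\<close>, over all \<open>z\<close> and all reflections \<open>x\<close> in the class. As
  differential operators are linear, the theorem follows once it is known, for each single \<open>z\<close>, that
  the monomials of the elements \<open>x z\<close> add up to the differential operator applied to the monomial of
  \<open>z\<close> (\<open>CJ_eq\<close>). Centrality is gone from this last statement, and it is a matter of counting:

  \<^item> A reflection \<open>x\<close> that transposes the points \<open>a\<close> and \<open>b\<close>, up to opposite colours \<open>t\<close> and \<open>- t\<close>, cuts
    the cycle of \<open>z\<close> that contains both points, or joins the two cycles that contain them. For a cycle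
    of length \<open>l\<close> and colour \<open>r\<close>, each of the \<open>l\<close> choices of \<open>a\<close> leads to every decomposition \<open>l = i + j\<close>,
    \<open>r = \<alpha> + \<gamma>\<close> exactly once as \<open>b\<close> and \<open>t\<close> vary. Two cycles of lengths \<open>i\<close> and \<open>j\<close> are joined in
    \<open>m i j\<close> ways, always with the same result. A first derivative of a product of variables selects
    one factor, and a second derivative an ordered pair of different factors, so these are the two
    parts of the operator (\<open>sum_type_poly_transpositions\<close>, \<open>cut_join_prod_pv\<close>). The factor \<open>1 / 2\<close>
    is there because \<open>(a, b, t)\<close> and \<open>(b, a, - t)\<close> are the same reflection.
  \<^item> A diagonal reflection adds \<open>k\<close> to the colour of the cycle through its point, and a cycle of
    length \<open>i\<close> has \<open>i\<close> points (\<open>sum_type_poly_shift\<close>).\<close>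

section \<open>Cycles of a permutation and of its products with transpositions\<close>

definition cycle_sets :: "'a set \<Rightarrow> ('a \<Rightarrow> 'a) \<Rightarrow> 'a set set" where
  "cycle_sets S u = orbit u ` S"

lemma cyclic_on_cycle_set:
  assumes "u permutes S" "finite S" "c \<in> cycle_sets S u"
  shows "cyclic_on u c"
proof -
  obtain x where "c = orbit u x" using assms(3) unfolding cycle_sets_def by auto
  then show ?thesis using cyclic_on_orbit[OF assms(1,2)] by simp
qed

lemma orbit_eq_cycle_set:
  assumes "u permutes S" "finite S" "c \<in> cycle_sets S u" "a \<in> c"
  shows "orbit u a = c"
  using cyclic_on_cycle_set[OF assms(1-3)] assms(4) by (rule orbit_cyclic_eq3)

lemma self_in_orbit_permutes:
  assumes "u permutes S" "finite S"
  shows "x \<in> orbit u x"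
  using assms permutation_permutes permutation_self_in_orbit by metis

lemma cycle_set_subset:
  assumes "u permutes S" "c \<in> cycle_sets S u"
  shows "c \<subseteq> S"
  using permutes_orbit_subset[OF assms(1)] assms(2) unfolding cycle_sets_def by auto

lemma finite_cycle_sets: "finite S \<Longrightarrow> finite (cycle_sets S u)"
  by (simp add: cycle_sets_def)

lemma finite_cycle_set:
  assumes "u permutes S" "finite S" "c \<in> cycle_sets S u"
  shows "finite c"
  using cycle_set_subset[OF assms(1,3)] assms(2) finite_subset by blast

lemma Union_cycle_sets:
  assumes "u permutes S" "finite S"
  shows "\<Union> (cycle_sets S u) = S"
  using self_in_orbit_permutes[OF assms] permutes_orbit_subset[OF assms(1)]
  unfolding cycle_sets_def by fast

lemma cycle_sets_disjoint:
  assumes "u permutes S" "finite S" "c \<in> cycle_sets S u" "d \<in> cycle_sets S u" "c \<noteq> d"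
  shows "c \<inter> d = {}"
  using orbit_eq_cycle_set[OF assms(1,2,3)] orbit_eq_cycle_set[OF assms(1,2,4)] assms(5) by auto

lemma cycle_set_nonempty: "c \<in> cycle_sets S u \<Longrightarrow> c \<noteq> {}"
  by (auto simp: cycle_sets_def orbit_nonempty)

lemma card_cycle_set_pos:
  assumes "u permutes S" "finite S" "c \<in> cycle_sets S u"
  shows "card c > 0"
  using cycle_set_nonempty[OF assms(3)] finite_cycle_set[OF assms] by (simp add: card_gt_0_iff)

lemma image_cycle_set:
  assumes "u permutes S" "finite S" "c \<in> cycle_sets S u"
  shows "u ` c = c"
proof (rule card_subset_eq)
  show "finite c" using finite_cycle_set[OF assms] .
  show "u ` c \<subseteq> c" using cyclic_on_inI[OF cyclic_on_cycle_set[OF assms]] by blast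
  show "card (u ` c) = card c"
    using assms(1) by (intro card_image) (meson inj_on_subset permutes_inj subset_UNIV)
qed

text \<open>Two sets on which a map is cyclic coincide as soon as they meet. A family of such sets that
  covers the domain is therefore the whole list of cycles; this is how the cycles of a product with
  a transposition are recognised.\<close>

lemma cycle_sets_eqI:
  assumes "\<Union> Q = S" "\<And>c. c \<in> Q \<Longrightarrow> cyclic_on v c"
  shows "cycle_sets S v = Q"
proof
  show "cycle_sets S v \<subseteq> Q"
    using assms(1) orbit_cyclic_eq3[OF assms(2)] unfolding cycle_sets_def by auto
  show "Q \<subseteq> cycle_sets S v"
  proof
    fix c assume c: "c \<in> Q"
    then obtain x where "x \<in> c" "c = orbit v x" using assms(2) unfolding cyclic_on_def by blast
    then show "c \<in> cycle_sets S v" using c assms(1) unfolding cycle_sets_def by blast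
  qed
qed

lemma sum_over_cycle_sets:
  assumes "u permutes S" "finite S"
  shows "(\<Sum>x\<in>S. f x) = (\<Sum>c\<in>cycle_sets S u. \<Sum>x\<in>c. f x)"
  using sum.Union_disjoint[of "cycle_sets S u" f]
    finite_cycle_set[OF assms] cycle_sets_disjoint[OF assms]
  by (simp add: Union_cycle_sets[OF assms])

text \<open>Every cycle is the injective list \<open>a, u a, u (u a), \<dots>\<close> of its points, starting at any of
  them. Cutting, joining and conjugating cycles are all done on such lists.\<close>

lemma cycle_set_iterates:
  assumes "u permutes S" "finite S" "c \<in> cycle_sets S u" "a \<in> c"
  shows "c = (\<lambda>i. (u ^^ i) a) ` {..<card c}"
    and "inj_on (\<lambda>i. (u ^^ i) a) {..<card c}"
    and "(u ^^ card c) a = a"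
proof -
  let ?L = "funpow_dist1 u a a"
  have self: "a \<in> orbit u a" using self_in_orbit_permutes[OF assms(1,2)] .
  have o: "orbit u a = c" using orbit_eq_cycle_set[OF assms] .
  have inj: "inj_on (\<lambda>i. (u ^^ i) a) {..<?L}"
    using funpow_neq_less_funpow_dist1[OF self] by (intro inj_onI) blast
  have ret: "(u ^^ ?L) a = a" using funpow_dist1_prop[OF self] .
  have im: "c = (\<lambda>i. (u ^^ i) a) ` {..<?L}"
    using orbit_altdef_bounded[OF ret] o by auto
  have "card c = ?L" using card_image[OF inj] im by simp
  then show "c = (\<lambda>i. (u ^^ i) a) ` {..<card c}" "inj_on (\<lambda>i. (u ^^ i) a) {..<card c}"
    "(u ^^ card c) a = a" using im inj ret by simp_all
qed

text \<open>The standard way to exhibit a cycle: list its points as \<open>p s, \<dots>, p (t - 1)\<close>, in the order in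
  which \<open>v\<close> visits them.\<close>

lemma cyclic_on_image_interval:
  fixes p :: "nat \<Rightarrow> 'a"
  assumes "s < t"
    and step: "\<And>i. s \<le> i \<Longrightarrow> Suc i < t \<Longrightarrow> v (p i) = p (Suc i)"
    and last: "v (p (t - 1)) = p s"
  shows "cyclic_on v (p ` {s..<t})"
proof (rule cyclic_on_singleI)
  show "p s \<in> p ` {s..<t}" using assms(1) by simp
  have it: "(v ^^ j) (p s) = p (s + j)" if "s + j < t" for j
    using that by (induction j) (use step in auto)
  have "(v ^^ (t - s)) (p s) = v ((v ^^ (t - s - 1)) (p s))"
    using assms(1) by (cases "t - s") auto
  also have "\<dots> = p s" using it[of "t - s - 1"] assms(1) last by simp
  finally have "orbit v (p s) = {(v ^^ j) (p s) | j. j < t - s}"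
    using assms(1) by (intro orbit_altdef_bounded) auto
  also have "\<dots> = {p (s + j) | j. j < t - s}"
    using it by (intro Collect_cong ex_cong1) (auto simp: less_diff_conv add.commute)
  also have "\<dots> = p ` ((+) s ` {0..<t - s})" unfolding image_image by force
  also have "(+) s ` {0..<t - s} = {s..<t}" using assms(1) by simp
  finally show "p ` {s..<t} = orbit v (p s)" ..
qed

lemma transpose_comp_outside:
  assumes "u permutes S" "finite S" "d \<in> cycle_sets S u" "a \<notin> d" "b \<notin> d"
  shows "cyclic_on (transpose a b \<circ> u) d"
proof -
  have "\<And>x. x \<in> d \<Longrightarrow> u x = (transpose a b \<circ> u) x"
    using cyclic_on_inI[OF cyclic_on_cycle_set[OF assms(1-3)]] assms(4,5)
    by (metis comp_apply transpose_apply_other)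
  then show ?thesis
    using cyclic_cong cyclic_on_cycle_set[OF assms(1-3)] by metis
qed

text \<open>Write the cycle as \<open>p 0 = a, p 1, \<dots>\<close>. Composing with the transposition of \<open>p 0\<close> and \<open>p s\<close>
  redirects the two arrows that end in these points: \<open>p (s - 1)\<close> now goes back to \<open>p 0\<close>, and the
  last point goes to \<open>p s\<close>, so the list falls apart at \<open>s\<close>. The last two claims say which
  transposed point is hit by an arrow of \<open>u\<close> that starts in which piece; they decide which piece
  receives which colour of the reflection.\<close>

lemma cycle_sets_split:
  assumes u: "u permutes S" "finite S" and c: "c \<in> cycle_sets S u" and a: "a \<in> c"
    and s: "0 < s" "s < card c"
  defines "p \<equiv> \<lambda>i. (u ^^ i) a"
  defines "c1 \<equiv> p ` {..<s}" and "c2 \<equiv> p ` {s..<card c}"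
  shows "cycle_sets S (transpose a (p s) \<circ> u) = cycle_sets S u - {c} \<union> {c1, c2}"
    and "c1 \<union> c2 = c" "c1 \<inter> c2 = {}" "card c1 = s" "card c2 = card c - s"
    and "u ` c1 \<inter> {a, p s} = {p s}" "u ` c2 \<inter> {a, p s} = {a}"
proof -
  let ?L = "card c" and ?v = "transpose a (p s) \<circ> u"
  note it = cycle_set_iterates[OF u c a, folded p_def]
  have inj: "p i = p j \<longleftrightarrow> i = j" if "i < ?L" "j < ?L" for i j
    using it(2) that by (auto simp: inj_on_def p_def)
  have pa: "p 0 = a" by (simp add: p_def)
  have L: "p ?L = p 0" using it(3) by (simp add: p_def)
  have pS: "u (p i) = p (Suc i)" for i by (simp add: p_def)
  have c_eq: "c = p ` {..<?L}" using it(1) by (simp add: p_def)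
  have split: "{..<?L} = {..<s} \<union> {s..<?L}" using s by auto
  show un: "c1 \<union> c2 = c" unfolding c1_def c2_def by (subst (2) c_eq) (simp add: split image_Un)
  show "c1 \<inter> c2 = {}" unfolding c1_def c2_def using s inj by fastforce
  have "inj_on p {..<s}" "inj_on p {s..<?L}" using s inj by (auto intro!: inj_onI)
  then show "card c1 = s" "card c2 = ?L - s"
    unfolding c1_def c2_def by (simp_all add: card_image)
  have "u ` c1 = p ` (Suc ` {..<s})" unfolding c1_def image_image pS ..
  then have u1: "u ` c1 = p ` {1..s}" by (simp only: image_Suc_lessThan)
  have u2: "u ` c2 = p ` {Suc s..?L}"
    unfolding c2_def image_image pS image_Suc_atLeastLessThan[symmetric] atLeastLessThanSuc_atLeastAtMost[symmetric]
    by simp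
  show "u ` c1 \<inter> {a, p s} = {p s}"
    unfolding u1 pa[symmetric] using s inj by force
  have "u ` c2 = insert (p 0) (p ` {Suc s..<?L})"
    unfolding u2 using s by (subst L[symmetric]) (simp add: image_insert[symmetric] ivl_disj_un_singleton(6)[symmetric] del: image_insert; auto)
  then show "u ` c2 \<inter> {a, p s} = {a}"
    unfolding pa[symmetric] using s inj by force
  have cyc1: "cyclic_on ?v (p ` {0..<s})"
  proof (rule cyclic_on_image_interval)
    fix i assume "Suc i < s"
    then have "p (Suc i) \<noteq> p 0" "p (Suc i) \<noteq> p s" using s inj by auto
    then show "?v (p i) = p (Suc i)" using pa by (simp add: pS)
  qed (use s pa in \<open>auto simp: pS\<close>)
  have cyc2: "cyclic_on ?v (p ` {s..<?L})"
  proof (rule cyclic_on_image_interval)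
    fix i assume "s \<le> i" "Suc i < ?L"
    then have "p (Suc i) \<noteq> p 0" "p (Suc i) \<noteq> p s" using s inj by auto
    then show "?v (p i) = p (Suc i)" using pa by (simp add: pS)
  qed (use s pa L in \<open>auto simp: pS\<close>)
  show "cycle_sets S ?v = cycle_sets S u - {c} \<union> {c1, c2}"
  proof (rule cycle_sets_eqI)
    show "\<Union> (cycle_sets S u - {c} \<union> {c1, c2}) = S"
      using Union_cycle_sets[OF u] un c by auto
    fix d assume "d \<in> cycle_sets S u - {c} \<union> {c1, c2}"
    moreover have "p s \<in> c" using s c_eq by blast
    ultimately show "cyclic_on ?v d"
      using cyc1 cyc2 transpose_comp_outside[OF u, of d a "p s"] cycle_sets_disjoint[OF u, of d c] a c
      unfolding c1_def c2_def atLeast0LessThan by blast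
  qed
qed

text \<open>The same two arrows are redirected as in the cut, but now they lie in different cycles: the
  arrow that closed the cycle of \<open>a\<close> leads to \<open>b\<close> and vice versa, so the two lists are
  concatenated.\<close>

lemma cycle_sets_join:
  assumes u: "u permutes S" "finite S" and c: "c \<in> cycle_sets S u" "d \<in> cycle_sets S u" "c \<noteq> d"
    and ab: "a \<in> c" "b \<in> d"
  shows "cycle_sets S (transpose a b \<circ> u) = cycle_sets S u - {c, d} \<union> {c \<union> d}"
proof -
  let ?v = "transpose a b \<circ> u"
  \<comment> \<open>the cycle of \<open>a\<close>, followed by the cycle of \<open>b\<close>\<close>
  define p where "p i = (if i < card c then (u ^^ i) a else (u ^^ (i - card c)) b)" for i
  have disj: "c \<inter> d = {}" using cycle_sets_disjoint[OF u c] .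
  note ic = cycle_set_iterates[OF u c(1) ab(1)] and id = cycle_set_iterates[OF u c(2) ab(2)]
  have pos: "card c > 0" "card d > 0" using card_cycle_set_pos[OF u] c by auto
  have inc: "(u ^^ i) a \<in> c" for i
    using cyclic_on_funpow_in[OF cyclic_on_cycle_set[OF u c(1)] ab(1)] .
  have ind: "(u ^^ i) b \<in> d" for i
    using cyclic_on_funpow_in[OF cyclic_on_cycle_set[OF u c(2)] ab(2)] .
  have nea: "(u ^^ i) a \<noteq> a" if "0 < i" "i < card c" for i
    using inj_onD[OF ic(2), of i 0] that pos by auto
  have neb: "(u ^^ i) b \<noteq> b" if "0 < i" "i < card d" for i
    using inj_onD[OF id(2), of i 0] that pos by auto
  have "p ` {0..<card c + card d} = p ` {0..<card c} \<union> p ` {card c..<card c + card d}"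
    by (metis image_Un ivl_disj_un_two(3) le_add1 zero_le)
  also have "p ` {0..<card c} = c"
    by (subst (2) ic(1)) (auto simp: p_def)
  also have "p ` {card c..<card c + card d} = p ` (\<lambda>i. i + card c) ` {0..<card d}"
    by (metis image_add_atLeastLessThan' add.commute add_0)
  also have "\<dots> = d"
    unfolding image_image by (subst (2) id(1)) (auto simp: p_def)
  finally have im: "p ` {0..<card c + card d} = c \<union> d" .
  have "cyclic_on ?v (p ` {0..<card c + card d})"
  proof (rule cyclic_on_image_interval)
    fix i assume i: "Suc i < card c + card d"
    consider "Suc i < card c" | "Suc i = card c" | "card c \<le> i" by linarith
    then show "?v (p i) = p (Suc i)"
    proof cases
      case 1
      have "(u ^^ Suc i) a \<noteq> a" "(u ^^ Suc i) a \<noteq> b" using 1 nea inc[of "Suc i"] ab disj by blast+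
      then show ?thesis using 1 by (simp add: p_def)
    next
      case 2
      then have "u ((u ^^ i) a) = a" using ic(3) by (metis comp_apply funpow.simps(2))
      then show ?thesis using 2 by (simp add: p_def)
    next
      case 3
      have "(u ^^ (Suc i - card c)) b \<noteq> b" "(u ^^ (Suc i - card c)) b \<noteq> a"
        using 3 i neb[of "Suc i - card c"] ind[of "Suc i - card c"] ab disj by auto
      then show ?thesis using 3 by (simp add: p_def Suc_diff_le)
    qed
  next
    have "u ((u ^^ (card d - 1)) b) = b"
      using id(3) pos by (metis Suc_pred' comp_apply funpow.simps(2))
    moreover have "\<not> card c + card d - 1 < card c" "card c + card d - 1 - card c = card d - 1"
      using pos by auto
    ultimately show "?v (p (card c + card d - 1)) = p 0" using pos by (simp add: p_def)
  qed (use pos in auto)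
  then have cyc: "cyclic_on ?v (c \<union> d)" unfolding im .
  show ?thesis
  proof (rule cycle_sets_eqI)
    show "\<Union> (cycle_sets S u - {c, d} \<union> {c \<union> d}) = S"
      using Union_cycle_sets[OF u] c by auto
    fix e assume "e \<in> cycle_sets S u - {c, d} \<union> {c \<union> d}"
    then show "cyclic_on ?v e"
      using cyc transpose_comp_outside[OF u, of e a b] cycle_sets_disjoint[OF u, of e] ab c by blast
  qed
qed

section \<open>Polynomials of coloured cycle types\<close>

lemma scale_eq_mult:
  fixes f :: ppoly
  shows "c *\<^sub>C f = Poly_Mapping.single 0 c * f"
  by (simp add: scale_def mult_map_scale_conv_mult)

lemma lookup_scale: "Poly_Mapping.lookup (c *\<^sub>C f) x = c * Poly_Mapping.lookup f x"
  by (simp add: scale_def Poly_Mapping.map.rep_eq when_def)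

lemma scale_zero_left: "0 *\<^sub>C f = 0"
  by (rule poly_mapping_eqI) (simp add: lookup_scale)

text \<open>The variable with index \<open>w\<close>, so that the type of a cycle, which is a pair, can be plugged in
  without taking it apart.\<close>

definition pv :: "nat \<times> nat \<Rightarrow> ppoly" where
  "pv w = Poly_Mapping.single (Poly_Mapping.single w 1) 1"

lemma pvar_eq_pv: "pvar \<alpha> k = pv (\<alpha>, k)"
  by (simp add: pvar_def pv_def)

definition cycle_type :: "nat \<Rightarrow> ('a \<Rightarrow> nat) \<Rightarrow> 'a set \<Rightarrow> nat \<times> nat" where
  "cycle_type m g c = ((\<Sum>i\<in>c. g i) mod m, card c)"

definition type_poly :: "nat \<Rightarrow> 'a set \<Rightarrow> ('a \<Rightarrow> 'a) \<Rightarrow> ('a \<Rightarrow> nat) \<Rightarrow> ppoly" where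
  "type_poly m S u g = (\<Prod>c\<in>cycle_sets S u. pv (cycle_type m g c))"

text \<open>The reflections in the class of transpositions send \<open>e\<^sub>a\<close> to \<open>\<zeta>\<^sup>t e\<^sub>b\<close> and \<open>e\<^sub>b\<close> to \<open>\<zeta>\<^sup>-\<^sup>t e\<^sub>a\<close>, where
  \<open>\<zeta> = exp (2 \<pi> \<i> / m)\<close>. Colours matter modulo \<open>m\<close> only, and \<open>m - t\<close> stands for \<open>- t\<close>; for \<open>t = 0\<close>
  this is \<open>m\<close>, which is as good as \<open>0\<close>.\<close>

definition transposition_colour :: "nat \<Rightarrow> 'a \<Rightarrow> 'a \<Rightarrow> nat \<Rightarrow> 'a \<Rightarrow> nat" where
  "transposition_colour m a b t k = (if k = a then t else if k = b then m - t else 0)"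

lemma sum_transposition_colour:
  assumes "finite e" "a \<noteq> b"
  shows "(\<Sum>k\<in>e. transposition_colour m a b t k) =
    (if a \<in> e then t else 0) + (if b \<in> e then m - t else 0)"
proof -
  have "transposition_colour m a b t k = (if k = a then t else 0) + (if k = b then m - t else 0)" for k
    using assms(2) by (simp add: transposition_colour_def)
  then show ?thesis using assms(1) by (simp add: sum.distrib)
qed

text \<open>In a product of coloured permutations the left factor contributes its colour at the image
  point. Over a cycle these images run through the cycle again.\<close>

lemma sum_colour_product:
  assumes "inj_on u e"
  shows "(\<Sum>k\<in>e. g k + h (u k)) = (\<Sum>k\<in>e. g k) + (\<Sum>k\<in>u ` e. h k :: nat)"
  using assms by (simp add: sum.distrib sum.reindex)

lemma cycle_type_unaffected:
  assumes u: "u permutes S" "finite S" and e: "e \<in> cycle_sets S u" "a \<notin> e" "b \<notin> e"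
  shows "cycle_type m (\<lambda>k. g k + transposition_colour m a b t (u k)) e = cycle_type m g e"
proof -
  have "(\<Sum>k\<in>e. g k + transposition_colour m a b t (u k)) = (\<Sum>k\<in>e. g k)"
  proof (rule sum.cong)
    fix k assume "k \<in> e"
    then have "u k \<in> e" using image_cycle_set[OF u e(1)] by blast
    then show "g k + transposition_colour m a b t (u k) = g k"
      using e by (auto simp: transposition_colour_def)
  qed simp
  then show ?thesis by (simp add: cycle_type_def)
qed

text \<open>The joined cycle meets both transposed points, so the colours \<open>t\<close> and \<open>m - t\<close> cancel: its
  colour is the sum of the two old colours, whatever \<open>t\<close> is.\<close>

lemma type_poly_join:
  assumes u: "u permutes S" "finite S" and c: "c \<in> cycle_sets S u" "d \<in> cycle_sets S u" "c \<noteq> d"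
    and ab: "a \<in> c" "b \<in> d" and t: "t \<le> m"
  shows "type_poly m S (transpose a b \<circ> u) (\<lambda>k. g k + transposition_colour m a b t (u k)) =
    pv (((\<Sum>i\<in>c. g i) + (\<Sum>i\<in>d. g i)) mod m, card c + card d) *
    (\<Prod>e\<in>cycle_sets S u - {c, d}. pv (cycle_type m g e))"
proof -
  let ?g = "\<lambda>k. g k + transposition_colour m a b t (u k)"
  let ?Q = "cycle_sets S u - {c, d}"
  have disj: "c \<inter> d = {}" using cycle_sets_disjoint[OF u c] .
  have fin: "finite c" "finite d" using finite_cycle_set[OF u] c by auto
  have "a \<noteq> b" using ab disj by blast
  have inj: "inj_on u (c \<union> d)" using u(1) by (meson inj_on_subset permutes_inj subset_UNIV)
  have "(\<Sum>k\<in>c \<union> d. ?g k) = (\<Sum>i\<in>c. g i) + (\<Sum>i\<in>d. g i) + m"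
    using sum_transposition_colour[of "c \<union> d" a b m t] fin ab t \<open>a \<noteq> b\<close> disj
    by (simp add: sum_colour_product[OF inj] image_Un image_cycle_set[OF u] c sum.union_disjoint)
  then have ty: "cycle_type m ?g (c \<union> d) = (((\<Sum>i\<in>c. g i) + (\<Sum>i\<in>d. g i)) mod m, card c + card d)"
    using fin disj by (simp add: cycle_type_def card_Un_disjoint)
  have other: "cycle_type m ?g e = cycle_type m g e" if "e \<in> ?Q" for e
    using that cycle_type_unaffected[OF u, of e a b] cycle_sets_disjoint[OF u, of e] ab c by blast
  have notin: "c \<union> d \<notin> ?Q"
  proof
    assume "c \<union> d \<in> ?Q"
    then have "(c \<union> d) \<inter> c = {}" using cycle_sets_disjoint[OF u _ c(1), of "c \<union> d"] by blast
    then show False using ab by blast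
  qed
  have "type_poly m S (transpose a b \<circ> u) ?g = (\<Prod>e\<in>insert (c \<union> d) ?Q. pv (cycle_type m ?g e))"
    unfolding type_poly_def cycle_sets_join[OF u c ab] by simp
  also have "\<dots> = pv (cycle_type m ?g (c \<union> d)) * (\<Prod>e\<in>?Q. pv (cycle_type m ?g e))"
    using notin finite_cycle_sets[OF u(2), of u] by (intro prod.insert) auto
  also have "(\<Prod>e\<in>?Q. pv (cycle_type m ?g e)) = (\<Prod>e\<in>?Q. pv (cycle_type m g e))"
    using other by (intro prod.cong) auto
  finally show ?thesis unfolding ty .
qed

text \<open>The numbers \<open>x\<close> and \<open>y\<close> are the colour sums of the two pieces. One piece loses \<open>t\<close> and the other
  gains it, because each piece contains exactly one of the two arrows that end in a transposed
  point.\<close>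

lemma type_poly_split:
  assumes u: "u permutes S" "finite S" and c: "c \<in> cycle_sets S u" "a \<in> c"
    and s: "0 < s" "s < card c"
  shows "\<exists>x y. x + y = (\<Sum>i\<in>c. g i) \<and>
    (\<forall>t\<le>m. type_poly m S (transpose a ((u ^^ s) a) \<circ> u)
        (\<lambda>k. g k + transposition_colour m a ((u ^^ s) a) t (u k)) =
      pv ((x + (m - t)) mod m, s) * pv ((y + t) mod m, card c - s) *
      (\<Prod>e\<in>cycle_sets S u - {c}. pv (cycle_type m g e)))"
proof -
  define b where "b = (u ^^ s) a"
  define c1 where "c1 = (\<lambda>i. (u ^^ i) a) ` {..<s}"
  define c2 where "c2 = (\<lambda>i. (u ^^ i) a) ` {s..<card c}"
  note split = cycle_sets_split[OF u c s, folded b_def c1_def c2_def]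
  let ?Q = "cycle_sets S u - {c}"
  have fin: "finite c1" "finite c2" by (simp_all add: c1_def c2_def)
  have inj: "inj_on u e" for e using u(1) by (meson inj_on_subset permutes_inj subset_UNIV)
  have "a \<noteq> b" 
    using inj_onD[OF cycle_set_iterates(2)[OF u c], of s 0] s unfolding b_def by auto
  have bc: "b \<in> c" unfolding b_def
    using cyclic_on_funpow_in[OF cyclic_on_cycle_set[OF u c(1)] c(2)] .
  have ne: "c1 \<noteq> {}" "c2 \<noteq> {}" using s by (auto simp: c1_def c2_def)
  have notin: "c1 \<notin> ?Q" "c2 \<notin> ?Q" "c1 \<noteq> c2"
    using cycle_sets_disjoint[OF u _ c(1), of c1] cycle_sets_disjoint[OF u _ c(1), of c2]
      split(2,3) ne by blast+
  have mem: "a \<notin> u ` c1" "b \<in> u ` c1" "a \<in> u ` c2" "b \<notin> u ` c2"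
  proof -
    have 1: "a \<notin> X \<and> b \<in> X" if "X \<inter> {a, b} = {b}" for X using that \<open>a \<noteq> b\<close> by auto
    have 2: "b \<notin> X \<and> a \<in> X" if "X \<inter> {a, b} = {a}" for X using that \<open>a \<noteq> b\<close> by auto
    show "a \<notin> u ` c1" "b \<in> u ` c1" "a \<in> u ` c2" "b \<notin> u ` c2"
      using 1[OF split(6)] 2[OF split(7)] by blast+
  qed
  have "type_poly m S (transpose a b \<circ> u) (\<lambda>k. g k + transposition_colour m a b t (u k)) =
      pv (((\<Sum>i\<in>c1. g i) + (m - t)) mod m, s) * pv (((\<Sum>i\<in>c2. g i) + t) mod m, card c - s) *
      (\<Prod>e\<in>?Q. pv (cycle_type m g e))" if t: "t \<le> m" for t
  proof -
    let ?g = "\<lambda>k. g k + transposition_colour m a b t (u k)"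
    have other: "cycle_type m ?g e = cycle_type m g e" if "e \<in> ?Q" for e
      using that cycle_type_unaffected[OF u, of e a b] cycle_sets_disjoint[OF u, of e c] c bc by blast
    have ty1: "cycle_type m ?g c1 = (((\<Sum>i\<in>c1. g i) + (m - t)) mod m, s)"
      using mem fin \<open>a \<noteq> b\<close>
      by (simp add: cycle_type_def split sum_colour_product[OF inj] sum_transposition_colour)
    have ty2: "cycle_type m ?g c2 = (((\<Sum>i\<in>c2. g i) + t) mod m, card c - s)"
      using mem fin \<open>a \<noteq> b\<close>
      by (simp add: cycle_type_def split sum_colour_product[OF inj] sum_transposition_colour)
    have "type_poly m S (transpose a b \<circ> u) ?g = (\<Prod>e\<in>insert c1 (insert c2 ?Q). pv (cycle_type m ?g e))"
      unfolding type_poly_def split(1) by (simp add: insert_commute)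
    also have "\<dots> = pv (cycle_type m ?g c1) * (pv (cycle_type m ?g c2) *
        (\<Prod>e\<in>?Q. pv (cycle_type m ?g e)))"
      using notin finite_cycle_sets[OF u(2), of u] by simp
    also have "(\<Prod>e\<in>?Q. pv (cycle_type m ?g e)) = (\<Prod>e\<in>?Q. pv (cycle_type m g e))"
      using other by (intro prod.cong) auto
    finally show ?thesis unfolding ty1 ty2 mult.assoc .
  qed
  moreover have "(\<Sum>i\<in>c1. g i) + (\<Sum>i\<in>c2. g i) = (\<Sum>i\<in>c. g i)"
    using sum.union_disjoint[OF fin split(3), of g] split(2) by simp
  ultimately show ?thesis unfolding b_def[symmetric] by blast
qed

text \<open>As \<open>t\<close> runs through the residues, the pairs of colours \<open>(x - t, y + t)\<close> run exactly once through
  all pairs with the given sum. This turns the sum over the reflections that cut a cycle at two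
  given points into the sum over \<open>\<alpha> + \<gamma> = r\<close> of the cut operator.\<close>

lemma sum_opposite_shifts:
  fixes F :: "nat \<Rightarrow> nat \<Rightarrow> 'b::comm_monoid_add"
  assumes "m \<ge> 1"
  shows "(\<Sum>t<m. F ((x + (m - t)) mod m) ((y + t) mod m)) =
    (\<Sum>(\<alpha>, \<gamma>)\<in>{..<m} \<times> {..<m}. if (\<alpha> + \<gamma>) mod m = (x + y) mod m then F \<alpha> \<gamma> else 0)"
proof -
  let ?A = "{(\<alpha>, \<gamma>). \<alpha> < m \<and> \<gamma> < m \<and> (\<alpha> + \<gamma>) mod m = (x + y) mod m}"
  let ?i = "\<lambda>t. ((x + (m - t)) mod m, (y + t) mod m)"
  let ?j = "\<lambda>(\<alpha>, \<gamma>). (\<gamma> + (m - y mod m)) mod m"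
  have yl: "y mod m < m" using assms by simp
  have "(\<Sum>t<m. F ((x + (m - t)) mod m) ((y + t) mod m)) = (\<Sum>(\<alpha>, \<gamma>)\<in>?A. F \<alpha> \<gamma>)"
  proof (rule sum.reindex_bij_witness[of _ ?j ?i])
    fix t assume t: "t \<in> {..<m}"
    have "((y + t) mod m + (m - y mod m)) mod m = (t + (y mod m + (m - y mod m))) mod m"
      by (metis (no_types, lifting) add.assoc add.commute mod_add_left_eq mod_add_right_eq)
    also have "\<dots> = t" using t yl by simp
    finally show "?j (?i t) = t" by simp
    have "((x + (m - t)) mod m + (y + t) mod m) mod m = (x + y + m) mod m"
    proof -
      have "x + (m - t) + (y + t) = x + y + m" using t by simp
      then show ?thesis by (simp only: mod_add_eq)
    qed
    then show "?i t \<in> ?A" using assms by simp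
  next
    fix p assume p: "p \<in> ?A"
    obtain \<alpha> \<gamma> where [simp]: "p = (\<alpha>, \<gamma>)" by fastforce
    have l: "\<alpha> < m" "\<gamma> < m" and e: "(\<alpha> + \<gamma>) mod m = (x + y) mod m" using p by auto
    define t where "t = (\<gamma> + (m - y mod m)) mod m"
    have tl: "t < m" using assms by (simp add: t_def)
    have "(y + t) mod m = (\<gamma> + (y mod m + (m - y mod m))) mod m"
      unfolding t_def by (metis (no_types, lifting) add.assoc add.commute mod_add_left_eq mod_add_right_eq)
    also have "\<dots> = \<gamma>" using l yl by simp
    finally have 1: "(y + t) mod m = \<gamma>" .
    have "((x + (m - t)) + \<gamma>) mod m = ((x + (m - t)) + (y + t)) mod m"
      by (metis 1 mod_add_right_eq)
    also have "(x + (m - t)) + (y + t) = x + y + m" using tl by simp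
    finally have "((x + (m - t)) + \<gamma>) mod m = (\<alpha> + \<gamma>) mod m" using e by simp
    then have "(x + (m - t)) mod m = \<alpha> mod m"
      by (metis cong_def cong_add_rcancel_nat)
    then have "(x + (m - t)) mod m = \<alpha>" using l by simp
    then show "?i (?j p) = p" using 1 by (simp add: t_def)
    show "?j p \<in> {..<m}" using tl by (simp add: t_def)
  qed simp
  also have "\<dots> = (\<Sum>(\<alpha>, \<gamma>)\<in>{..<m} \<times> {..<m}. if (\<alpha> + \<gamma>) mod m = (x + y) mod m then F \<alpha> \<gamma> else 0)"
    by (intro sum.mono_neutral_cong_left) (auto split: if_splits)
  finally show ?thesis .
qed

text \<open>What replaces the variable of a cycle of length \<open>l\<close> and colour \<open>r\<close> when it is cut in all ways:
  the sum of \<open>p\<^sub>i\<^sup>\<alpha> p\<^sub>j\<^sup>\<gamma>\<close> over \<open>i + j = l\<close> and \<open>\<alpha> + \<gamma> = r\<close>.\<close>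

definition cut_poly :: "nat \<Rightarrow> nat \<Rightarrow> nat \<Rightarrow> ppoly" where
  "cut_poly m r l = (\<Sum>i\<in>{1..<l}. \<Sum>(\<alpha>, \<gamma>)\<in>{..<m} \<times> {..<m}.
     if (\<alpha> + \<gamma>) mod m = r then pv (\<alpha>, i) * pv (\<gamma>, l - i) else 0)"

text \<open>With \<open>a\<close> fixed, the second point is \<open>u\<^sup>s a\<close> for a unique \<open>s\<close>, and \<open>s\<close> is the length of the first
  piece. The result does not depend on \<open>a\<close>.\<close>

lemma sum_type_poly_split:
  assumes u: "u permutes S" "finite S" and c: "c \<in> cycle_sets S u" "a \<in> c" and m: "m \<ge> 1"
  shows "(\<Sum>b\<in>c - {a}. \<Sum>t<m. type_poly m S (transpose a b \<circ> u)
        (\<lambda>k. g k + transposition_colour m a b t (u k))) =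
    cut_poly m ((\<Sum>i\<in>c. g i) mod m) (card c) *
    (\<Prod>e\<in>cycle_sets S u - {c}. pv (cycle_type m g e))"
proof -
  let ?R = "\<Prod>e\<in>cycle_sets S u - {c}. pv (cycle_type m g e)"
  let ?W = "\<lambda>b t. type_poly m S (transpose a b \<circ> u) (\<lambda>k. g k + transposition_colour m a b t (u k))"
  let ?p = "\<lambda>s. (u ^^ s) a"
  note it = cycle_set_iterates[OF u c]
  have pos: "card c > 0" using card_cycle_set_pos[OF u c(1)] .
  have "c - {a} = ?p ` {..<card c} - ?p ` {0}" using it(1) by simp
  also have "\<dots> = ?p ` ({..<card c} - {0})"
    using it(2) pos by (intro inj_on_image_set_diff[symmetric, OF it(2)]) auto
  also have "{..<card c} - {0} = {1..<card c}" by auto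
  finally have im: "c - {a} = ?p ` {1..<card c}" .
  have inj: "inj_on ?p {1..<card c}" using it(2) by (rule inj_on_subset) auto
  have "(\<Sum>b\<in>c - {a}. \<Sum>t<m. ?W b t) = (\<Sum>s\<in>{1..<card c}. \<Sum>t<m. ?W (?p s) t)"
    unfolding im by (simp only: sum.reindex[OF inj] o_def)
  also have "\<dots> = (\<Sum>s\<in>{1..<card c}. (\<Sum>(\<alpha>, \<gamma>)\<in>{..<m} \<times> {..<m}.
     if (\<alpha> + \<gamma>) mod m = (\<Sum>i\<in>c. g i) mod m then pv (\<alpha>, s) * pv (\<gamma>, card c - s) else 0) * ?R)"
  proof (rule sum.cong)
    fix s assume s: "s \<in> {1..<card c}"
    then obtain x y where xy: "x + y = (\<Sum>i\<in>c. g i)"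
      and W: "\<And>t. t \<le> m \<Longrightarrow> ?W (?p s) t = pv ((x + (m - t)) mod m, s) * pv ((y + t) mod m, card c - s) * ?R"
      using type_poly_split[OF u c, where s = s and m = m and g = g] by auto
    have "(\<Sum>t<m. ?W (?p s) t) =
        (\<Sum>t<m. pv ((x + (m - t)) mod m, s) * pv ((y + t) mod m, card c - s)) * ?R"
      unfolding sum_distrib_right by (intro sum.cong) (auto simp: W)
    also have "(\<Sum>t<m. pv ((x + (m - t)) mod m, s) * pv ((y + t) mod m, card c - s)) =
        (\<Sum>(\<alpha>, \<gamma>)\<in>{..<m} \<times> {..<m}.
          if (\<alpha> + \<gamma>) mod m = (x + y) mod m then pv (\<alpha>, s) * pv (\<gamma>, card c - s) else 0)"
      by (rule sum_opposite_shifts[OF m, of "\<lambda>\<alpha> \<gamma>. pv (\<alpha>, s) * pv (\<gamma>, card c - s)"])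
    finally show "(\<Sum>t<m. ?W (?p s) t) = (\<Sum>(\<alpha>, \<gamma>)\<in>{..<m} \<times> {..<m}.
      if (\<alpha> + \<gamma>) mod m = (\<Sum>i\<in>c. g i) mod m then pv (\<alpha>, s) * pv (\<gamma>, card c - s) else 0) * ?R"
      unfolding xy .
  qed simp
  finally show ?thesis by (simp add: cut_poly_def sum_distrib_right)
qed

text \<open>The left factor \<open>card c\<close> counts the starting points \<open>a\<close> of a cut. A join of two cycles arises
  from \<open>card c * card d\<close> pairs of points and from each of the \<open>m\<close> values of \<open>t\<close>. Pairs of points,
  and of cycles, are ordered.\<close>

lemma sum_type_poly_transpositions:
  assumes u: "u permutes S" "finite S" and m: "m \<ge> 1"
  shows "(\<Sum>a\<in>S. \<Sum>b\<in>S - {a}. \<Sum>t<m. type_poly m S (transpose a b \<circ> u)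
        (\<lambda>k. g k + transposition_colour m a b t (u k))) =
    (\<Sum>c\<in>cycle_sets S u. of_nat (card c) * cut_poly m ((\<Sum>i\<in>c. g i) mod m) (card c) *
       (\<Prod>e\<in>cycle_sets S u - {c}. pv (cycle_type m g e))) +
    (\<Sum>c\<in>cycle_sets S u. \<Sum>d\<in>cycle_sets S u - {c}. of_nat (m * card c * card d) *
       pv (((\<Sum>i\<in>c. g i) + (\<Sum>i\<in>d. g i)) mod m, card c + card d) *
       (\<Prod>e\<in>cycle_sets S u - {c, d}. pv (cycle_type m g e)))"
proof -
  let ?W = "\<lambda>a b. \<Sum>t<m. type_poly m S (transpose a b \<circ> u) (\<lambda>k. g k + transposition_colour m a b t (u k))"
  let ?Q = "cycle_sets S u"
  let ?C = "\<lambda>c. cut_poly m ((\<Sum>i\<in>c. g i) mod m) (card c) * (\<Prod>e\<in>?Q - {c}. pv (cycle_type m g e))"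
  let ?J = "\<lambda>c d. pv (((\<Sum>i\<in>c. g i) + (\<Sum>i\<in>d. g i)) mod m, card c + card d) *
       (\<Prod>e\<in>?Q - {c, d}. pv (cycle_type m g e))"
  have finQ: "finite ?Q" using finite_cycle_sets[OF u(2)] .
  have fin: "finite c" if "c \<in> ?Q" for c using finite_cycle_set[OF u that] .
  \<comment> \<open>a second point in the cycle of \<open>a\<close> cuts it, one in another cycle joins the two\<close>
  have row: "(\<Sum>b\<in>S - {a}. ?W a b) = ?C c + (\<Sum>d\<in>?Q - {c}. of_nat (m * card d) * ?J c d)"
    if c: "c \<in> ?Q" and a: "a \<in> c" for c a
  proof -
    have Sc: "S - {a} = (c - {a}) \<union> \<Union> (?Q - {c})"
    proof -
      have "a \<notin> \<Union> (?Q - {c})" using cycle_sets_disjoint[OF u _ c] a by blast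
      moreover have "S = c \<union> \<Union> (?Q - {c})" using Union_cycle_sets[OF u] c by blast
      ultimately show ?thesis by blast
    qed
    have disj: "(c - {a}) \<inter> \<Union> (?Q - {c}) = {}"
    proof -
      have "c \<inter> d = {}" if "d \<in> ?Q - {c}" for d using cycle_sets_disjoint[OF u c, of d] that by auto
      then show ?thesis by blast
    qed
    have "(\<Sum>b\<in>S - {a}. ?W a b) = (\<Sum>b\<in>c - {a}. ?W a b) + (\<Sum>b\<in>\<Union> (?Q - {c}). ?W a b)"
      unfolding Sc using fin c finQ disj by (intro sum.union_disjoint) auto
    also have "(\<Sum>b\<in>c - {a}. ?W a b) = ?C c" using sum_type_poly_split[OF u c a m] .
    also have "(\<Sum>b\<in>\<Union> (?Q - {c}). ?W a b) = (\<Sum>d\<in>?Q - {c}. \<Sum>b\<in>d. ?W a b)"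
      using fin cycle_sets_disjoint[OF u] by (subst sum.Union_disjoint) auto
    also have "\<dots> = (\<Sum>d\<in>?Q - {c}. of_nat (m * card d) * ?J c d)"
    proof (rule sum.cong)
      fix d assume d: "d \<in> ?Q - {c}"
      have "?W a b = of_nat m * ?J c d" if b: "b \<in> d" for b
      proof -
        have "?W a b = (\<Sum>t<m. ?J c d)"
          using d by (intro sum.cong refl type_poly_join[OF u c _ _ a b]) auto
        then show ?thesis by simp
      qed
      then show "(\<Sum>b\<in>d. ?W a b) = of_nat (m * card d) * ?J c d" by (simp add: mult_ac)
    qed simp
    finally show ?thesis .
  qed
  have "(\<Sum>a\<in>S. \<Sum>b\<in>S - {a}. ?W a b) = (\<Sum>c\<in>?Q. \<Sum>a\<in>c. \<Sum>b\<in>S - {a}. ?W a b)"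
    by (rule sum_over_cycle_sets[OF u])
  also have "\<dots> = (\<Sum>c\<in>?Q. of_nat (card c) * (?C c + (\<Sum>d\<in>?Q - {c}. of_nat (m * card d) * ?J c d)))"
    by (intro sum.cong) (simp_all add: row)
  also have "\<dots> = (\<Sum>c\<in>?Q. of_nat (card c) * ?C c) +
      (\<Sum>c\<in>?Q. \<Sum>d\<in>?Q - {c}. of_nat (m * card c * card d) * ?J c d)"
    by (simp add: distrib_left sum.distrib sum_distrib_left mult_ac)
  finally show ?thesis by (simp add: mult.assoc)
qed

section \<open>The differential operators on products of variables\<close>

lemma of_nat_scale: "of_nat k *\<^sub>C (f :: ppoly) = of_nat k * f"
  by (simp add: scale_eq_mult)

text \<open>Linearity of the derivative, its commutation with other derivatives and its vanishing on
  polynomials of small degree can be read off from its coefficients. Truncated subtraction of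
  exponents does no harm, since \<open>\<nu> - e = \<mu>\<close> determines \<open>\<nu>\<close> as soon as \<open>\<nu>\<close> contains the variable.\<close>

lemma lookup_pdiff:
  "Poly_Mapping.lookup (pdiff \<alpha> k f) \<mu> =
    of_nat (Poly_Mapping.lookup \<mu> (\<alpha>, k) + 1) *
    Poly_Mapping.lookup f (\<mu> + Poly_Mapping.single (\<alpha>, k) 1)"
proof -
  let ?e = "Poly_Mapping.single (\<alpha>, k) (1::nat)"
  let ?n = "\<lambda>\<nu>. Poly_Mapping.lookup \<nu> (\<alpha>, k)"
  have shift: "\<nu> - ?e = \<mu> \<longleftrightarrow> \<nu> = \<mu> + ?e" if "?n \<nu> \<noteq> 0" for \<nu> :: pmonom
  proof
    assume "\<nu> - ?e = \<mu>"
    then have "\<mu> + ?e = (\<nu> - ?e) + ?e" by simp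
    also have "\<dots> = \<nu>"
      by (rule poly_mapping_eqI) (use that in \<open>auto simp: lookup_add lookup_minus lookup_single when_def\<close>)
    finally show "\<nu> = \<mu> + ?e" ..
  qed (simp add: poly_mapping_eq_iff fun_eq_iff lookup_add lookup_minus)
  have "Poly_Mapping.lookup (pdiff \<alpha> k f) \<mu> =
      (\<Sum>\<nu>\<in>Poly_Mapping.keys f. of_nat (?n \<nu>) * Poly_Mapping.lookup f \<nu> when \<nu> - ?e = \<mu>)"
    by (simp add: pdiff_def lookup_sum lookup_single)
  also have "\<dots> = (\<Sum>\<nu>\<in>Poly_Mapping.keys f. if \<nu> = \<mu> + ?e then of_nat (?n \<nu>) * Poly_Mapping.lookup f \<nu> else 0)"
  proof (rule sum.cong)
    fix \<nu>
    show "(of_nat (?n \<nu>) * Poly_Mapping.lookup f \<nu> when \<nu> - ?e = \<mu>) =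
        (if \<nu> = \<mu> + ?e then of_nat (?n \<nu>) * Poly_Mapping.lookup f \<nu> else 0)"
      using shift[of \<nu>] by (cases "?n \<nu> = 0") (auto simp: when_def)
  qed simp
  also have "\<dots> = of_nat (?n \<mu> + 1) * Poly_Mapping.lookup f (\<mu> + ?e)"
    by (auto simp: lookup_add in_keys_iff)
  finally show ?thesis .
qed

lemma pdiff_add: "pdiff \<alpha> k (f + g) = pdiff \<alpha> k f + pdiff \<alpha> k g"
  by (rule poly_mapping_eqI) (simp add: lookup_pdiff lookup_add distrib_left)

lemma pdiff_scale: "pdiff \<alpha> k (c *\<^sub>C f) = c *\<^sub>C pdiff \<alpha> k f"
  by (rule poly_mapping_eqI) (simp add: lookup_pdiff lookup_scale)

lemma pdiff_zero: "pdiff \<alpha> k 0 = 0"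
  by (rule poly_mapping_eqI) (simp add: lookup_pdiff)

lemma pdiff_sum: "pdiff \<alpha> k (\<Sum>x\<in>A. f x) = (\<Sum>x\<in>A. pdiff \<alpha> k (f x))"
  by (induction A rule: infinite_finite_induct) (simp_all add: pdiff_zero pdiff_add)

lemma pdiff_commute: "pdiff \<alpha> i (pdiff \<gamma> j f) = pdiff \<gamma> j (pdiff \<alpha> i f)"
  by (rule poly_mapping_eqI)
    (auto simp: lookup_pdiff lookup_add lookup_single when_def add_ac mult_ac)

lemma monom_deg_ge: "k * Poly_Mapping.lookup \<mu> (\<alpha>, k) \<le> monom_deg \<mu>"
proof (cases "(\<alpha>, k) \<in> Poly_Mapping.keys \<mu>")
  case True
  then show ?thesis
    using member_le_sum[of "(\<alpha>, k)" "Poly_Mapping.keys \<mu>" "\<lambda>(\<alpha>, k). k * Poly_Mapping.lookup \<mu> (\<alpha>, k)"]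
    by (simp add: monom_deg_def)
qed (simp add: in_keys_iff)

lemma pdiff_eq_0:
  assumes "f \<in> poly_component m n" "k > n"
  shows "pdiff \<alpha> k f = 0"
proof (rule poly_mapping_eqI)
  fix \<mu> :: pmonom
  let ?\<nu> = "\<mu> + Poly_Mapping.single (\<alpha>, k) 1"
  have "k \<le> monom_deg ?\<nu>"
    using monom_deg_ge[of k ?\<nu> \<alpha>] by (simp add: lookup_add)
  then have "?\<nu> \<notin> Poly_Mapping.keys f" using assms by (auto simp: poly_component_def)
  then show "Poly_Mapping.lookup (pdiff \<alpha> k f) \<mu> = Poly_Mapping.lookup 0 \<mu>"
    by (simp add: lookup_pdiff in_keys_iff)
qed

lemma prod_pv_eq_single:
  "(\<Prod>c\<in>Q. pv (ty c)) = Poly_Mapping.single (\<Sum>c\<in>Q. Poly_Mapping.single (ty c) 1) 1"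
  by (induction Q rule: infinite_finite_induct) (simp_all add: pv_def mult_single)

lemma lookup_sum_single:
  assumes "finite Q"
  shows "Poly_Mapping.lookup (\<Sum>c\<in>Q. Poly_Mapping.single (ty c) (1::nat)) w = card {c \<in> Q. ty c = w}"
proof -
  have "Poly_Mapping.lookup (\<Sum>c\<in>Q. Poly_Mapping.single (ty c) (1::nat)) w = (\<Sum>c\<in>Q. if ty c = w then 1 else 0)"
    by (simp add: lookup_sum lookup_single when_def del: One_nat_def)
  then show ?thesis using assms by (simp add: sum.If_cases Int_def)
qed

lemma sum_single_const:
  "(\<Sum>c\<in>C. Poly_Mapping.single \<nu> (1::complex)) = Poly_Mapping.single \<nu> (of_nat (card C))"
  by (induction C rule: infinite_finite_induct) (simp_all flip: single_add)

text \<open>The product rule for a product of variables. On monomials both sides have the same exponent,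
  and the number of summands is the multiplicity of the variable.\<close>

lemma pdiff_prod_pv:
  assumes Q: "finite Q"
  shows "pdiff \<alpha> k (\<Prod>c\<in>Q. pv (ty c)) = (\<Sum>c\<in>{c \<in> Q. ty c = (\<alpha>, k)}. \<Prod>e\<in>Q - {c}. pv (ty e))"
proof -
  let ?\<mu> = "\<Sum>c\<in>Q. Poly_Mapping.single (ty c) (1::nat)"
  let ?w = "(\<alpha>, k)" and ?C = "{c \<in> Q. ty c = (\<alpha>, k)}"
  let ?\<nu> = "?\<mu> - Poly_Mapping.single ?w 1"
  have "(\<Sum>e\<in>Q - {c}. Poly_Mapping.single (ty e) 1) = ?\<nu>" if "c \<in> ?C" for c
    using that sum.remove[OF Q, of c "\<lambda>c. Poly_Mapping.single (ty c) (1::nat)"] by simp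
  then have "(\<Sum>c\<in>?C. \<Prod>e\<in>Q - {c}. pv (ty e)) = (\<Sum>c\<in>?C. Poly_Mapping.single ?\<nu> 1)"
    by (intro sum.cong) (simp_all add: prod_pv_eq_single)
  also have "\<dots> = Poly_Mapping.single ?\<nu> (of_nat (card ?C))"
    by (rule sum_single_const)
  also have "\<dots> = pdiff \<alpha> k (\<Prod>c\<in>Q. pv (ty c))"
    using lookup_sum_single[OF Q, of ty ?w] by (simp add: prod_pv_eq_single pdiff_def)
  finally show ?thesis ..
qed

lemma pdiff_prod_pv_if:
  assumes Q: "finite Q"
  shows "pdiff \<alpha> k (\<Prod>c\<in>Q. pv (ty c)) = (\<Sum>c\<in>Q. if ty c = (\<alpha>, k) then \<Prod>e\<in>Q - {c}. pv (ty e) else 0)"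
  unfolding pdiff_prod_pv[OF Q] using Q by (simp add: sum.inter_filter)

definition cut_term :: "nat \<Rightarrow> ppoly \<Rightarrow> nat \<times> nat \<times> nat \<times> nat \<Rightarrow> ppoly" where
  "cut_term m f = (\<lambda>(i, j, \<alpha>, \<gamma>). of_nat (i + j) *
     (pv (\<alpha>, i) * pv (\<gamma>, j) * pdiff ((\<alpha> + \<gamma>) mod m) (i + j) f))"

definition join_term :: "nat \<Rightarrow> ppoly \<Rightarrow> nat \<times> nat \<times> nat \<times> nat \<Rightarrow> ppoly" where
  "join_term m f = (\<lambda>(i, j, \<alpha>, \<gamma>). of_nat (m * i * j) *
     (pv ((\<alpha> + \<gamma>) mod m, i + j) * pdiff \<alpha> i (pdiff \<gamma> j f)))"

text \<open>On polynomials of degree \<open>n\<close> all summands of the operators with an index above \<open>n\<close> vanish, so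
  the infinite sums can be taken over this finite set.\<close>

definition index_box :: "nat \<Rightarrow> nat \<Rightarrow> (nat \<times> nat \<times> nat \<times> nat) set" where
  "index_box m n = {1..n} \<times> {1..n} \<times> {..<m} \<times> {..<m}"

text \<open>Twice the cut-and-join operator: the factor \<open>1 / 2\<close> is split off because the sums over ordered
  pairs of points, with which this operator is compared, meet every reflection twice.\<close>

definition cut_join :: "nat \<Rightarrow> nat \<Rightarrow> ppoly \<Rightarrow> ppoly" where
  "cut_join m n f = (\<Sum>p\<in>index_box m n. cut_term m f p + join_term m f p)"

definition recolour :: "nat \<Rightarrow> nat \<Rightarrow> nat \<Rightarrow> ppoly \<Rightarrow> ppoly" where
  "recolour m n k f = (\<Sum>(i, \<alpha>)\<in>{1..n} \<times> {..<m}. of_nat i * (pv ((\<alpha> + k) mod m, i) * pdiff \<alpha> i f))"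

lemma Sum_any_eq_cut_join:
  assumes f: "f \<in> poly_component m n"
  shows "Sum_any (\<lambda>(i, j, \<alpha>, \<gamma>).
      if 1 \<le> i \<and> 1 \<le> j \<and> \<alpha> < m \<and> \<gamma> < m then
        of_nat (i + j) *\<^sub>C (pvar \<alpha> i * pvar \<gamma> j * pdiff ((\<alpha> + \<gamma>) mod m) (i + j) f) +
        of_nat (m * i * j) *\<^sub>C (pvar ((\<alpha> + \<gamma>) mod m) (i + j) * pdiff \<alpha> i (pdiff \<gamma> j f))
      else 0) = cut_join m n f" (is "Sum_any ?F = _")
proof -
  have zero: "pdiff ((\<alpha> + \<gamma>) mod m) (i + j) f = 0 \<and> pdiff \<alpha> i (pdiff \<gamma> j f) = 0"
    if "i > n \<or> j > n" for i j \<alpha> \<gamma>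
  proof
    show "pdiff ((\<alpha> + \<gamma>) mod m) (i + j) f = 0" using that by (intro pdiff_eq_0[OF f]) auto
    show "pdiff \<alpha> i (pdiff \<gamma> j f) = 0"
      using that pdiff_eq_0[OF f] by (metis pdiff_commute pdiff_zero)
  qed
  have "Sum_any ?F = (\<Sum>p\<in>index_box m n. ?F p)"
  proof (rule Sum_any.expand_superset)
    show "finite (index_box m n)" by (simp add: index_box_def)
    show "{p. ?F p \<noteq> 0} \<subseteq> index_box m n"
    proof
      fix p assume p: "p \<in> {p. ?F p \<noteq> 0}"
      obtain i j \<alpha> \<gamma> where [simp]: "p = (i, j, \<alpha>, \<gamma>)" by (metis prod.exhaust)
      have "1 \<le> i \<and> 1 \<le> j \<and> \<alpha> < m \<and> \<gamma> < m" using p by (auto split: if_splits)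
      moreover have "i \<le> n \<and> j \<le> n"
      proof (rule ccontr)
        assume "\<not> ?thesis"
        then have "i > n \<or> j > n" by auto
        from zero[OF this, of \<alpha> \<gamma>] have "?F p = 0" by (simp add: scale_eq_mult)
        then show False using p by blast
      qed
      ultimately show "p \<in> index_box m n" by (simp add: index_box_def)
    qed
  qed
  also have "\<dots> = cut_join m n f"
    unfolding cut_join_def
    by (intro sum.cong) (auto simp: index_box_def cut_term_def join_term_def of_nat_scale pvar_eq_pv
        simp del: of_nat_add of_nat_mult)
  finally show ?thesis .
qed

lemma Sum_any_eq_recolour:
  assumes f: "f \<in> poly_component m n"
  shows "Sum_any (\<lambda>(i, \<alpha>).
      if 1 \<le> i \<and> \<alpha> < m then of_nat i *\<^sub>C (pvar ((\<alpha> + k) mod m) i * pdiff \<alpha> i f) else 0) =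
    recolour m n k f" (is "Sum_any ?F = _")
proof -
  have "Sum_any ?F = (\<Sum>p\<in>{1..n} \<times> {..<m}. ?F p)"
  proof (rule Sum_any.expand_superset)
    show "{p. ?F p \<noteq> 0} \<subseteq> {1..n} \<times> {..<m}"
    proof
      fix p assume p: "p \<in> {p. ?F p \<noteq> 0}"
      obtain i \<alpha> where [simp]: "p = (i, \<alpha>)" by fastforce
      have "1 \<le> i \<and> \<alpha> < m" using p by (auto split: if_splits)
      moreover have "i \<le> n"
      proof (rule ccontr)
        assume "\<not> i \<le> n"
        then have "?F p = 0" using pdiff_eq_0[OF f, of i \<alpha>] by (simp add: scale_eq_mult)
        then show False using p by blast
      qed
      ultimately show "p \<in> {1..n} \<times> {..<m}" by simp
    qed
  qed simp
  also have "\<dots> = recolour m n k f"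
    unfolding recolour_def by (intro sum.cong) (auto simp: of_nat_scale pvar_eq_pv)
  finally show ?thesis .
qed

lemma cut_sum_at:
  assumes "l \<le> n"
  shows "(\<Sum>(i, j, \<alpha>, \<gamma>)\<in>index_box m n.
      if (r, l) = ((\<alpha> + \<gamma>) mod m, i + j) then of_nat (i + j) * (pv (\<alpha>, i) * pv (\<gamma>, j) * R) else 0) =
    of_nat l * cut_poly m r l * R"
proof -
  let ?G = "\<lambda>i j. \<Sum>(\<alpha>, \<gamma>)\<in>{..<m} \<times> {..<m}. if (\<alpha> + \<gamma>) mod m = r then pv (\<alpha>, i) * pv (\<gamma>, j) else 0"
  have "(\<Sum>(i, j, \<alpha>, \<gamma>)\<in>index_box m n.
      if (r, l) = ((\<alpha> + \<gamma>) mod m, i + j) then of_nat (i + j) * (pv (\<alpha>, i) * pv (\<gamma>, j) * R) else 0) =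
    (\<Sum>i\<in>{1..n}. \<Sum>j\<in>{1..n}. if i + j = l then of_nat l * ?G i j * R else 0)"
    unfolding index_box_def sum.cartesian_product[symmetric] sum_distrib_left sum_distrib_right
    by (intro sum.cong refl) (auto simp: sum_distrib_left sum_distrib_right mult_ac intro!: sum.cong)
  also have "\<dots> = (\<Sum>i\<in>{1..n}. if i < l then of_nat l * ?G i (l - i) * R else 0)"
  proof (rule sum.cong)
    fix i assume i: "i \<in> {1..n}"
    have "(\<Sum>j\<in>{1..n}. if i + j = l then of_nat l * ?G i j * R else 0) =
        (\<Sum>j\<in>{1..n}. if j = l - i then (if i < l then of_nat l * ?G i (l - i) * R else 0) else 0)"
    proof (rule sum.cong)
      fix j assume "j \<in> {1..n}"
      show "(if i + j = l then of_nat l * ?G i j * R else 0) =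
          (if j = l - i then (if i < l then of_nat l * ?G i (l - i) * R else 0) else 0)"
      proof (cases "i + j = l")
        case True
        then have j: "l - i = j" and "i < l" using \<open>j \<in> {1..n}\<close> by auto
        then show ?thesis unfolding j using True by simp
      qed auto
    qed simp
    also have "\<dots> = (if i < l then of_nat l * ?G i (l - i) * R else 0)"
      using i assms by (subst sum.delta) auto
    finally show "(\<Sum>j\<in>{1..n}. if i + j = l then of_nat l * ?G i j * R else 0) =
        (if i < l then of_nat l * ?G i (l - i) * R else 0)" .
  qed simp
  also have "\<dots> = (\<Sum>i\<in>{1..<l}. of_nat l * ?G i (l - i) * R)"
    using assms by (intro sum.mono_neutral_cong_right) auto
  also have "\<dots> = of_nat l * cut_poly m r l * R"
    by (simp add: cut_poly_def sum_distrib_left sum_distrib_right)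
  finally show ?thesis .
qed

text \<open>A first derivative removes one factor of the product and a second derivative removes another,
  different one. So the cut part becomes a sum over factors and the join part a sum over ordered
  pairs of different factors, and each factor or pair selects those indices that are its type.\<close>

lemma cut_join_prod_pv:
  assumes Q: "finite Q" and ty: "\<And>c. c \<in> Q \<Longrightarrow> fst (ty c) < m \<and> 1 \<le> snd (ty c) \<and> snd (ty c) \<le> n"
  shows "cut_join m n (\<Prod>c\<in>Q. pv (ty c)) =
    (\<Sum>c\<in>Q. of_nat (snd (ty c)) * cut_poly m (fst (ty c)) (snd (ty c)) * (\<Prod>e\<in>Q - {c}. pv (ty e))) +
    (\<Sum>c\<in>Q. \<Sum>d\<in>Q - {c}. of_nat (m * snd (ty c) * snd (ty d)) *
       pv ((fst (ty c) + fst (ty d)) mod m, snd (ty c) + snd (ty d)) * (\<Prod>e\<in>Q - {c, d}. pv (ty e)))"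
proof -
  let ?P = "\<Prod>c\<in>Q. pv (ty c)" and ?B = "index_box m n"
  let ?R = "\<lambda>c. \<Prod>e\<in>Q - {c}. pv (ty e)" and ?R2 = "\<lambda>c d. \<Prod>e\<in>Q - {c, d}. pv (ty e)"
  have fin: "finite ?B" by (simp add: index_box_def)
  have "(\<Sum>p\<in>?B. cut_term m ?P p) = (\<Sum>p\<in>?B. \<Sum>c\<in>Q. case p of (i, j, \<alpha>, \<gamma>) \<Rightarrow>
      if ty c = ((\<alpha> + \<gamma>) mod m, i + j) then of_nat (i + j) * (pv (\<alpha>, i) * pv (\<gamma>, j) * ?R c) else 0)"
    by (intro sum.cong refl)
      (auto simp: cut_term_def pdiff_prod_pv_if[OF Q] sum_distrib_left if_distrib[of "(*) _"] cong: if_cong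
        simp del: of_nat_add)
  also have "\<dots> = (\<Sum>c\<in>Q. \<Sum>p\<in>?B. case p of (i, j, \<alpha>, \<gamma>) \<Rightarrow>
      if ty c = ((\<alpha> + \<gamma>) mod m, i + j) then of_nat (i + j) * (pv (\<alpha>, i) * pv (\<gamma>, j) * ?R c) else 0)"
    by (rule sum.swap)
  also have "\<dots> = (\<Sum>c\<in>Q. of_nat (snd (ty c)) * cut_poly m (fst (ty c)) (snd (ty c)) * ?R c)"
  proof (rule sum.cong)
    fix c assume "c \<in> Q"
    then show "(\<Sum>p\<in>?B. case p of (i, j, \<alpha>, \<gamma>) \<Rightarrow>
        if ty c = ((\<alpha> + \<gamma>) mod m, i + j) then of_nat (i + j) * (pv (\<alpha>, i) * pv (\<gamma>, j) * ?R c) else 0) =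
      of_nat (snd (ty c)) * cut_poly m (fst (ty c)) (snd (ty c)) * ?R c"
      using cut_sum_at[of "snd (ty c)" n "fst (ty c)" m "?R c"] ty by (simp del: of_nat_add)
  qed simp
  finally have cut: "(\<Sum>p\<in>?B. cut_term m ?P p) =
    (\<Sum>c\<in>Q. of_nat (snd (ty c)) * cut_poly m (fst (ty c)) (snd (ty c)) * ?R c)" .

  \<comment> \<open>the inner derivative removes the factor \<open>d\<close>, the outer one a factor \<open>c\<close> other than \<open>d\<close>\<close>
  have dd: "pdiff \<alpha> i (pdiff \<gamma> j ?P) =
      (\<Sum>d\<in>Q. \<Sum>c\<in>Q - {d}. if ty c = (\<alpha>, i) \<and> ty d = (\<gamma>, j) then ?R2 c d else 0)" for \<alpha> i \<gamma> j
  proof -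
    have "pdiff \<alpha> i (if ty d = (\<gamma>, j) then ?R d else 0) =
        (\<Sum>c\<in>Q - {d}. if ty c = (\<alpha>, i) \<and> ty d = (\<gamma>, j) then ?R2 c d else 0)" for d
    proof (cases "ty d = (\<gamma>, j)")
      case True
      have del2: "Q - {d} - {c} = Q - {c, d}" for c by auto
      show ?thesis using True Q by (simp add: pdiff_prod_pv_if del2 cong: if_cong)
    qed (simp add: pdiff_zero)
    then show ?thesis by (simp add: pdiff_prod_pv_if[OF Q] pdiff_sum)
  qed
  let ?J = "\<lambda>c d. of_nat (m * snd (ty c) * snd (ty d)) *
       pv ((fst (ty c) + fst (ty d)) mod m, snd (ty c) + snd (ty d)) * ?R2 c d"
  have "(\<Sum>p\<in>?B. join_term m ?P p) = (\<Sum>p\<in>?B. \<Sum>d\<in>Q. \<Sum>c\<in>Q - {d}.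
      if p = (snd (ty c), snd (ty d), fst (ty c), fst (ty d)) then ?J c d else 0)"
  proof (rule sum.cong)
    fix p assume "p \<in> ?B"
    obtain i j \<alpha> \<gamma> where p: "p = (i, j, \<alpha>, \<gamma>)" by (metis prod.exhaust)
    show "join_term m ?P p = (\<Sum>d\<in>Q. \<Sum>c\<in>Q - {d}.
      if p = (snd (ty c), snd (ty d), fst (ty c), fst (ty d)) then ?J c d else 0)"
      unfolding p join_term_def prod.case dd sum_distrib_left
      by (intro sum.cong refl) (auto simp: mult.assoc)
  qed simp
  also have "\<dots> = (\<Sum>d\<in>Q. \<Sum>p\<in>?B. \<Sum>c\<in>Q - {d}.
      if p = (snd (ty c), snd (ty d), fst (ty c), fst (ty d)) then ?J c d else 0)"
    by (rule sum.swap)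
  also have "\<dots> = (\<Sum>d\<in>Q. \<Sum>c\<in>Q - {d}. \<Sum>p\<in>?B.
      if p = (snd (ty c), snd (ty d), fst (ty c), fst (ty d)) then ?J c d else 0)"
    by (intro sum.cong refl sum.swap)
  also have "\<dots> = (\<Sum>d\<in>Q. \<Sum>c\<in>Q - {d}. ?J c d)"
    using fin ty by (intro sum.cong refl) (auto simp: sum.delta index_box_def)
  also have "\<dots> = (\<Sum>c\<in>Q. \<Sum>d\<in>Q - {c}. ?J c d)"
    by (intro sum.cong refl) (simp_all add: insert_commute add.commute mult_ac)
  finally have join: "(\<Sum>p\<in>?B. join_term m ?P p) = (\<Sum>c\<in>Q. \<Sum>d\<in>Q - {c}. ?J c d)" .
  show ?thesis unfolding cut_join_def sum.distrib cut join ..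
qed

lemma recolour_prod_pv:
  assumes Q: "finite Q" and ty: "\<And>c. c \<in> Q \<Longrightarrow> fst (ty c) < m \<and> 1 \<le> snd (ty c) \<and> snd (ty c) \<le> n"
  shows "recolour m n k (\<Prod>c\<in>Q. pv (ty c)) =
    (\<Sum>c\<in>Q. of_nat (snd (ty c)) * (pv ((fst (ty c) + k) mod m, snd (ty c)) * (\<Prod>e\<in>Q - {c}. pv (ty e))))"
proof -
  let ?B = "{1..n} \<times> {..<m}"
  let ?J = "\<lambda>c. of_nat (snd (ty c)) * (pv ((fst (ty c) + k) mod m, snd (ty c)) * (\<Prod>e\<in>Q - {c}. pv (ty e)))"
  have "recolour m n k (\<Prod>c\<in>Q. pv (ty c)) =
      (\<Sum>p\<in>?B. \<Sum>c\<in>Q. if p = (snd (ty c), fst (ty c)) then ?J c else 0)"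
    unfolding recolour_def
  proof (rule sum.cong)
    fix p :: "nat \<times> nat"
    obtain i \<alpha> where p: "p = (i, \<alpha>)" by fastforce
    show "(case p of (i, \<alpha>) \<Rightarrow> of_nat i * (pv ((\<alpha> + k) mod m, i) * pdiff \<alpha> i (\<Prod>c\<in>Q. pv (ty c)))) =
        (\<Sum>c\<in>Q. if p = (snd (ty c), fst (ty c)) then ?J c else 0)"
      unfolding p prod.case pdiff_prod_pv_if[OF Q] sum_distrib_left
      by (intro sum.cong refl) auto
  qed simp
  also have "\<dots> = (\<Sum>c\<in>Q. \<Sum>p\<in>?B. if p = (snd (ty c), fst (ty c)) then ?J c else 0)"
    by (rule sum.swap)
  also have "\<dots> = (\<Sum>c\<in>Q. ?J c)"
    using ty by (intro sum.cong refl) (auto simp: sum.delta)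
  finally show ?thesis .
qed

section \<open>Coloured cycle types and conjugacy\<close>

definition type_monom :: "nat \<Rightarrow> 'a set \<Rightarrow> ('a \<Rightarrow> 'a) \<Rightarrow> ('a \<Rightarrow> nat) \<Rightarrow> pmonom" where
  "type_monom m S u g = (\<Sum>c\<in>cycle_sets S u. Poly_Mapping.single (cycle_type m g c) 1)"

lemma type_poly_eq_single: "type_poly m S u g = Poly_Mapping.single (type_monom m S u g) 1"
  by (simp add: type_poly_def type_monom_def prod_pv_eq_single)

lemma single_one_eq_iff:
  "Poly_Mapping.single \<mu> (1::complex) = Poly_Mapping.single \<nu> 1 \<longleftrightarrow> \<mu> = \<nu>"
  by (metis keys_single singleton_inject zero_neq_one)

lemma type_monom_cong:
  assumes "u permutes S" "\<And>x. x \<in> S \<Longrightarrow> [g x = h x] (mod m)"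
  shows "type_monom m S u g = type_monom m S u h"
  unfolding type_monom_def
proof (rule sum.cong)
  fix c assume c: "c \<in> cycle_sets S u"
  have "[(\<Sum>x\<in>c. g x) = (\<Sum>x\<in>c. h x)] (mod m)"
    using assms(2) cycle_set_subset[OF assms(1) c] by (intro cong_sum) auto
  then show "Poly_Mapping.single (cycle_type m g c) 1 = Poly_Mapping.single (cycle_type m h c) 1"
    by (simp add: cycle_type_def cong_def)
qed simp

text \<open>The hypotheses say that the coloured permutation \<open>(v, h)\<close> conjugates \<open>(u, g)\<close> into \<open>(u', g')\<close>.
  Then \<open>v\<close> maps cycles to cycles, and the colours \<open>h\<close> cancel in the sum over a cycle, which \<open>u\<close>
  permutes.\<close>

lemma type_monom_conjugate:
  assumes u: "u permutes S" and v: "v permutes S" and S: "finite S"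
    and vu: "\<And>x. x \<in> S \<Longrightarrow> v (u x) = u' (v x)"
    and h: "\<And>x. x \<in> S \<Longrightarrow> [g x + h (u x) = h x + g' (v x)] (mod m)"
  shows "type_monom m S u' g' = type_monom m S u g"
proof -
  have inj: "inj v" using v by (rule permutes_inj)
  have im: "cycle_sets S u' = (`) v ` cycle_sets S u"
  proof (rule cycle_sets_eqI)
    have "\<Union> ((`) v ` cycle_sets S u) = v ` \<Union> (cycle_sets S u)" by blast
    then show "\<Union> ((`) v ` cycle_sets S u) = S"
      by (simp add: Union_cycle_sets[OF u S] permutes_image[OF v])
    fix d assume "d \<in> (`) v ` cycle_sets S u"
    then obtain c where c: "c \<in> cycle_sets S u" and d: "d = v ` c" by blast
    show "cyclic_on u' d" unfolding d
      using cyclic_on_image[OF cyclic_on_cycle_set[OF u S c]] vu cycle_set_subset[OF u c]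
      by (metis subsetD)
  qed
  have ty: "cycle_type m g' (v ` c) = cycle_type m g c" if c: "c \<in> cycle_sets S u" for c
  proof -
    have "inj_on u c" using u by (meson inj_on_subset permutes_inj subset_UNIV)
    then have "(\<Sum>x\<in>c. h (u x)) = (\<Sum>x\<in>u ` c. h x)" by (simp add: sum.reindex)
    then have hu: "(\<Sum>x\<in>c. h (u x)) = (\<Sum>x\<in>c. h x)" by (simp add: image_cycle_set[OF u S c])
    have "[(\<Sum>x\<in>c. g x + h (u x)) = (\<Sum>x\<in>c. h x + g' (v x))] (mod m)"
      using h cycle_set_subset[OF u c] by (intro cong_sum) auto
    then have "[(\<Sum>x\<in>c. g x) = (\<Sum>x\<in>c. g' (v x))] (mod m)"
      by (simp add: sum.distrib hu add.commute[of "sum g c"] cong_add_lcancel_nat)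
    moreover have "inj_on v c" using inj by (rule inj_on_subset) simp
    ultimately show ?thesis
      by (simp add: cycle_type_def cong_def sum.reindex card_image)
  qed
  have "inj_on ((`) v) (cycle_sets S u)" using inj by (auto simp: inj_on_def inj_image_eq_iff)
  then show ?thesis
    unfolding type_monom_def im by (simp add: sum.reindex ty)
qed

lemma bij_betw_of_sum_single_eq:
  assumes A: "finite A" and B: "finite B"
    and eq: "(\<Sum>a\<in>A. Poly_Mapping.single (f a) (1::nat)) = (\<Sum>b\<in>B. Poly_Mapping.single (g b) 1)"
  shows "\<exists>\<phi>. bij_betw \<phi> A B \<and> (\<forall>a\<in>A. g (\<phi> a) = f a)"
proof -
  have "\<exists>\<phi>. bij_betw \<phi> {a \<in> A. f a = w} {b \<in> B. g b = w}" for w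
  proof (rule finite_same_card_bij)
    show "card {a \<in> A. f a = w} = card {b \<in> B. g b = w}"
      using lookup_sum_single[OF A, of f w] lookup_sum_single[OF B, of g w] eq by simp
  qed (use A B in auto)
  then obtain \<phi> where \<phi>: "\<And>w. bij_betw (\<phi> w) {a \<in> A. f a = w} {b \<in> B. g b = w}" by metis
  have maps: "\<phi> (f a) a \<in> B \<and> g (\<phi> (f a) a) = f a" if "a \<in> A" for a
    using bij_betwE[OF \<phi>[of "f a"]] that by auto
  have "bij_betw (\<lambda>a. \<phi> (f a) a) A B"
  proof (rule bij_betw_imageI)
    show "inj_on (\<lambda>a. \<phi> (f a) a) A"
    proof (rule inj_onI)
      fix x y assume xy: "x \<in> A" "y \<in> A" "\<phi> (f x) x = \<phi> (f y) y"
      then have "f x = f y" using maps by metis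
      then show "x = y"
        using inj_onD[OF bij_betw_imp_inj_on[OF \<phi>[of "f x"]], of x y] xy by simp
    qed
    show "(\<lambda>a. \<phi> (f a) a) ` A = B"
    proof
      show "B \<subseteq> (\<lambda>a. \<phi> (f a) a) ` A"
      proof
        fix b assume "b \<in> B"
        then have "b \<in> \<phi> (g b) ` {a \<in> A. f a = g b}"
          using bij_betw_imp_surj_on[OF \<phi>[of "g b"]] by simp
        then obtain x where "b = \<phi> (g b) x" "x \<in> A" "f x = g b" by auto
        then show "b \<in> (\<lambda>a. \<phi> (f a) a) ` A" by (intro image_eqI[of _ _ x]) simp_all
      qed
    qed (use maps in auto)
  qed
  then show ?thesis using maps by (intro exI[of _ "\<lambda>a. \<phi> (f a) a"]) simp
qed

text \<open>The converse: pair the cycles of both permutations by type and choose a base point in each. Let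
  \<open>v\<close> carry the \<open>i\<close>-th iterate of a base point to the \<open>i\<close>-th iterate of the corresponding base
  point, and let \<open>h\<close> add up the differences of the colours met on the way. When the cycle closes, the
  permutations agree because the lengths do, and the colours agree modulo \<open>m\<close> because the colour
  sums do.\<close>

lemma conjugate_of_type_monom_eq:
  fixes u u' :: "'a \<Rightarrow> 'a" and g g' :: "'a \<Rightarrow> nat"
  assumes u: "u permutes S" and u': "u' permutes S" and S: "finite S" and m: "m \<ge> 1"
    and eq: "type_monom m S u g = type_monom m S u' g'"
  obtains v h where "v permutes S" "\<And>x. x \<in> S \<Longrightarrow> v (u x) = u' (v x)"
    "\<And>x. x \<in> S \<Longrightarrow> [g x + h (u x) = h x + g' (v x)] (mod m)"
proof -
  let ?Q = "cycle_sets S u" and ?Q' = "cycle_sets S u'"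
  obtain \<phi> where \<phi>: "bij_betw \<phi> ?Q ?Q'" and ty: "\<And>c. c \<in> ?Q \<Longrightarrow> cycle_type m g' (\<phi> c) = cycle_type m g c"
    using bij_betw_of_sum_single_eq[OF finite_cycle_sets[OF S] finite_cycle_sets[OF S]
        eq[unfolded type_monom_def]] by metis
  have \<phi>Q: "\<phi> c \<in> ?Q'" if "c \<in> ?Q" for c using \<phi> that by (metis bij_betwE)
  have card: "card (\<phi> c) = card c" if "c \<in> ?Q" for c using ty[OF that] by (simp add: cycle_type_def)
  define a where "a c = (SOME x. x \<in> c)" for c :: "'a set"
  have a: "a c \<in> c" if "c \<noteq> {}" for c using that unfolding a_def by (simp add: some_in_eq)
  have aQ: "a c \<in> c" if "c \<in> ?Q" for c using a cycle_set_nonempty[OF that] .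
  have aQ': "a (\<phi> c) \<in> \<phi> c" if "c \<in> ?Q" for c using a cycle_set_nonempty[OF \<phi>Q[OF that]] .
  define idx where "idx x = (SOME i. i < card (orbit u x) \<and> (u ^^ i) (a (orbit u x)) = x)" for x
  have orb: "orbit u x \<in> ?Q" if "x \<in> S" for x using that by (simp add: cycle_sets_def)
  have idx: "idx x < card (orbit u x) \<and> (u ^^ idx x) (a (orbit u x)) = x" if x: "x \<in> S" for x
  proof -
    have "x \<in> (\<lambda>i. (u ^^ i) (a (orbit u x))) ` {..<card (orbit u x)}"
      using cycle_set_iterates(1)[OF u S orb[OF x] aQ[OF orb[OF x]]] self_in_orbit_permutes[OF u S]
      by metis
    then have "\<exists>i. i < card (orbit u x) \<and> (u ^^ i) (a (orbit u x)) = x" by auto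
    then show ?thesis unfolding idx_def by (rule someI_ex)
  qed
  have inc: "(u ^^ i) (a c) \<in> c" if "c \<in> ?Q" for c i
    using cyclic_on_funpow_in[OF cyclic_on_cycle_set[OF u S that] aQ[OF that]] .
  have inc': "(u' ^^ i) (a (\<phi> c)) \<in> \<phi> c" if "c \<in> ?Q" for c i
    using cyclic_on_funpow_in[OF cyclic_on_cycle_set[OF u' S \<phi>Q[OF that]] aQ'[OF that]] .
  have orb_iter: "orbit u ((u ^^ i) (a c)) = c" if "c \<in> ?Q" for c i
    using orbit_eq_cycle_set[OF u S that inc[OF that]] .
  have inS: "(u ^^ i) (a c) \<in> S" if "c \<in> ?Q" for c i
    using inc[OF that] cycle_set_subset[OF u that] by blast
  have idx_iter: "idx ((u ^^ i) (a c)) = i" if c: "c \<in> ?Q" and i: "i < card c" for c i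
    using idx[OF inS[OF c, of i]] inj_onD[OF cycle_set_iterates(2)[OF u S c aQ[OF c]], of _ i] i
    by (simp add: orb_iter[OF c])
  define v where "v x = (if x \<in> S then (u' ^^ idx x) (a (\<phi> (orbit u x))) else x)" for x
  have v_iter: "v ((u ^^ i) (a c)) = (u' ^^ i) (a (\<phi> c))" if c: "c \<in> ?Q" and i: "i \<le> card c" for c i
  proof (cases "i < card c")
    case True
    then show ?thesis by (simp add: v_def inS[OF c] idx_iter[OF c] orb_iter[OF c])
  next
    case False
    then have "i = card c" using i by simp
    moreover have "v (a c) = a (\<phi> c)"
      using idx_iter[OF c, of 0] card_cycle_set_pos[OF u S c] inS[OF c, of 0] orb_iter[OF c, of 0]
      by (simp add: v_def)
    ultimately show ?thesis
      using cycle_set_iterates(3)[OF u S c aQ[OF c]]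
        cycle_set_iterates(3)[OF u' S \<phi>Q[OF c] aQ'[OF c]] card[OF c] by simp
  qed
  have vin: "v x \<in> \<phi> (orbit u x)" if "x \<in> S" for x
    using inc'[OF orb[OF that]] that by (simp add: v_def)
  have vS: "v x \<in> S" if "x \<in> S" for x
    using vin[OF that] cycle_set_subset[OF u' \<phi>Q[OF orb[OF that]]] by blast
  have "inj_on v S"
  proof (rule inj_onI)
    fix x y assume x: "x \<in> S" and y: "y \<in> S" and e: "v x = v y"
    then have "\<phi> (orbit u x) = \<phi> (orbit u y)"
      using vin[OF x] vin[OF y] cycle_sets_disjoint[OF u' S \<phi>Q[OF orb[OF x]] \<phi>Q[OF orb[OF y]]] by auto
    then have o: "orbit u x = orbit u y"
      using inj_onD[OF bij_betw_imp_inj_on[OF \<phi>]] orb x y by blast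
    have "idx x = idx y"
    proof (rule inj_onD[OF cycle_set_iterates(2)[OF u' S \<phi>Q[OF orb[OF x]] aQ'[OF orb[OF x]]]])
      show "(u' ^^ idx x) (a (\<phi> (orbit u x))) = (u' ^^ idx y) (a (\<phi> (orbit u x)))"
        using e x y unfolding v_def o by simp
      show "idx x \<in> {..<card (\<phi> (orbit u x))}"
        using conjunct1[OF idx[OF x]] card[OF orb[OF x]] by simp
      show "idx y \<in> {..<card (\<phi> (orbit u x))}"
        using conjunct1[OF idx[OF y]] card[OF orb[OF y]] unfolding o by simp
    qed
    then show "x = y" using idx[OF x] idx[OF y] o by metis
  qed
  moreover have "v ` S \<subseteq> S" using vS by blast
  ultimately have "bij_betw v S S" using S by (simp add: bij_betw_def endo_inj_surj)
  then have v: "v permutes S" by (rule bij_imp_permutes) (simp add: v_def)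
  have vu: "v (u x) = u' (v x)" if x: "x \<in> S" for x
  proof -
    let ?c = "orbit u x"
    have c: "?c \<in> ?Q" using orb[OF x] .
    have x_eq: "(u ^^ idx x) (a ?c) = x" and i: "idx x < card ?c" using idx[OF x] by auto
    have "v (u x) = v ((u ^^ Suc (idx x)) (a ?c))" using x_eq by simp
    also have "\<dots> = u' (v ((u ^^ idx x) (a ?c)))"
      using v_iter[OF c, of "Suc (idx x)"] v_iter[OF c, of "idx x"] i by simp
    finally show ?thesis using x_eq by simp
  qed
  \<comment> \<open>\<open>\<delta> x\<close> is the colour difference \<open>g' (v x) - g x\<close> modulo \<open>m\<close>, with \<open>m - 1\<close> in the role of \<open>- 1\<close>\<close>
  define \<delta> where "\<delta> x = g' (v x) + (m - 1) * g x" for x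
  define h where "h x = (\<Sum>j<idx x. \<delta> ((u ^^ j) (a (orbit u x))))" for x
  have \<delta>: "[g x + \<delta> x = g' (v x)] (mod m)" for x
  proof -
    have "g x + \<delta> x = g' (v x) + m * g x" unfolding \<delta>_def using m by (cases m) simp_all
    then show ?thesis by (simp add: cong_def)
  qed
  \<comment> \<open>the point is the case \<open>i = card c\<close>, where the path has closed up\<close>
  have h_iter: "[h ((u ^^ i) (a c)) = (\<Sum>j<i. \<delta> ((u ^^ j) (a c)))] (mod m)"
    if c: "c \<in> ?Q" and i: "i \<le> card c" for c i
  proof (cases "i < card c")
    case True
    then show ?thesis by (simp add: h_def idx_iter[OF c] orb_iter[OF c])
  next
    case False
    then have ic: "i = card c" using i by simp
    have "(\<Sum>j<card c. f ((u ^^ j) (a c))) = (\<Sum>x\<in>c. f x)" for f :: "'a \<Rightarrow> nat"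
      using cycle_set_iterates[OF u S c aQ[OF c]]
      by (metis (no_types, lifting) sum.reindex_cong)
    then have "(\<Sum>j<card c. \<delta> ((u ^^ j) (a c))) = (\<Sum>x\<in>c. \<delta> x)" .
    also have "\<dots> = (\<Sum>x\<in>c. g' (v x)) + (m - 1) * (\<Sum>x\<in>c. g x)"
      by (simp add: \<delta>_def sum.distrib sum_distrib_left)
    also have "(\<Sum>x\<in>c. g' (v x)) = (\<Sum>x\<in>\<phi> c. g' x)"
    proof -
      have "v ` c \<subseteq> \<phi> c"
        using vin cycle_set_subset[OF u c] orbit_eq_cycle_set[OF u S c] by (metis image_subsetI subsetD)
      moreover have inj: "inj_on v c" using v by (meson inj_on_subset permutes_inj subset_UNIV)
      ultimately have "v ` c = \<phi> c"
        using card[OF c] finite_cycle_set[OF u' S \<phi>Q[OF c]] by (intro card_subset_eq) (auto simp: card_image)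
      then show ?thesis using inj by (metis (no_types, lifting) sum.reindex_cong)
    qed
    finally have "[(\<Sum>j<card c. \<delta> ((u ^^ j) (a c))) = (\<Sum>x\<in>\<phi> c. g' x) + (m - 1) * (\<Sum>x\<in>c. g x)] (mod m)"
      by simp
    also have "[(\<Sum>x\<in>\<phi> c. g' x) + (m - 1) * (\<Sum>x\<in>c. g x) = (\<Sum>x\<in>c. g x) + (m - 1) * (\<Sum>x\<in>c. g x)] (mod m)"
      using ty[OF c] by (intro cong_add) (simp_all add: cycle_type_def cong_def)
    also have "(\<Sum>x\<in>c. g x) + (m - 1) * (\<Sum>x\<in>c. g x) = m * (\<Sum>x\<in>c. g x)"
      using m by (cases m) simp_all
    also have "[m * (\<Sum>x\<in>c. g x) = 0] (mod m)" by (simp add: cong_def)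
    finally have "[(\<Sum>j<card c. \<delta> ((u ^^ j) (a c))) = 0] (mod m)" .
    moreover have "h (a c) = 0"
      using idx_iter[OF c, of 0] card_cycle_set_pos[OF u S c] by (simp add: h_def)
    ultimately show ?thesis
      using cycle_set_iterates(3)[OF u S c aQ[OF c]] by (simp add: ic cong_sym)
  qed
  have "[g x + h (u x) = h x + g' (v x)] (mod m)" if x: "x \<in> S" for x
  proof -
    let ?c = "orbit u x"
    have c: "?c \<in> ?Q" using orb[OF x] .
    have x_eq: "(u ^^ idx x) (a ?c) = x" and i: "idx x < card ?c" using idx[OF x] by auto
    have "[h ((u ^^ Suc (idx x)) (a ?c)) = (\<Sum>j<Suc (idx x). \<delta> ((u ^^ j) (a ?c)))] (mod m)"
      using h_iter[OF c, of "Suc (idx x)"] i by simp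
    then have "[h (u x) = h x + \<delta> x] (mod m)" by (simp add: x_eq h_def)
    then have "[g x + h (u x) = g x + (h x + \<delta> x)] (mod m)" by (intro cong_add) simp_all
    also have "g x + (h x + \<delta> x) = h x + (g x + \<delta> x)" by simp
    also have "[h x + (g x + \<delta> x) = h x + g' (v x)] (mod m)" using \<delta> by (intro cong_add) simp_all
    finally show ?thesis .
  qed
  then show ?thesis using that v vu by blast
qed

lemma monom_deg_eq_sum:
  assumes "finite K" "Poly_Mapping.keys \<mu> \<subseteq> K"
  shows "monom_deg \<mu> = (\<Sum>w\<in>K. snd w * Poly_Mapping.lookup \<mu> w)"
proof -
  have "monom_deg \<mu> = (\<Sum>w\<in>Poly_Mapping.keys \<mu>. snd w * Poly_Mapping.lookup \<mu> w)"
    unfolding monom_deg_def by (intro sum.cong) auto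
  also have "\<dots> = (\<Sum>w\<in>K. snd w * Poly_Mapping.lookup \<mu> w)"
    using assms by (intro sum.mono_neutral_left) (auto simp: in_keys_iff)
  finally show ?thesis .
qed

lemma monom_deg_add: "monom_deg (\<mu> + \<nu>) = monom_deg \<mu> + monom_deg \<nu>"
proof -
  let ?K = "Poly_Mapping.keys \<mu> \<union> Poly_Mapping.keys \<nu>"
  have "Poly_Mapping.keys (\<mu> + \<nu>) \<subseteq> ?K" by (rule keys_add)
  then show ?thesis
    by (simp add: monom_deg_eq_sum[of ?K] lookup_add distrib_left sum.distrib)
qed

lemma monom_deg_single: "monom_deg (Poly_Mapping.single w k) = snd w * k"
  by (simp add: monom_deg_eq_sum[of "{w}"])

lemma monom_deg_zero: "monom_deg 0 = 0"
  by (simp add: monom_deg_def)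

lemma monom_deg_sum: "monom_deg (\<Sum>x\<in>A. f x) = (\<Sum>x\<in>A. monom_deg (f x))"
  by (induction A rule: infinite_finite_induct) (simp_all add: monom_deg_zero monom_deg_add)

text \<open>The condition on variables in the definition of the polynomial ring.\<close>

definition proper_monom :: "nat \<Rightarrow> pmonom \<Rightarrow> bool" where
  "proper_monom m \<mu> \<longleftrightarrow> (\<forall>w\<in>Poly_Mapping.keys \<mu>. fst w < m \<and> 1 \<le> snd w)"

lemma poly_component_iff:
  "f \<in> poly_component m n \<longleftrightarrow> (\<forall>\<mu>\<in>Poly_Mapping.keys f. proper_monom m \<mu> \<and> monom_deg \<mu> = n)"
  by (simp add: poly_component_def proper_monom_def case_prod_beta)

lemma type_monom_proper:
  assumes u: "u permutes S" "finite S" and m: "m \<ge> 1"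
  shows "proper_monom m (type_monom m S u g)" "monom_deg (type_monom m S u g) = card S"
proof -
  show "proper_monom m (type_monom m S u g)"
    unfolding proper_monom_def
  proof
    fix w assume "w \<in> Poly_Mapping.keys (type_monom m S u g)"
    then have "card {c \<in> cycle_sets S u. cycle_type m g c = w} \<noteq> 0"
      by (simp add: in_keys_iff type_monom_def lookup_sum_single[OF finite_cycle_sets[OF u(2)]] del: One_nat_def)
    then obtain c where "c \<in> cycle_sets S u" "cycle_type m g c = w"
      by (metis (mono_tags, lifting) card.empty empty_Collect_eq)
    then show "fst w < m \<and> 1 \<le> snd w"
      using card_cycle_set_pos[OF u, of c] m by (auto simp: cycle_type_def)
  qed
  show "monom_deg (type_monom m S u g) = card S"
    using sum_over_cycle_sets[OF u, of "\<lambda>_. 1 :: nat"]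
    by (simp add: type_monom_def monom_deg_sum monom_deg_single cycle_type_def)
qed

lemma cycle_sets_fixed_point:
  assumes "u permutes S" "x \<notin> S"
  shows "cycle_sets (insert x S) u = insert {x} (cycle_sets S u)" "{x} \<notin> cycle_sets S u"
proof -
  have "orbit u x = {x}" using assms by (simp add: orbit_eq_singleton_iff permutes_not_in)
  then show "cycle_sets (insert x S) u = insert {x} (cycle_sets S u)" by (simp add: cycle_sets_def)
  show "{x} \<notin> cycle_sets S u" using cycle_set_subset[OF assms(1)] assms(2) by blast
qed

lemma type_monom_fixed_point:
  assumes u: "u permutes S" "finite S" and x: "x \<notin> S"
  shows "type_monom m (insert x S) u (g(x := \<alpha>)) =
    Poly_Mapping.single (\<alpha> mod m, 1) 1 + type_monom m S u g"
proof -
  have "type_monom m (insert x S) u (g(x := \<alpha>)) =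
      Poly_Mapping.single (\<alpha> mod m, 1) 1 + type_monom m S u (g(x := \<alpha>))"
    unfolding type_monom_def cycle_sets_fixed_point(1)[OF u(1) x]
    using cycle_sets_fixed_point(2)[OF u(1) x] finite_cycle_sets[OF u(2), of u]
    by (simp add: cycle_type_def)
  also have "type_monom m S u (g(x := \<alpha>)) = type_monom m S u g"
    using x by (intro type_monom_cong[OF u(1)]) auto
  finally show ?thesis .
qed

text \<open>Every monomial of degree \<open>n\<close> is the type of a coloured permutation of \<open>n\<close> points, by induction on
  \<open>n\<close>: a part of length 1 is realised by a new fixed point, and a longer part by joining a new point
  of colour 0 to a cycle that is one shorter.\<close>

lemma type_monom_surj:
  assumes m: "m \<ge> 1" and "proper_monom m \<mu>"
  shows "\<exists>u g. u permutes {..<monom_deg \<mu>} \<and> type_monom m {..<monom_deg \<mu>} u g = \<mu>"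
  using assms(2)
proof (induction "monom_deg \<mu>" arbitrary: \<mu>)
  case 0
  have "Poly_Mapping.lookup \<mu> w = 0" for w
  proof (rule ccontr)
    assume w: "Poly_Mapping.lookup \<mu> w \<noteq> 0"
    then have "1 \<le> snd w" using 0(2) by (auto simp: proper_monom_def in_keys_iff)
    then show False using monom_deg_ge[of "snd w" \<mu> "fst w"] w 0(1) by simp
  qed
  then have "\<mu> = 0" by (intro poly_mapping_eqI) simp
  then show ?case
    by (intro exI[of _ id]) (simp add: type_monom_def cycle_sets_def id_def monom_deg_zero)
next
  case (Suc n)
  have "\<mu> \<noteq> 0" using Suc(2) by (metis monom_deg_zero nat.distinct(1))
  then obtain w where w: "w \<in> Poly_Mapping.keys \<mu>" by (metis all_not_in_conv keys_eq_empty)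
  obtain \<alpha> k where wk: "w = (\<alpha>, k)" by fastforce
  have ak: "\<alpha> < m" "1 \<le> k" using Suc(3) w wk by (auto simp: proper_monom_def)
  define \<mu>' where "\<mu>' = \<mu> - Poly_Mapping.single w 1"
  have \<mu>: "\<mu> = \<mu>' + Poly_Mapping.single w 1"
    using w by (intro poly_mapping_eqI)
      (auto simp: \<mu>'_def lookup_add lookup_minus lookup_single in_keys_iff when_def)
  have proper: "proper_monom m \<mu>'"
    using Suc(3) by (auto simp: proper_monom_def \<mu>'_def in_keys_iff lookup_minus)
  have deg: "monom_deg \<mu>' + k = Suc n"
    using Suc(2) unfolding \<mu> by (simp add: monom_deg_add monom_deg_single wk)
  have ins: "insert n {..<n} = {..<Suc n}" by auto
  have up: "u permutes {..<Suc n}" if "u permutes {..<n}" for u :: "nat \<Rightarrow> nat"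
    using that by (rule permutes_subset) auto
  show ?case
  proof (cases "k = 1")
    case True
    then obtain u g where u: "u permutes {..<n}" and ug: "type_monom m {..<n} u g = \<mu>'"
      using Suc(1)[of \<mu>'] deg proper by auto
    have "type_monom m {..<Suc n} u (g(n := \<alpha>)) = \<mu>"
      using type_monom_fixed_point[OF u finite_lessThan, of n m g \<alpha>] ak True
      by (simp add: ins ug \<mu> wk add.commute)
    then show ?thesis using up[OF u] Suc(2) by metis
  next
    case False
    define \<nu> where "\<nu> = \<mu>' + Poly_Mapping.single (\<alpha>, k - 1) 1"
    have "monom_deg \<nu> = n"
      using deg False ak by (simp add: \<nu>_def monom_deg_add monom_deg_single)
    moreover have "proper_monom m \<nu>"
      unfolding proper_monom_def
    proof
      fix w assume "w \<in> Poly_Mapping.keys \<nu>"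
      then have "w \<in> Poly_Mapping.keys \<mu>' \<or> w = (\<alpha>, k - 1)"
        using keys_add[of \<mu>' "Poly_Mapping.single (\<alpha>, k - 1) 1"] by (auto simp: \<nu>_def)
      then show "fst w < m \<and> 1 \<le> snd w"
        using proper ak False by (auto simp: proper_monom_def)
    qed
    ultimately obtain u g where u: "u permutes {..<n}" and ug: "type_monom m {..<n} u g = \<nu>"
      using Suc(1)[of \<nu>] by auto
    let ?Q = "cycle_sets {..<n} u" and ?g = "g(n := 0)"
    have finQ: "finite ?Q" by (simp add: finite_cycle_sets)
    have QT: "cycle_sets {..<Suc n} u = insert {n} ?Q" and nQ: "{n} \<notin> ?Q"
      using cycle_sets_fixed_point[OF u, of n] by (simp_all add: ins)
    have "Poly_Mapping.lookup \<nu> (\<alpha>, k - 1) \<noteq> 0" by (simp add: \<nu>_def lookup_add)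
    then have "card {c \<in> ?Q. cycle_type m g c = (\<alpha>, k - 1)} \<noteq> 0"
      using lookup_sum_single[OF finQ, of "cycle_type m g" "(\<alpha>, k - 1)"]
      by (simp add: ug[symmetric] type_monom_def)
    then obtain c where c: "c \<in> ?Q" and ty: "cycle_type m g c = (\<alpha>, k - 1)"
      by (metis (mono_tags, lifting) card.empty empty_Collect_eq)
    obtain a where a: "a \<in> c" using cycle_set_nonempty[OF c] by blast
    have same: "(\<Sum>i\<in>e. ?g i) = (\<Sum>i\<in>e. g i)" if "e \<in> ?Q" for e
      using cycle_set_subset[OF u that] by (intro sum.cong) auto
    have "\<nu> = Poly_Mapping.single (\<alpha>, k - 1) 1 + (\<Sum>e\<in>?Q - {c}. Poly_Mapping.single (cycle_type m g e) 1)"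
      using sum.remove[OF finQ c, of "\<lambda>e. Poly_Mapping.single (cycle_type m g e) (1::nat)"]
      by (simp add: ug[symmetric] type_monom_def ty)
    then have rest: "(\<Sum>e\<in>?Q - {c}. Poly_Mapping.single (cycle_type m g e) 1) = \<mu>'"
      unfolding \<nu>_def by (metis add.commute add_left_imp_eq)
    let ?h = "\<lambda>x. ?g x + transposition_colour m a n 0 (u x)"
    have "type_poly m {..<Suc n} (transpose a n \<circ> u) ?h =
        pv (((\<Sum>i\<in>c. ?g i) + (\<Sum>i\<in>{n}. ?g i)) mod m, card c + card {n}) *
        (\<Prod>e\<in>cycle_sets {..<Suc n} u - {c, {n}}. pv (cycle_type m ?g e))"
      using c nQ a by (intro type_poly_join[OF up[OF u]]) (auto simp: QT)
    also have "((\<Sum>i\<in>c. ?g i) + (\<Sum>i\<in>{n}. ?g i)) mod m = \<alpha>"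
      using ty same[OF c] by (simp add: cycle_type_def)
    also have "card c + card {n} = k" using ty ak False by (simp add: cycle_type_def)
    also have "cycle_sets {..<Suc n} u - {c, {n}} = ?Q - {c}" using nQ by (auto simp: QT)
    also have "(\<Prod>e\<in>?Q - {c}. pv (cycle_type m ?g e)) = (\<Prod>e\<in>?Q - {c}. pv (cycle_type m g e))"
      using same by (intro prod.cong) (auto simp: cycle_type_def)
    also have "\<dots> = Poly_Mapping.single \<mu>' 1" by (simp only: prod_pv_eq_single rest)
    also have "pv (\<alpha>, k) * Poly_Mapping.single \<mu>' 1 = Poly_Mapping.single \<mu> 1"
      by (simp add: pv_def mult_single \<mu> wk add.commute)
    finally have "type_monom m {..<Suc n} (transpose a n \<circ> u) ?h = \<mu>"
      unfolding type_poly_eq_single single_one_eq_iff .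
    moreover have "(transpose a n \<circ> u) permutes {..<Suc n}"
      using a cycle_set_subset[OF u c] by (intro permutes_compose[OF up[OF u]] permutes_swap_id) auto
    ultimately show ?thesis using Suc(2) by metis
  qed
qed

section \<open>Matrices of coloured permutations\<close>

definition unity_root :: "nat \<Rightarrow> nat \<Rightarrow> complex" where
  "unity_root m g = exp (2 * complex_of_real pi * \<i> * of_nat g / of_nat m)"

lemma unity_root_add: "unity_root m (g + h) = unity_root m g * unity_root m h"
  by (simp add: unity_root_def distrib_left add_divide_distrib exp_add)

lemma unity_root_nonzero: "unity_root m g \<noteq> 0"
  by (simp add: unity_root_def)

lemma unity_root_cis: "unity_root m g = cis (2 * pi * real g / real m)"
  by (simp add: unity_root_def cis_conv_exp mult_ac)

lemma unity_root_power: "m \<ge> 1 \<Longrightarrow> unity_root m g ^ m = 1"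
  using cis_multiple_2pi[of "of_nat g"] by (simp add: unity_root_cis DeMoivre mult_ac)

lemma unity_root_mod:
  assumes "m \<ge> 1"
  shows "unity_root m (g mod m) = unity_root m g"
proof -
  have "unity_root m (m * (g div m)) = cis (2 * pi * real (g div m))"
  proof -
    have "2 * pi * real (m * (g div m)) / real m = 2 * pi * real (g div m)" using assms by simp
    then show ?thesis by (simp only: unity_root_cis)
  qed
  also have "\<dots> = 1" by (rule cis_multiple_2pi) (simp add: Ints_of_nat)
  finally have "unity_root m (m * (g div m) + g mod m) = unity_root m (g mod m)"
    by (simp only: unity_root_add) simp
  then show ?thesis by simp
qed

lemma unity_root_bij: "m \<ge> 1 \<Longrightarrow> bij_betw (unity_root m) {..<m} {z. z ^ m = 1}"
  using bij_betw_roots_unity[of m] by (simp add: unity_root_cis[abs_def])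

lemma unity_root_cong:
  assumes "m \<ge> 1" "[g = h] (mod m)"
  shows "unity_root m g = unity_root m h"
  using assms unity_root_mod by (metis cong_def)

text \<open>The matrix of \<open>e\<^sub>k \<mapsto> \<zeta>\<^bsup>g k\<^esup> e\<^bsub>u k\<^esub>\<close>. Colours are arbitrary natural numbers, so that products and
  inverses of such matrices need no reduction modulo \<open>m\<close>.\<close>

definition coloured_perm_mat :: "nat \<Rightarrow> nat \<Rightarrow> (nat \<Rightarrow> nat) \<Rightarrow> (nat \<Rightarrow> nat) \<Rightarrow> complex mat" where
  "coloured_perm_mat m n u g = mat n n (\<lambda>(i, k). if i = u k then unity_root m (g k) else 0)"

lemma coloured_perm_mat_index:
  assumes "i < n" "k < n"
  shows "coloured_perm_mat m n u g $$ (i, k) = (if i = u k then unity_root m (g k) else 0)"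
  using assms by (simp add: coloured_perm_mat_def)

lemma coloured_perm_mat_dim [simp]:
  "dim_row (coloured_perm_mat m n u g) = n" "dim_col (coloured_perm_mat m n u g) = n"
  by (simp_all add: coloured_perm_mat_def)

lemma coloured_perm_mat_carrier_mat: "coloured_perm_mat m n u g \<in> carrier_mat n n"
  by (simp add: coloured_perm_mat_def)

lemma coloured_perm_mat_cong:
  assumes "m \<ge> 1" "\<And>k. k < n \<Longrightarrow> u k = v k" "\<And>k. k < n \<Longrightarrow> [g k = h k] (mod m)"
  shows "coloured_perm_mat m n u g = coloured_perm_mat m n v h"
  by (rule eq_matI) (use assms unity_root_cong in \<open>auto simp: coloured_perm_mat_index\<close>)

lemma permutes_lessThan: "u permutes {..<n} \<Longrightarrow> u k < n \<longleftrightarrow> k < n"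
  using permutes_in_image[of u "{..<n}" k] by simp

lemma coloured_perm_mat_mult:
  assumes u: "u permutes {..<n}"
  shows "coloured_perm_mat m n v h * coloured_perm_mat m n u g =
    coloured_perm_mat m n (v \<circ> u) (\<lambda>k. g k + h (u k))"
proof (rule eq_matI)
  fix i k assume "i < dim_row (coloured_perm_mat m n (v \<circ> u) (\<lambda>k. g k + h (u k)))"
    "k < dim_col (coloured_perm_mat m n (v \<circ> u) (\<lambda>k. g k + h (u k)))"
  then have ik: "i < n" "k < n" by simp_all
  have "(coloured_perm_mat m n v h * coloured_perm_mat m n u g) $$ (i, k) =
      (\<Sum>j<n. (if i = v j then unity_root m (h j) else 0) * (if j = u k then unity_root m (g k) else 0))"
    using ik by (simp add: scalar_prod_def coloured_perm_mat_index atLeast0LessThan)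
  also have "\<dots> = (\<Sum>j<n. if j = u k then
      (if i = v (u k) then unity_root m (h (u k)) else 0) * unity_root m (g k) else 0)"
    by (intro sum.cong) auto
  also have "\<dots> = (if i = v (u k) then unity_root m (h (u k)) else 0) * unity_root m (g k)"
    using ik permutes_lessThan[OF u, of k] by simp
  finally show "(coloured_perm_mat m n v h * coloured_perm_mat m n u g) $$ (i, k) =
      coloured_perm_mat m n (v \<circ> u) (\<lambda>k. g k + h (u k)) $$ (i, k)"
    using ik by (simp add: coloured_perm_mat_index unity_root_add mult.commute)
qed simp_all

lemma coloured_perm_mat_id: "coloured_perm_mat m n id (\<lambda>_. 0) = 1\<^sub>m n"
  by (rule eq_matI) (auto simp: coloured_perm_mat_index unity_root_def)

lemma perm_of_coloured_perm_mat:
  assumes u: "u permutes {..<n}"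
  shows "perm_of (coloured_perm_mat m n u g) = u"
proof
  fix k
  show "perm_of (coloured_perm_mat m n u g) k = u k"
  proof (cases "k < n")
    case True
    then have "u k < n" using permutes_lessThan[OF u] by simp
    then have "(THE i. i < n \<and> coloured_perm_mat m n u g $$ (i, k) \<noteq> 0) = u k"
      using True unity_root_nonzero by (intro the_equality) (auto simp: coloured_perm_mat_index split: if_splits)
    then show ?thesis using True by (simp add: perm_of_def)
  next
    case False
    then show ?thesis using permutes_not_in[OF u, of k] by (simp add: perm_of_def)
  qed
qed

lemma colour_of_coloured_perm_mat:
  assumes m: "m \<ge> 1" and u: "u permutes {..<n}" and k: "k < n"
  shows "colour_of m (coloured_perm_mat m n u g) k = g k mod m"
proof -
  have "coloured_perm_mat m n u g $$ (u k, k) = unity_root m (g k mod m)"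
    using k permutes_lessThan[OF u, of k] unity_root_mod[OF m] by (simp add: coloured_perm_mat_index)
  then have "colour_of m (coloured_perm_mat m n u g) k =
      (THE c. c < m \<and> unity_root m (g k mod m) = unity_root m c)"
    by (simp add: colour_of_def perm_of_coloured_perm_mat[OF u] unity_root_def)
  also have "\<dots> = g k mod m"
    using m inj_onD[OF bij_betw_imp_inj_on[OF unity_root_bij[OF m]], of "g k mod m"]
    by (intro the_equality) auto
  finally show ?thesis .
qed

lemma coloured_perm_mat_carrier:
  assumes m: "m \<ge> 1" and u: "u permutes {..<n}"
  shows "coloured_perm_mat m n u g \<in> carrier (Gm1n m n)"
proof -
  let ?M = "coloured_perm_mat m n u g"
  have nz: "?M $$ (i, k) \<noteq> 0 \<longleftrightarrow> i = u k" if "i < n" "k < n" for i k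
    using that unity_root_nonzero by (simp add: coloured_perm_mat_index)
  have "\<exists>!j. j < n \<and> ?M $$ (i, j) \<noteq> 0" if "i < n" for i
  proof (rule ex1I[of _ "inv_into UNIV u i"])
    have "inv_into UNIV u i < n" using that permutes_lessThan[OF permutes_inv[OF u]] by simp
    then show "inv_into UNIV u i < n \<and> ?M $$ (i, inv_into UNIV u i) \<noteq> 0"
      using nz[OF that] permutes_inverses(1)[OF u] by simp
    show "j = inv_into UNIV u i" if "j < n \<and> ?M $$ (i, j) \<noteq> 0" for j
      using that nz[OF \<open>i < n\<close>] permutes_inverses(2)[OF u] by auto
  qed
  moreover have "\<exists>!i. i < n \<and> ?M $$ (i, j) \<noteq> 0" if "j < n" for j
    using that nz permutes_lessThan[OF u, of j] by (intro ex1I[of _ "u j"]) auto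
  moreover have "?M $$ (i, j) ^ m = 1" if "i < n" "j < n" "?M $$ (i, j) \<noteq> 0" for i j
    using that unity_root_power[OF m] by (auto simp: coloured_perm_mat_index split: if_splits)
  ultimately show ?thesis
    by (simp add: Gm1n_def monomial_mat_def coloured_perm_mat_carrier_mat)
qed

text \<open>Every group element is the matrix of a coloured permutation. From here on the group is handled
  through pairs \<open>(u, g)\<close>.\<close>

lemma carrier_Gm1nE:
  assumes m: "m \<ge> 1" and z: "z \<in> carrier (Gm1n m n)"
  obtains u g where "u permutes {..<n}" "\<And>k. g k < m" "z = coloured_perm_mat m n u g"
proof -
  have dim: "z \<in> carrier_mat n n" using z by (simp add: Gm1n_def)
  have root: "\<And>i j. i < n \<Longrightarrow> j < n \<Longrightarrow> z $$ (i, j) \<noteq> 0 \<Longrightarrow> z $$ (i, j) ^ m = 1"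
    and row: "\<And>i. i < n \<Longrightarrow> \<exists>!j. j < n \<and> z $$ (i, j) \<noteq> 0"
    and col: "\<And>j. j < n \<Longrightarrow> \<exists>!i. i < n \<and> z $$ (i, j) \<noteq> 0"
    using z dim by (simp_all add: Gm1n_def monomial_mat_def)
  define u where "u k = (if k < n then THE i. i < n \<and> z $$ (i, k) \<noteq> 0 else k)" for k
  have u: "u k < n \<and> z $$ (u k, k) \<noteq> 0" if "k < n" for k
    using theI'[OF col[OF that]] that by (simp add: u_def)
  have u_eq: "i = u k" if "k < n" "i < n" "z $$ (i, k) \<noteq> 0" for i k
    using col[OF \<open>k < n\<close>] u[OF \<open>k < n\<close>] that by blast
  have "inj_on u {..<n}"
  proof (rule inj_onI)
    fix k l assume kl: "k \<in> {..<n}" "l \<in> {..<n}" "u k = u l"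
    then have "k < n \<and> z $$ (u k, k) \<noteq> 0" "l < n \<and> z $$ (u k, l) \<noteq> 0" "u k < n"
      using u[of k] u[of l] by auto
    then show "k = l" using row[of "u k"] by blast
  qed
  moreover have "u ` {..<n} \<subseteq> {..<n}" using u by auto
  ultimately have "bij_betw u {..<n} {..<n}" by (simp add: bij_betw_def endo_inj_surj)
  then have perm: "u permutes {..<n}" by (rule bij_imp_permutes) (simp add: u_def)
  have "\<exists>c. c < m \<and> (k < n \<longrightarrow> z $$ (u k, k) = unity_root m c)" for k
  proof (cases "k < n")
    case True
    then have "z $$ (u k, k) \<in> unity_root m ` {..<m}"
      using root u bij_betw_imp_surj_on[OF unity_root_bij[OF m]] by simp
    then show ?thesis by auto
  qed (use m in \<open>auto intro: exI[of _ 0]\<close>)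
  then obtain g where g: "\<And>k. g k < m \<and> (k < n \<longrightarrow> z $$ (u k, k) = unity_root m (g k))" by metis
  have eq: "z = coloured_perm_mat m n u g"
  proof (rule eq_matI)
    fix i k assume "i < dim_row (coloured_perm_mat m n u g)" "k < dim_col (coloured_perm_mat m n u g)"
    then show "z $$ (i, k) = coloured_perm_mat m n u g $$ (i, k)"
      using g u_eq by (auto simp: coloured_perm_mat_index)
  qed (use dim in auto)
  show ?thesis by (rule that[OF perm _ eq]) (simp add: g)
qed

lemma mult_Gm1n [simp]: "x \<otimes>\<^bsub>Gm1n m n\<^esub> y = x * y"
  by (simp add: Gm1n_def)

lemma one_Gm1n [simp]: "\<one>\<^bsub>Gm1n m n\<^esub> = 1\<^sub>m n"
  by (simp add: Gm1n_def)

lemma carrier_Gm1n_subset: "z \<in> carrier (Gm1n m n) \<Longrightarrow> z \<in> carrier_mat n n"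
  by (simp add: Gm1n_def)

lemma group_Gm1n:
  assumes m: "m \<ge> 1"
  shows "Group.group (Gm1n m n)"
proof (rule groupI)
  show "\<one>\<^bsub>Gm1n m n\<^esub> \<in> carrier (Gm1n m n)"
    using coloured_perm_mat_carrier[OF m permutes_id] by (metis coloured_perm_mat_id one_Gm1n)
  fix x assume x: "x \<in> carrier (Gm1n m n)"
  then show "\<one>\<^bsub>Gm1n m n\<^esub> \<otimes>\<^bsub>Gm1n m n\<^esub> x = x" using carrier_Gm1n_subset[OF x] by simp
  obtain u g where u: "u permutes {..<n}" and x_eq: "x = coloured_perm_mat m n u g"
    using carrier_Gm1nE[OF m x] .
  \<comment> \<open>the inverse of the permutation, with the colours multiplied by \<open>- 1 = m - 1\<close> modulo \<open>m\<close>\<close>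
  define y where "y = coloured_perm_mat m n (inv_into UNIV u) (\<lambda>k. (m - 1) * g (inv_into UNIV u k))"
  have "y * x = coloured_perm_mat m n (inv_into UNIV u \<circ> u) (\<lambda>k. g k + (m - 1) * g (inv_into UNIV u (u k)))"
    unfolding y_def x_eq by (rule coloured_perm_mat_mult[OF u])
  also have "\<dots> = coloured_perm_mat m n id (\<lambda>_. 0)"
  proof (rule coloured_perm_mat_cong[OF m])
    fix k
    have "g k + (m - 1) * g k = m * g k" using m by (cases m) simp_all
    then show "[g k + (m - 1) * g (inv_into UNIV u (u k)) = 0] (mod m)"
      by (simp add: permutes_inverses(2)[OF u] cong_def)
  qed (simp add: permutes_inverses(2)[OF u])
  also have "\<dots> = 1\<^sub>m n" by (rule coloured_perm_mat_id)
  finally show "\<exists>y\<in>carrier (Gm1n m n). y \<otimes>\<^bsub>Gm1n m n\<^esub> x = \<one>\<^bsub>Gm1n m n\<^esub>"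
    using coloured_perm_mat_carrier[OF m permutes_inv[OF u]] unfolding y_def by auto
  fix y assume y: "y \<in> carrier (Gm1n m n)"
  obtain v h where v: "v permutes {..<n}" and y_eq: "y = coloured_perm_mat m n v h"
    using carrier_Gm1nE[OF m y] .
  show "x \<otimes>\<^bsub>Gm1n m n\<^esub> y \<in> carrier (Gm1n m n)"
    unfolding x_eq y_eq mult_Gm1n coloured_perm_mat_mult[OF v]
    by (rule coloured_perm_mat_carrier[OF m permutes_compose[OF v u]])
  fix z assume z: "z \<in> carrier (Gm1n m n)"
  show "x \<otimes>\<^bsub>Gm1n m n\<^esub> y \<otimes>\<^bsub>Gm1n m n\<^esub> z = x \<otimes>\<^bsub>Gm1n m n\<^esub> (y \<otimes>\<^bsub>Gm1n m n\<^esub> z)"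
    using carrier_Gm1n_subset[OF x] carrier_Gm1n_subset[OF y] carrier_Gm1n_subset[OF z]
    by (simp add: assoc_mult_mat)
qed

lemma finite_Gm1n:
  assumes m: "m \<ge> 1"
  shows "finite (carrier (Gm1n m n))"
proof (rule finite_subset)
  let ?F = "\<lambda>(u, g). coloured_perm_mat m n u g"
  show "carrier (Gm1n m n) \<subseteq> ?F ` ({u. u permutes {..<n}} \<times> ({..<n} \<rightarrow>\<^sub>E {..<m}))"
  proof
    fix z assume "z \<in> carrier (Gm1n m n)"
    then obtain u g where u: "u permutes {..<n}" and g: "\<And>k. g k < m" and z: "z = coloured_perm_mat m n u g"
      using carrier_Gm1nE[OF m] by metis
    have "z = ?F (u, restrict g {..<n})"
      unfolding z prod.case by (rule coloured_perm_mat_cong[OF m]) auto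
    moreover have "restrict g {..<n} \<in> {..<n} \<rightarrow>\<^sub>E {..<m}" using g by auto
    ultimately show "z \<in> ?F ` ({u. u permutes {..<n}} \<times> ({..<n} \<rightarrow>\<^sub>E {..<m}))"
      using u by blast
  qed
  show "finite (?F ` ({u. u permutes {..<n}} \<times> ({..<n} \<rightarrow>\<^sub>E {..<m})))"
    by (intro finite_imageI finite_cartesian_product finite_permutations finite_PiE) simp_all
qed

definition mat_type :: "nat \<Rightarrow> nat \<Rightarrow> complex mat \<Rightarrow> pmonom" where
  "mat_type m n z = type_monom m {..<n} (perm_of z) (colour_of m z)"

lemma mat_type_coloured_perm_mat:
  assumes m: "m \<ge> 1" and u: "u permutes {..<n}"
  shows "mat_type m n (coloured_perm_mat m n u g) = type_monom m {..<n} u g"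
  unfolding mat_type_def perm_of_coloured_perm_mat[OF u]
  by (rule type_monom_cong[OF u]) (simp add: colour_of_coloured_perm_mat[OF m u] cong_def)

lemma coloured_perm_mat_eqD:
  assumes m: "m \<ge> 1" and u: "u permutes {..<n}" "u' permutes {..<n}"
    and eq: "coloured_perm_mat m n u g = coloured_perm_mat m n u' g'"
  shows "u = u'" "k < n \<Longrightarrow> [g k = g' k] (mod m)"
proof -
  show "u = u'" using perm_of_coloured_perm_mat[OF u(1)] perm_of_coloured_perm_mat[OF u(2)] eq by metis
  show "[g k = g' k] (mod m)" if "k < n"
    using colour_of_coloured_perm_mat[OF m u(1) that] colour_of_coloured_perm_mat[OF m u(2) that] eq
    by (metis cong_def)
qed

lemma mat_type_conjugate:
  assumes m: "m \<ge> 1" and G: "w \<in> carrier (Gm1n m n)" "z \<in> carrier (Gm1n m n)" "z' \<in> carrier (Gm1n m n)"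
    and eq: "w * z = z' * w"
  shows "mat_type m n z' = mat_type m n z"
proof -
  obtain v h where v: "v permutes {..<n}" and w: "w = coloured_perm_mat m n v h"
    using carrier_Gm1nE[OF m G(1)] .
  obtain u g where u: "u permutes {..<n}" and z: "z = coloured_perm_mat m n u g"
    using carrier_Gm1nE[OF m G(2)] .
  obtain u' g' where u': "u' permutes {..<n}" and z': "z' = coloured_perm_mat m n u' g'"
    using carrier_Gm1nE[OF m G(3)] .
  have e: "coloured_perm_mat m n (v \<circ> u) (\<lambda>k. g k + h (u k)) =
      coloured_perm_mat m n (u' \<circ> v) (\<lambda>k. h k + g' (v k))"
    using eq unfolding w z z' coloured_perm_mat_mult[OF u] coloured_perm_mat_mult[OF v] .
  note eD = coloured_perm_mat_eqD[OF m permutes_compose[OF u v] permutes_compose[OF v u'] e]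
  have "type_monom m {..<n} u' g' = type_monom m {..<n} u g"
  proof (rule type_monom_conjugate[OF u v finite_lessThan])
    fix x assume "x \<in> {..<n}"
    then show "[g x + h (u x) = h x + g' (v x)] (mod m)" using eD(2) by simp
    show "v (u x) = u' (v x)" using fun_cong[OF eD(1), of x] by simp
  qed
  then show ?thesis unfolding z z' by (simp add: mat_type_coloured_perm_mat[OF m] u u')
qed

lemma conjugate_of_mat_type_eq:
  assumes m: "m \<ge> 1" and G: "z \<in> carrier (Gm1n m n)" "z' \<in> carrier (Gm1n m n)"
    and eq: "mat_type m n z = mat_type m n z'"
  shows "\<exists>w\<in>carrier (Gm1n m n). w * z = z' * w"
proof -
  obtain u g where u: "u permutes {..<n}" and z: "z = coloured_perm_mat m n u g"
    using carrier_Gm1nE[OF m G(1)] .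
  obtain u' g' where u': "u' permutes {..<n}" and z': "z' = coloured_perm_mat m n u' g'"
    using carrier_Gm1nE[OF m G(2)] .
  have "type_monom m {..<n} u g = type_monom m {..<n} u' g'"
    using eq unfolding z z' by (simp add: mat_type_coloured_perm_mat[OF m] u u')
  then obtain v h where v: "v permutes {..<n}" and vu: "\<And>x. x \<in> {..<n} \<Longrightarrow> v (u x) = u' (v x)"
    and h: "\<And>x. x \<in> {..<n} \<Longrightarrow> [g x + h (u x) = h x + g' (v x)] (mod m)"
    using conjugate_of_type_monom_eq[OF u u' finite_lessThan m] by metis
  have "coloured_perm_mat m n v h * z = z' * coloured_perm_mat m n v h"
    unfolding z z' coloured_perm_mat_mult[OF u] coloured_perm_mat_mult[OF v]
    by (rule coloured_perm_mat_cong[OF m]) (use vu h in auto)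
  then show ?thesis using coloured_perm_mat_carrier[OF m v] by blast
qed

lemma mat_type_surj:
  assumes m: "m \<ge> 1" and \<mu>: "proper_monom m \<mu>" "monom_deg \<mu> = n"
  shows "\<exists>z\<in>carrier (Gm1n m n). mat_type m n z = \<mu>"
proof -
  obtain u g where u: "u permutes {..<n}" and "type_monom m {..<n} u g = \<mu>"
    using type_monom_surj[OF m \<mu>(1)] \<mu>(2) by auto
  then show ?thesis
    using coloured_perm_mat_carrier[OF m u, of g] mat_type_coloured_perm_mat[OF m u, of g] by metis
qed

lemma mat_type_proper:
  assumes m: "m \<ge> 1" and z: "z \<in> carrier (Gm1n m n)"
  shows "proper_monom m (mat_type m n z)" "monom_deg (mat_type m n z) = n"
proof -
  obtain u g where u: "u permutes {..<n}" and z: "z = coloured_perm_mat m n u g"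
    using carrier_Gm1nE[OF m z] .
  show "proper_monom m (mat_type m n z)" "monom_deg (mat_type m n z) = n"
    unfolding z mat_type_coloured_perm_mat[OF m u]
    using type_monom_proper[OF u finite_lessThan m, of g] by simp_all
qed

text \<open>The exponents of the monomial \<open>p\<^sub>\<Lambda>\<close>; a class \<open>C\<^sub>\<Lambda>\<close> consists of the group elements of this type.\<close>

definition part_monom :: "nat \<Rightarrow> nat multiset list \<Rightarrow> pmonom" where
  "part_monom m \<Lambda> = (\<Sum>r<m. \<Sum>l\<in>#\<Lambda> ! r. Poly_Mapping.single (r, l) 1)"

lemma lookup_sum_mset_single:
  "Poly_Mapping.lookup (\<Sum>l\<in>#M. Poly_Mapping.single (r, l) (1::nat)) w =
    (if fst w = r then count M (snd w) else 0)"
  by (cases w, induction M) (auto simp: lookup_add lookup_single when_def)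

lemma lookup_part_monom:
  "Poly_Mapping.lookup (part_monom m \<Lambda>) (r, l) = (if r < m then count (\<Lambda> ! r) l else 0)"
proof -
  have "Poly_Mapping.lookup (part_monom m \<Lambda>) (r, l) = (\<Sum>s<m. if r = s then count (\<Lambda> ! s) l else 0)"
    by (simp add: part_monom_def lookup_sum lookup_sum_mset_single del: One_nat_def)
  then show ?thesis by simp
qed

lemma p_part_eq_single: "p_part m \<Lambda> = Poly_Mapping.single (part_monom m \<Lambda>) 1"
proof -
  have "(\<Prod>l\<in>#M. pvar r l) = Poly_Mapping.single (\<Sum>l\<in>#M. Poly_Mapping.single (r, l) 1) 1" for r M
    by (induction M) (simp_all add: pvar_def mult_single)
  moreover have "(\<Prod>r\<in>A. Poly_Mapping.single (f r) (1::complex)) = Poly_Mapping.single (\<Sum>r\<in>A. f r) 1"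
    for A :: "nat set" and f :: "nat \<Rightarrow> pmonom"
    by (induction A rule: infinite_finite_induct) (simp_all add: mult_single)
  ultimately show ?thesis by (simp add: p_part_def part_monom_def del: One_nat_def)
qed

lemma monom_deg_part_monom: "monom_deg (part_monom m \<Lambda>) = (\<Sum>r<m. \<Sum>\<^sub># (\<Lambda> ! r))"
proof -
  have "monom_deg (\<Sum>l\<in>#M. Poly_Mapping.single (r, l) 1) = \<Sum>\<^sub># M" for r M
    by (induction M) (simp_all add: monom_deg_zero monom_deg_add monom_deg_single)
  then show ?thesis by (simp add: part_monom_def monom_deg_sum del: One_nat_def)
qed

lemma coloured_partition_monom:
  assumes "coloured_partition m n \<Lambda>"
  shows "proper_monom m (part_monom m \<Lambda>)" "monom_deg (part_monom m \<Lambda>) = n"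
proof -
  show "proper_monom m (part_monom m \<Lambda>)"
    unfolding proper_monom_def
  proof
    fix w assume "w \<in> Poly_Mapping.keys (part_monom m \<Lambda>)"
    then have "fst w < m" "snd w \<in># \<Lambda> ! fst w"
      using lookup_part_monom[of m \<Lambda> "fst w" "snd w"] by (auto simp: in_keys_iff split: if_splits)
    moreover have "0 \<notin># \<Lambda> ! fst w"
      using assms \<open>fst w < m\<close> by (simp add: coloured_partition_def)
    ultimately have "snd w \<noteq> 0" by metis
    then show "fst w < m \<and> 1 \<le> snd w" using \<open>fst w < m\<close> by simp
  qed
  show "monom_deg (part_monom m \<Lambda>) = n"
    using assms by (simp add: monom_deg_part_monom coloured_partition_def)
qed

lemma count_image_mset_set:
  assumes "finite A"
  shows "count (image_mset f (mset_set A)) x = card {a \<in> A. f a = x}"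
  using assms
proof (induction A rule: finite_induct)
  case (insert a A)
  have "{b \<in> insert a A. f b = x} = (if f a = x then insert a {b \<in> A. f b = x} else {b \<in> A. f b = x})"
    by auto
  then show ?case using insert by simp
qed simp

lemma count_cycles_of_colour:
  assumes m: "m \<ge> 1"
  shows "count (image_mset card (mset_set (cycles_of_colour m n z r))) l =
    Poly_Mapping.lookup (mat_type m n z) (r, l)"
proof -
  have "finite (cycles_of_colour m n z r)" by (simp add: cycles_of_colour_def)
  then have "count (image_mset card (mset_set (cycles_of_colour m n z r))) l =
      card {c \<in> cycles_of_colour m n z r. card c = l}" by (rule count_image_mset_set)
  also have "{c \<in> cycles_of_colour m n z r. card c = l} =
      {c \<in> cycle_sets {..<n} (perm_of z). cycle_type m (colour_of m z) c = (r, l)}"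
    by (auto simp: cycles_of_colour_def cycle_sets_def cycle_type_def)
  finally show ?thesis
    by (simp add: mat_type_def type_monom_def lookup_sum_single[OF finite_cycle_sets] del: One_nat_def)
qed

lemma conj_class_eq:
  assumes m: "m \<ge> 1"
  shows "conj_class m n \<Lambda> = {z \<in> carrier (Gm1n m n). mat_type m n z = part_monom m \<Lambda>}"
proof -
  have "(\<forall>r<m. \<Lambda> ! r = image_mset card (mset_set (cycles_of_colour m n z r))) \<longleftrightarrow>
      mat_type m n z = part_monom m \<Lambda>" (is "?L \<longleftrightarrow> _") if z: "z \<in> carrier (Gm1n m n)" for z
  proof -
    have "Poly_Mapping.lookup (mat_type m n z) (r, l) = 0" if "r \<ge> m" for r l
      using mat_type_proper(1)[OF m z] that
      by (auto simp: proper_monom_def in_keys_iff dest!: bspec[of _ _ "(r, l)"])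
    then have "mat_type m n z = part_monom m \<Lambda> \<longleftrightarrow>
        (\<forall>r<m. \<forall>l. Poly_Mapping.lookup (mat_type m n z) (r, l) = count (\<Lambda> ! r) l)"
      by (auto simp: poly_mapping_eq_iff fun_eq_iff lookup_part_monom)
    then show ?thesis by (auto simp: multiset_eq_iff count_cycles_of_colour[OF m])
  qed
  then show ?thesis by (auto simp: conj_class_def)
qed

lemma ex_coloured_partition:
  assumes m: "m \<ge> 1" and z: "z \<in> carrier (Gm1n m n)"
  obtains \<Lambda> where "coloured_partition m n \<Lambda>" "part_monom m \<Lambda> = mat_type m n z"
proof -
  define \<Lambda> where "\<Lambda> = map (\<lambda>r. image_mset card (mset_set (cycles_of_colour m n z r))) [0..<m]"
  have nth: "\<Lambda> ! r = image_mset card (mset_set (cycles_of_colour m n z r))" if "r < m" for r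
    using that by (simp add: \<Lambda>_def)
  then have "z \<in> conj_class m n \<Lambda>" using z by (simp add: conj_class_def)
  then have eq: "part_monom m \<Lambda> = mat_type m n z" by (simp add: conj_class_eq[OF m])
  have "coloured_partition m n \<Lambda>"
    unfolding coloured_partition_def
  proof (intro conjI allI impI)
    show "length \<Lambda> = m" by (simp add: \<Lambda>_def)
    show "(\<Sum>r<m. \<Sum>\<^sub># (\<Lambda> ! r)) = n"
      using mat_type_proper(2)[OF m z] by (simp add: monom_deg_part_monom flip: eq)
    fix r assume r: "r < m"
    show "0 \<notin># \<Lambda> ! r"
    proof
      assume "0 \<in># \<Lambda> ! r"
      then have "Poly_Mapping.lookup (mat_type m n z) (r, 0) \<noteq> 0"
        using r by (simp add: lookup_part_monom flip: eq)
      then show False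
        using bspec[OF mat_type_proper(1)[OF m z, unfolded proper_monom_def], of "(r, 0)"]
        by (simp add: in_keys_iff)
    qed
  qed
  then show ?thesis using that eq by blast
qed

section \<open>The reflections and their products with a group element\<close>

lemma cycle_sets_id: "cycle_sets S id = (\<lambda>x. {x}) ` S"
  unfolding cycle_sets_def by (intro image_cong) (simp_all add: orbit_eq_singleton_iff)

lemma singleton_cycle_set:
  assumes u: "u permutes S" "finite S" and x: "x \<in> S" and card: "card (orbit u x) = 1"
  shows "orbit u x = {x}" "u x = x"
proof -
  obtain y where "orbit u x = {y}" using card card_1_singletonE by blast
  then show "orbit u x = {x}" using self_in_orbit_permutes[OF u, of x] by simp
  then show "u x = x" by (simp add: orbit_eq_singleton_iff)
qed

definition shift_colour :: "'a \<Rightarrow> nat \<Rightarrow> 'a \<Rightarrow> nat" where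
  "shift_colour a k i = (if i = a then k else 0)"

definition diagonal_reflection :: "nat \<Rightarrow> nat \<Rightarrow> nat \<Rightarrow> nat \<Rightarrow> complex mat" where
  "diagonal_reflection m n a k = coloured_perm_mat m n id (shift_colour a k)"

definition transposition_reflection :: "nat \<Rightarrow> nat \<Rightarrow> nat \<Rightarrow> nat \<Rightarrow> nat \<Rightarrow> complex mat" where
  "transposition_reflection m n a b t =
     coloured_perm_mat m n (transpose a b) (transposition_colour m a b t)"

text \<open>A diagonal reflection at \<open>a\<close> leaves the permutation alone and adds \<open>k\<close> to the colour of the cycle
  through \<open>a\<close>.\<close>

lemma type_poly_shift:
  assumes u: "u permutes S" "finite S" and c: "c \<in> cycle_sets S u" "a \<in> c"
  shows "type_poly m S u (\<lambda>i. g i + shift_colour a k (u i)) =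
    pv (((\<Sum>i\<in>c. g i) + k) mod m, card c) * (\<Prod>e\<in>cycle_sets S u - {c}. pv (cycle_type m g e))"
proof -
  let ?g = "\<lambda>i. g i + shift_colour a k (u i)"
  have sum: "(\<Sum>i\<in>e. ?g i) = (\<Sum>i\<in>e. g i) + (if a \<in> e then k else 0)" if e: "e \<in> cycle_sets S u" for e
  proof -
    have "inj_on u e" using u(1) by (meson inj_on_subset permutes_inj subset_UNIV)
    then have "(\<Sum>i\<in>e. ?g i) = (\<Sum>i\<in>e. g i) + (\<Sum>i\<in>e. shift_colour a k i)"
      by (simp add: sum_colour_product image_cycle_set[OF u e])
    then show ?thesis using finite_cycle_set[OF u e] by (simp add: shift_colour_def)
  qed
  have other: "a \<notin> e" if "e \<in> cycle_sets S u - {c}" for e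
    using cycle_sets_disjoint[OF u c(1), of e] that c(2) by blast
  have "type_poly m S u ?g = pv (cycle_type m ?g c) * (\<Prod>e\<in>cycle_sets S u - {c}. pv (cycle_type m ?g e))"
    unfolding type_poly_def using finite_cycle_sets[OF u(2)] c(1) by (rule prod.remove)
  also have "cycle_type m ?g c = (((\<Sum>i\<in>c. g i) + k) mod m, card c)"
    using sum[OF c(1)] c(2) by (simp add: cycle_type_def)
  also have "(\<Prod>e\<in>cycle_sets S u - {c}. pv (cycle_type m ?g e)) =
      (\<Prod>e\<in>cycle_sets S u - {c}. pv (cycle_type m g e))"
    using sum other by (intro prod.cong) (auto simp: cycle_type_def)
  finally show ?thesis .
qed

lemma sum_type_poly_shift:
  assumes u: "u permutes S" "finite S" and m: "m \<ge> 1"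
  shows "(\<Sum>a\<in>S. type_poly m S u (\<lambda>i. g i + shift_colour a k (u i))) = recolour m (card S) k (type_poly m S u g)"
proof -
  let ?Q = "cycle_sets S u"
  let ?J = "\<lambda>c. pv (((\<Sum>i\<in>c. g i) + k) mod m, card c) * (\<Prod>e\<in>?Q - {c}. pv (cycle_type m g e))"
  have "(\<Sum>a\<in>S. type_poly m S u (\<lambda>i. g i + shift_colour a k (u i))) = (\<Sum>c\<in>?Q. \<Sum>a\<in>c. ?J c)"
    unfolding sum_over_cycle_sets[OF u] by (intro sum.cong refl type_poly_shift[OF u])
  also have "\<dots> = (\<Sum>c\<in>?Q. of_nat (card c) * ?J c)" by simp
  also have "\<dots> = recolour m (card S) k (\<Prod>c\<in>?Q. pv (cycle_type m g c))"
  proof (subst recolour_prod_pv[OF finite_cycle_sets[OF u(2)]])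
    fix c assume c: "c \<in> ?Q"
    show "fst (cycle_type m g c) < m \<and> 1 \<le> snd (cycle_type m g c) \<and> snd (cycle_type m g c) \<le> card S"
      using m card_cycle_set_pos[OF u c] card_mono[OF u(2) cycle_set_subset[OF u(1) c]]
      by (simp add: cycle_type_def)
  qed (simp add: cycle_type_def mod_add_left_eq)
  finally show ?thesis by (simp add: type_poly_def)
qed

lemma sum_type_poly_transpositions_eq_cut_join:
  assumes u: "u permutes S" "finite S" and m: "m \<ge> 1"
  shows "(\<Sum>a\<in>S. \<Sum>b\<in>S - {a}. \<Sum>t<m. type_poly m S (transpose a b \<circ> u)
        (\<lambda>k. g k + transposition_colour m a b t (u k))) = cut_join m (card S) (type_poly m S u g)"
  unfolding sum_type_poly_transpositions[OF u m] unfolding type_poly_def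
proof (subst cut_join_prod_pv[OF finite_cycle_sets[OF u(2)]])
  fix c assume c: "c \<in> cycle_sets S u"
  show "fst (cycle_type m g c) < m \<and> 1 \<le> snd (cycle_type m g c) \<and> snd (cycle_type m g c) \<le> card S"
    using m card_cycle_set_pos[OF u c] card_mono[OF u(2) cycle_set_subset[OF u(1) c]]
    by (simp add: cycle_type_def)
qed (simp add: cycle_type_def mod_add_eq)

lemma lookup_type_monom:
  "finite S \<Longrightarrow> Poly_Mapping.lookup (type_monom m S u g) w = card {c \<in> cycle_sets S u. cycle_type m g c = w}"
  unfolding type_monom_def by (rule lookup_sum_single[OF finite_cycle_sets])

lemma cycle_type_in_keys:
  assumes "finite S" "c \<in> cycle_sets S u"
  shows "Poly_Mapping.lookup (type_monom m S u g) (cycle_type m g c) \<noteq> 0"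
proof -
  have "c \<in> {d \<in> cycle_sets S u. cycle_type m g d = cycle_type m g c}" using assms(2) by simp
  then show ?thesis
    using finite_cycle_sets[OF assms(1), of u] by (auto simp: lookup_type_monom[OF assms(1)] card_eq_0_iff)
qed

lemma type_monom_id:
  "type_monom m S id g = (\<Sum>x\<in>S. Poly_Mapping.single (g x mod m, 1) 1)"
  unfolding type_monom_def cycle_sets_id by (simp add: sum.reindex cycle_type_def)

lemma sum_single_nat_const:
  "(\<Sum>x\<in>A. Poly_Mapping.single w (1::nat)) = Poly_Mapping.single w (card A)"
  by (induction A rule: infinite_finite_induct) (simp_all flip: single_add)

text \<open>The types of the two kinds of reflections, written as exponents: membership in the classes becomes
  a statement about the number of cycles of each type.\<close>

lemma part_monom_class_L:
  assumes "1 \<le> k" "k < m"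
  shows "part_monom m ((replicate m {#})[0 := replicate_mset (n - 1) 1, k := {#1#}]) =
    Poly_Mapping.single (k, 1) 1 + Poly_Mapping.single (0, 1) (n - 1)"
proof (rule poly_mapping_eqI)
  fix w :: "nat \<times> nat"
  obtain r l where "w = (r, l)" by fastforce
  then show "Poly_Mapping.lookup (part_monom m ((replicate m {#})[0 := replicate_mset (n - 1) 1, k := {#1#}])) w =
      Poly_Mapping.lookup (Poly_Mapping.single (k, 1) 1 + Poly_Mapping.single (0, 1) (n - 1)) w"
    using assms by (auto simp: lookup_part_monom lookup_add lookup_single when_def nth_list_update)
qed

lemma part_monom_class_R:
  assumes "m \<ge> 1"
  shows "part_monom m ((replicate m {#})[0 := add_mset 2 (replicate_mset (n - 2) 1)]) =
    Poly_Mapping.single (0, 2) 1 + Poly_Mapping.single (0, 1) (n - 2)"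
proof (rule poly_mapping_eqI)
  fix w :: "nat \<times> nat"
  obtain r l where "w = (r, l)" by fastforce
  then show "Poly_Mapping.lookup (part_monom m ((replicate m {#})[0 := add_mset 2 (replicate_mset (n - 2) 1)])) w =
      Poly_Mapping.lookup (Poly_Mapping.single (0, 2) 1 + Poly_Mapping.single (0, 1) (n - 2)) w"
    using assms by (auto simp: lookup_part_monom lookup_add lookup_single when_def nth_list_update)
qed

text \<open>If the type allows only cycles of length 1, the permutation is the identity; a single point has
  colour \<open>k\<close>, and it determines the reflection.\<close>

lemma class_L_bij:
  assumes m: "m \<ge> 1" and k: "1 \<le> k" "k < m"
  shows "bij_betw (\<lambda>a. diagonal_reflection m n a k) {..<n} (class_L m n k)"
proof (rule bij_betw_imageI)
  have cl: "class_L m n k = {z \<in> carrier (Gm1n m n).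
      mat_type m n z = Poly_Mapping.single (k, 1) 1 + Poly_Mapping.single (0, 1) (n - 1)}"
    unfolding class_L_def conj_class_eq[OF m] part_monom_class_L[OF k] ..
  show "inj_on (\<lambda>a. diagonal_reflection m n a k) {..<n}"
  proof (rule inj_onI)
    fix a b assume ab: "a \<in> {..<n}" "b \<in> {..<n}" "diagonal_reflection m n a k = diagonal_reflection m n b k"
    then have "[shift_colour a k a = shift_colour b k a] (mod m)"
      using coloured_perm_mat_eqD(2)[OF m permutes_id permutes_id] by (auto simp: diagonal_reflection_def)
    then show "a = b" using k by (auto simp: shift_colour_def cong_def split: if_splits)
  qed
  show "(\<lambda>a. diagonal_reflection m n a k) ` {..<n} = class_L m n k"
  proof (intro equalityI subsetI)
    fix z assume "z \<in> (\<lambda>a. diagonal_reflection m n a k) ` {..<n}"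
    then obtain a where a: "a < n" and z: "z = diagonal_reflection m n a k" by auto
    have "mat_type m n z = (\<Sum>x<n. Poly_Mapping.single (shift_colour a k x mod m, 1) 1)"
      unfolding z diagonal_reflection_def mat_type_coloured_perm_mat[OF m permutes_id] type_monom_id ..
    also have "\<dots> = Poly_Mapping.single (k, 1) 1 + (\<Sum>x\<in>{..<n} - {a}. Poly_Mapping.single (shift_colour a k x mod m, 1) 1)"
      using a k by (subst sum.remove[of _ a]) (auto simp: shift_colour_def)
    also have "(\<Sum>x\<in>{..<n} - {a}. Poly_Mapping.single (shift_colour a k x mod m, 1::nat) (1::nat)) =
        (\<Sum>x\<in>{..<n} - {a}. Poly_Mapping.single (0, 1) 1)"
      by (intro sum.cong) (auto simp: shift_colour_def)
    also have "\<dots> = Poly_Mapping.single (0, 1) (n - 1)"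
      unfolding sum_single_nat_const using a by simp
    finally show "z \<in> class_L m n k"
      unfolding cl using coloured_perm_mat_carrier[OF m permutes_id] by (simp add: z diagonal_reflection_def)
  next
    fix z assume "z \<in> class_L m n k"
    then have zG: "z \<in> carrier (Gm1n m n)"
      and ty: "mat_type m n z = Poly_Mapping.single (k, 1) 1 + Poly_Mapping.single (0, 1) (n - 1)"
      by (simp_all add: cl)
    obtain u g where u: "u permutes {..<n}" and g: "\<And>i. g i < m" and z: "z = coloured_perm_mat m n u g"
      using carrier_Gm1nE[OF m zG] by metis
    have tm: "type_monom m {..<n} u g = Poly_Mapping.single (k, 1) 1 + Poly_Mapping.single (0, 1) (n - 1)"
      using ty unfolding z mat_type_coloured_perm_mat[OF m u] .
    have cyc: "cycle_type m g c \<in> {(k, 1), (0, 1)}" if "c \<in> cycle_sets {..<n} u" for c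
      using cycle_type_in_keys[OF finite_lessThan that, of m g]
      by (auto simp: tm lookup_add lookup_single when_def split: if_splits)
    have fixed: "u x = x \<and> orbit u x = {x}" if "x < n" for x
    proof -
      have "orbit u x \<in> cycle_sets {..<n} u" using that by (simp add: cycle_sets_def)
      from cyc[OF this] have "card (orbit u x) = 1" by (auto simp: cycle_type_def)
      then show ?thesis using singleton_cycle_set[OF u finite_lessThan, of x] that by simp
    qed
    have sing: "{x} \<in> cycle_sets {..<n} u" if "x < n" for x
    proof -
      have "orbit u x \<in> cycle_sets {..<n} u" using that by (simp add: cycle_sets_def)
      then show ?thesis using fixed[OF that] by simp
    qed
    have sing_type: "cycle_type m g {x} = (g x, 1)" for x using g[of x] by (simp add: cycle_type_def)
    have gs: "g x = k \<or> g x = 0" if "x < n" for x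
      using cyc[OF sing[OF that]] unfolding sing_type by auto
    have "card {c \<in> cycle_sets {..<n} u. cycle_type m g c = (k, 1)} = 1"
      using lookup_type_monom[OF finite_lessThan, of m n u g "(k, 1)"] k
      by (simp add: tm lookup_add lookup_single when_def)
    then obtain c0 where c0: "{c \<in> cycle_sets {..<n} u. cycle_type m g c = (k, 1)} = {c0}"
      using card_1_singletonE by blast
    then have "c0 \<in> cycle_sets {..<n} u" "cycle_type m g c0 = (k, 1)" by blast+
    then obtain a where a: "a < n" "c0 = {a}" using fixed by (auto simp: cycle_sets_def)
    have ga: "g a = k" using \<open>cycle_type m g c0 = (k, 1)\<close> by (simp add: a sing_type)
    have "g x = 0" if "x < n" "x \<noteq> a" for x
    proof (rule ccontr)
      assume "g x \<noteq> 0"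
      then have "g x = k" using gs[OF that(1)] by simp
      then have "{x} \<in> {c \<in> cycle_sets {..<n} u. cycle_type m g c = (k, 1)}"
        using sing that by (simp add: sing_type)
      then have "{x} = c0" unfolding c0 by (rule singletonD)
      then show False using a that by simp
    qed
    then have "z = diagonal_reflection m n a k"
      unfolding z diagonal_reflection_def using fixed ga
      by (intro coloured_perm_mat_cong[OF m]) (auto simp: shift_colour_def)
    then show "z \<in> (\<lambda>a. diagonal_reflection m n a k) ` {..<n}" using a by blast
  qed
qed

lemma transpose_eqD:
  assumes "transpose a b = transpose c d" "a < b" "c < (d::nat)"
  shows "a = c \<and> b = d"
proof -
  have "{x. transpose i j x \<noteq> x} = {i, j}" if "i < j" for i j :: nat
    using that by (auto simp: transpose_def)
  then have "{a, b} = {c, d}" using assms by metis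
  then show ?thesis using assms(2,3) by (auto simp: doubleton_eq_iff)
qed

lemma transposition_reflection_type:
  assumes m: "m \<ge> 1" and ab: "a < n" "b < n" "a \<noteq> b" and t: "t \<le> m"
  shows "mat_type m n (transposition_reflection m n a b t) =
    Poly_Mapping.single (0, 2) 1 + Poly_Mapping.single (0, 1) (n - 2)"
proof -
  have perm: "transpose a b permutes {..<n}" using ab by (intro permutes_swap_id) auto
  have sing: "{x} \<in> cycle_sets {..<n} id" if "x < n" for x using that by (simp add: cycle_sets_id)
  have "type_poly m {..<n} (transpose a b \<circ> id) (\<lambda>k. 0 + transposition_colour m a b t (id k)) =
      pv (((\<Sum>i\<in>{a}. 0) + (\<Sum>i\<in>{b}. 0)) mod m, card {a} + card {b}) *
      (\<Prod>e\<in>cycle_sets {..<n} id - {{a}, {b}}. pv (cycle_type m (\<lambda>_. 0) e))"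
    using ab t by (intro type_poly_join[OF permutes_id finite_lessThan]) (auto simp: sing)
  also have "(\<Prod>e\<in>cycle_sets {..<n} id - {{a}, {b}}. pv (cycle_type m (\<lambda>_. 0) e)) =
      (\<Prod>e\<in>cycle_sets {..<n} id - {{a}, {b}}. pv (0, 1))"
    by (intro prod.cong) (auto simp: cycle_sets_id cycle_type_def)
  also have "cycle_sets {..<n} id - {{a}, {b}} = (\<lambda>x. {x}) ` ({..<n} - {a, b})"
    by (auto simp: cycle_sets_id)
  also have "(\<Prod>e\<in>(\<lambda>x. {x}) ` ({..<n} - {a, b}). pv (0, 1)) = (\<Prod>e\<in>{..<n} - {a, b}. pv (0, 1))"
    by (subst prod.reindex) auto
  also have "\<dots> = Poly_Mapping.single (\<Sum>e\<in>{..<n} - {a, b}. Poly_Mapping.single (0, 1) 1) 1"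
    by (rule prod_pv_eq_single)
  also have "(\<Sum>e\<in>{..<n} - {a, b}. Poly_Mapping.single (0, 1) 1) = Poly_Mapping.single (0::nat, 1::nat) (n - 2)"
    unfolding sum_single_nat_const using ab by (simp add: card_Diff_subset numeral_2_eq_2)
  also have "pv (((\<Sum>i\<in>{a}. 0) + (\<Sum>i\<in>{b}. 0)) mod m, card {a} + card {b}) * Poly_Mapping.single (Poly_Mapping.single (0, 1) (n - 2)) 1 =
      Poly_Mapping.single (Poly_Mapping.single (0, 2) 1 + Poly_Mapping.single (0, 1) (n - 2)) 1"
    by (simp add: pv_def mult_single numeral_2_eq_2)
  finally have "type_monom m {..<n} (transpose a b) (transposition_colour m a b t) =
      Poly_Mapping.single (0, 2) 1 + Poly_Mapping.single (0, 1) (n - 2)"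
    unfolding type_poly_eq_single single_one_eq_iff by simp
  then show ?thesis
    unfolding transposition_reflection_def mat_type_coloured_perm_mat[OF m perm] .
qed

text \<open>A type with one cycle of length 2 forces the permutation to be a transposition. All colours off
  this cycle vanish, and the two colours on it are opposite because the colour of the cycle is 0.
  Taking \<open>a < b\<close> makes the parametrisation injective.\<close>

lemma class_R_bij:
  assumes m: "m \<ge> 1" and n: "n \<ge> 2"
  shows "bij_betw (\<lambda>(a, b, t). transposition_reflection m n a b t)
    {(a, b, t). a < b \<and> b < n \<and> t < m} (class_R m n)"
proof (rule bij_betw_imageI)
  let ?T = "{(a, b, t). a < b \<and> b < n \<and> t < m}"
  have cl: "class_R m n = {z \<in> carrier (Gm1n m n).
      mat_type m n z = Poly_Mapping.single (0, 2) 1 + Poly_Mapping.single (0, 1) (n - 2)}"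
    unfolding class_R_def conj_class_eq[OF m] part_monom_class_R[OF m] using n by simp
  have perm: "transpose a b permutes {..<n}" if "a < b" "b < n" for a b
    using that by (intro permutes_swap_id) auto
  show "inj_on (\<lambda>(a, b, t). transposition_reflection m n a b t) ?T"
  proof (rule inj_onI)
    fix p q assume pq: "p \<in> ?T" "q \<in> ?T" "(\<lambda>(a, b, t). transposition_reflection m n a b t) p =
      (\<lambda>(a, b, t). transposition_reflection m n a b t) q"
    obtain a b t a' b' t' where p: "p = (a, b, t)" and q: "q = (a', b', t')" by (metis prod.exhaust)
    have ab: "a < b" "b < n" "t < m" "a' < b'" "b' < n" "t' < m"
      and eq: "transposition_reflection m n a b t = transposition_reflection m n a' b' t'"
      using pq unfolding p q by auto
    note D = coloured_perm_mat_eqD[OF m perm perm, OF ab(1,2) ab(4,5) eq[unfolded transposition_reflection_def]]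
    have ab': "a = a' \<and> b = b'" using transpose_eqD[OF D(1) ab(1,4)] .
    have "[t = t'] (mod m)" using D(2)[of a] ab ab' by (simp add: transposition_colour_def)
    then show "p = q" unfolding p q using ab ab' by (simp add: cong_def)
  qed
  show "(\<lambda>(a, b, t). transposition_reflection m n a b t) ` ?T = class_R m n"
  proof (intro equalityI subsetI)
    fix z assume "z \<in> (\<lambda>(a, b, t). transposition_reflection m n a b t) ` ?T"
    then obtain a b t where ab: "a < b" "b < n" "t < m" and z: "z = transposition_reflection m n a b t"
      by auto
    show "z \<in> class_R m n"
      using transposition_reflection_type[OF m, of a n b t] coloured_perm_mat_carrier[OF m perm[OF ab(1,2)]] ab
      by (simp add: cl z transposition_reflection_def)
  next
    fix z assume "z \<in> class_R m n"
    then have zG: "z \<in> carrier (Gm1n m n)"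
      and ty: "mat_type m n z = Poly_Mapping.single (0, 2) 1 + Poly_Mapping.single (0, 1) (n - 2)"
      by (simp_all add: cl)
    obtain u g where u: "u permutes {..<n}" and g: "\<And>i. g i < m" and z: "z = coloured_perm_mat m n u g"
      using carrier_Gm1nE[OF m zG] by metis
    let ?Q = "cycle_sets {..<n} u"
    have tm: "type_monom m {..<n} u g = Poly_Mapping.single (0, 2) 1 + Poly_Mapping.single (0, 1) (n - 2)"
      using ty unfolding z mat_type_coloured_perm_mat[OF m u] .
    have cyc: "cycle_type m g c \<in> {(0, 2), (0, 1)}" if "c \<in> ?Q" for c
      using cycle_type_in_keys[OF finite_lessThan that, of m g]
      by (auto simp: tm lookup_add lookup_single when_def split: if_splits)
    have "card {c \<in> ?Q. cycle_type m g c = (0, 2)} = 1"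
      using lookup_type_monom[OF finite_lessThan, of m n u g "(0, 2)"]
      by (simp add: tm lookup_add lookup_single when_def)
    then obtain c where c: "{c \<in> ?Q. cycle_type m g c = (0, 2)} = {c}"
      using card_1_singletonE by blast
    then have cQ: "c \<in> ?Q" and tyc: "cycle_type m g c = (0, 2)" by blast+
    then obtain x y where xy: "c = {x, y}" "x \<noteq> y" by (auto simp: cycle_type_def card_2_iff)
    define a b where "a = min x y" and "b = max x y"
    have ab: "c = {a, b}" "a < b" using xy by (auto simp: a_def b_def min_def max_def)
    have bn: "b < n" using cycle_set_subset[OF u cQ] ab by auto
    have orb: "orbit u a = c" "orbit u b = c"
      using orbit_eq_cycle_set[OF u finite_lessThan cQ] ab by auto
    have "u a \<in> c" "u b \<in> c" using image_cycle_set[OF u finite_lessThan cQ] ab by auto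
    moreover have "u a \<noteq> a" "u b \<noteq> b"
      using orb ab orbit_eq_singleton_iff[of u a] orbit_eq_singleton_iff[of u b] by auto
    ultimately have uab: "u a = b" "u b = a" using ab by auto
    have fixed: "u x = x \<and> g x = 0" if x: "x < n" "x \<noteq> a" "x \<noteq> b" for x
    proof -
      have oQ: "orbit u x \<in> ?Q" using x by (simp add: cycle_sets_def)
      have "orbit u x \<noteq> c" using self_in_orbit_permutes[OF u finite_lessThan, of x] ab x by auto
      then have "cycle_type m g (orbit u x) \<noteq> (0, 2)" using c oQ by blast
      then have ty: "cycle_type m g (orbit u x) = (0, 1)" using cyc[OF oQ] by blast
      then have "card (orbit u x) = 1" by (simp add: cycle_type_def)
      then have "orbit u x = {x}" "u x = x" using singleton_cycle_set[OF u finite_lessThan, of x] x by auto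
      then show ?thesis using ty g[of x] by (simp add: cycle_type_def)
    qed
    have sum0: "(g a + g b) mod m = 0" using tyc ab by (simp add: cycle_type_def)
    have gb: "[g b = m - g a] (mod m)"
    proof -
      have "[g a + g b = g a + (m - g a)] (mod m)"
        using sum0 g[of a] by (simp add: cong_def)
      then show ?thesis by (simp add: cong_add_lcancel_nat)
    qed
    have "z = transposition_reflection m n a b (g a)"
      unfolding z transposition_reflection_def
    proof (rule coloured_perm_mat_cong[OF m])
      fix k assume "k < n"
      then show "u k = transpose a b k" using fixed[of k] uab by (auto simp: transpose_def)
      show "[g k = transposition_colour m a b (g a) k] (mod m)"
        using fixed[of k] gb \<open>k < n\<close> by (auto simp: transposition_colour_def)
    qed
    then show "z \<in> (\<lambda>(a, b, t). transposition_reflection m n a b t) ` ?T"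
      using ab bn g[of a] by (intro image_eqI[of _ _ "(a, b, g a)"]) auto
  qed
qed

text \<open>The triples \<open>(a, b, t)\<close> and \<open>(b, a, - t)\<close> describe the same reflection. For \<open>n = 1\<close> both sides are
  empty sums.\<close>

lemma sum_class_R:
  fixes f :: "complex mat \<Rightarrow> 'b::comm_semiring_1"
  assumes m: "m \<ge> 1" and n: "n \<ge> 1"
  shows "(\<Sum>a<n. \<Sum>b\<in>{..<n} - {a}. \<Sum>t<m. f (transposition_reflection m n a b t)) = 2 * (\<Sum>x\<in>class_R m n. f x)"
proof (cases "n = 1")
  case True
  then show ?thesis by (simp add: class_R_def lessThan_Suc)
next
  case False
  then have n: "n \<ge> 2" using n by simp
  let ?F = "\<lambda>a b. \<Sum>t<m. f (transposition_reflection m n a b t)"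
  let ?T = "{(a, b, t). a < b \<and> b < n \<and> t < m}"
  have swap: "transposition_reflection m n a b t = transposition_reflection m n b a ((m - t) mod m)"
    if "a \<noteq> b" "t < m" for a b t
    unfolding transposition_reflection_def
  proof (rule coloured_perm_mat_cong[OF m])
    fix k
    show "transpose a b k = transpose b a k" by (simp add: transpose_commute)
    show "[transposition_colour m a b t k = transposition_colour m b a ((m - t) mod m) k] (mod m)"
      using that by (cases "t = 0") (auto simp: transposition_colour_def cong_def)
  qed
  have sym: "?F a b = ?F b a" if "a \<noteq> b" for a b
  proof (rule sum.reindex_bij_witness[of _ "\<lambda>t. (m - t) mod m" "\<lambda>t. (m - t) mod m"])
    fix t assume t: "t \<in> {..<m}"
    then show "(m - (m - t) mod m) mod m = t" by (cases "t = 0") auto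
    show "(m - t) mod m \<in> {..<m}" using m by simp
    show "f (transposition_reflection m n b a ((m - t) mod m)) = f (transposition_reflection m n a b t)"
      using swap[OF that, of t] t by simp
  next
    fix t assume t: "t \<in> {..<m}"
    then show "(m - (m - t) mod m) mod m = t" by (cases "t = 0") auto
    show "(m - t) mod m \<in> {..<m}" using m by simp
  qed
  have "(\<Sum>a<n. \<Sum>b\<in>{..<n} - {a}. ?F a b) =
      (\<Sum>a<n. \<Sum>b<n. (if a < b then ?F a b else 0) + (if b < a then ?F a b else 0))"
  proof (rule sum.cong)
    fix a assume "a \<in> {..<n}"
    have "(\<Sum>b\<in>{..<n} - {a}. ?F a b) = (\<Sum>b\<in>{..<n} - {a}. (if a < b then ?F a b else 0) + (if b < a then ?F a b else 0))"
      by (intro sum.cong) auto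
    also have "\<dots> = (\<Sum>b<n. (if a < b then ?F a b else 0) + (if b < a then ?F a b else 0))"
      by (intro sum.mono_neutral_left) auto
    finally show "(\<Sum>b\<in>{..<n} - {a}. ?F a b) =
        (\<Sum>b<n. (if a < b then ?F a b else 0) + (if b < a then ?F a b else 0))" .
  qed simp
  also have "\<dots> = (\<Sum>a<n. \<Sum>b<n. if a < b then ?F a b else 0) + (\<Sum>a<n. \<Sum>b<n. if b < a then ?F a b else 0)"
    by (simp add: sum.distrib)
  also have "(\<Sum>a<n. \<Sum>b<n. if b < a then ?F a b else 0) = (\<Sum>b<n. \<Sum>a<n. if b < a then ?F a b else 0)"
    by (rule sum.swap)
  also have "\<dots> = (\<Sum>b<n. \<Sum>a<n. if b < a then ?F b a else 0)"
    by (intro sum.cong refl) (use sym in auto)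
  also have "(\<Sum>a<n. \<Sum>b<n. if a < b then ?F a b else 0) =
      (\<Sum>(a, b, t)\<in>{..<n} \<times> {..<n} \<times> {..<m}. if a < b then f (transposition_reflection m n a b t) else 0)"
    unfolding sum.cartesian_product[symmetric] by (intro sum.cong refl) auto
  also have "\<dots> = (\<Sum>(a, b, t)\<in>?T. f (transposition_reflection m n a b t))"
    by (intro sum.mono_neutral_cong_right) (auto split: if_splits)
  also have "\<dots> = (\<Sum>x\<in>class_R m n. f x)"
    using sum.reindex_bij_betw[OF class_R_bij[OF m n], of f] by (simp add: case_prod_beta)
  finally show ?thesis unfolding mult_2 .
qed

text \<open>The combinatorial core of the theorem: for a single group element \<open>z\<close>, the monomials of the
  products of the reflections with \<open>z\<close> add up to the cut-and-join operator applied to the monomial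
  of \<open>z\<close>.\<close>

lemma sum_class_R_product:
  assumes m: "m \<ge> 1" and n: "n \<ge> 1" and z: "z \<in> carrier (Gm1n m n)"
  shows "(\<Sum>x\<in>class_R m n. Poly_Mapping.single (mat_type m n (x * z)) 1) =
    (1 / 2) *\<^sub>C cut_join m n (Poly_Mapping.single (mat_type m n z) 1)"
proof -
  obtain u g where u: "u permutes {..<n}" and z: "z = coloured_perm_mat m n u g"
    using carrier_Gm1nE[OF m z] .
  have "cut_join m n (Poly_Mapping.single (mat_type m n z) 1) = cut_join m (card {..<n}) (type_poly m {..<n} u g)"
    by (simp add: z mat_type_coloured_perm_mat[OF m u] type_poly_eq_single)
  also have "\<dots> = (\<Sum>a<n. \<Sum>b\<in>{..<n} - {a}. \<Sum>t<m. type_poly m {..<n} (transpose a b \<circ> u)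
        (\<lambda>k. g k + transposition_colour m a b t (u k)))"
    by (rule sum_type_poly_transpositions_eq_cut_join[OF u finite_lessThan m, symmetric])
  also have "\<dots> = (\<Sum>a<n. \<Sum>b\<in>{..<n} - {a}. \<Sum>t<m.
      Poly_Mapping.single (mat_type m n (transposition_reflection m n a b t * z)) 1)"
  proof (intro sum.cong refl)
    fix a b t assume "a \<in> {..<n}" "b \<in> {..<n} - {a}"
    then have "(transpose a b \<circ> u) permutes {..<n}" by (intro permutes_compose[OF u] permutes_swap_id) auto
    then show "type_poly m {..<n} (transpose a b \<circ> u) (\<lambda>k. g k + transposition_colour m a b t (u k)) =
        Poly_Mapping.single (mat_type m n (transposition_reflection m n a b t * z)) 1"
      unfolding z transposition_reflection_def coloured_perm_mat_mult[OF u] type_poly_eq_single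
      by (simp only: mat_type_coloured_perm_mat[OF m])
  qed
  also have "\<dots> = 2 * (\<Sum>x\<in>class_R m n. Poly_Mapping.single (mat_type m n (x * z)) 1)"
    by (rule sum_class_R[OF m n])
  finally have double: "cut_join m n (Poly_Mapping.single (mat_type m n z) 1) =
      2 * (\<Sum>x\<in>class_R m n. Poly_Mapping.single (mat_type m n (x * z)) 1)" .
  have "(1 / 2) *\<^sub>C (2 * f) = f" for f :: ppoly
    unfolding mult_2 by (rule poly_mapping_eqI) (simp only: lookup_scale lookup_add, simp)
  then show ?thesis unfolding double by (rule sym)
qed

lemma sum_class_L_product:
  assumes m: "m \<ge> 1" and k: "1 \<le> k" "k < m" and z: "z \<in> carrier (Gm1n m n)"
  shows "(\<Sum>x\<in>class_L m n k. Poly_Mapping.single (mat_type m n (x * z)) 1) =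
    recolour m n k (Poly_Mapping.single (mat_type m n z) 1)"
proof -
  obtain u g where u: "u permutes {..<n}" and z: "z = coloured_perm_mat m n u g"
    using carrier_Gm1nE[OF m z] .
  have "(\<Sum>x\<in>class_L m n k. Poly_Mapping.single (mat_type m n (x * z)) (1::complex)) =
      (\<Sum>a<n. Poly_Mapping.single (mat_type m n (diagonal_reflection m n a k * z)) 1)"
    by (rule sum.reindex_bij_betw[OF class_L_bij[OF m k], symmetric])
  also have "\<dots> = (\<Sum>a<n. type_poly m {..<n} u (\<lambda>i. g i + shift_colour a k (u i)))"
    unfolding z diagonal_reflection_def coloured_perm_mat_mult[OF u] type_poly_eq_single
    by (simp add: mat_type_coloured_perm_mat[OF m u])
  also have "\<dots> = recolour m n k (type_poly m {..<n} u g)"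
    using sum_type_poly_shift[OF u finite_lessThan m, of g k] by simp
  finally show ?thesis
    by (simp add: z mat_type_coloured_perm_mat[OF m u] type_poly_eq_single)
qed

section \<open>The centre of the group algebra\<close>

lemma ga_mult_sum:
  assumes "finite A" "finite B" "Poly_Mapping.keys a \<subseteq> A" "Poly_Mapping.keys b \<subseteq> B"
  shows "ga_mult G a b = (\<Sum>x\<in>A. \<Sum>y\<in>B.
    Poly_Mapping.single (x \<otimes>\<^bsub>G\<^esub> y) (Poly_Mapping.lookup a x * Poly_Mapping.lookup b y))"
proof -
  have "ga_mult G a b = (\<Sum>x\<in>Poly_Mapping.keys a. \<Sum>y\<in>B.
      Poly_Mapping.single (x \<otimes>\<^bsub>G\<^esub> y) (Poly_Mapping.lookup a x * Poly_Mapping.lookup b y))"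
    unfolding ga_mult_def using assms by (intro sum.cong refl sum.mono_neutral_left) (auto simp: in_keys_iff)
  also have "\<dots> = (\<Sum>x\<in>A. \<Sum>y\<in>B.
      Poly_Mapping.single (x \<otimes>\<^bsub>G\<^esub> y) (Poly_Mapping.lookup a x * Poly_Mapping.lookup b y))"
    using assms by (intro sum.mono_neutral_left) (auto simp: in_keys_iff)
  finally show ?thesis .
qed

lemma lookup_outside_group_algebra:
  "a \<in> group_algebra G \<Longrightarrow> x \<notin> carrier G \<Longrightarrow> Poly_Mapping.lookup a x = 0"
  by (auto simp: group_algebra_def in_keys_iff)

lemma group_algebraI:
  "(\<And>x. x \<notin> carrier G \<Longrightarrow> Poly_Mapping.lookup a x = 0) \<Longrightarrow> a \<in> group_algebra G"
  by (auto simp: group_algebra_def in_keys_iff)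

context group
begin

lemma ga_mult_closed:
  assumes a: "a \<in> group_algebra G" and b: "b \<in> group_algebra G"
  shows "ga_mult G a b \<in> group_algebra G"
proof (rule group_algebraI)
  fix g assume g: "g \<notin> carrier G"
  have "Poly_Mapping.lookup (Poly_Mapping.single (x \<otimes> y) (Poly_Mapping.lookup a x * Poly_Mapping.lookup b y)) g = 0"
    if "x \<in> Poly_Mapping.keys a" "y \<in> Poly_Mapping.keys b" for x y
  proof -
    have "x \<otimes> y \<in> carrier G" using that a b by (auto simp: group_algebra_def)
    then show ?thesis using g by (auto simp: lookup_single when_def)
  qed
  then show "Poly_Mapping.lookup (ga_mult G a b) g = 0"
    by (simp add: ga_mult_def lookup_sum)
qed

text \<open>Over a finite group the product is a convolution. In this form central elements are recognised as
  the class functions, and products of central elements as central.\<close>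

lemma lookup_ga_mult:
  assumes fin: "finite (carrier G)" and a: "a \<in> group_algebra G" and b: "b \<in> group_algebra G"
    and g: "g \<in> carrier G"
  shows "Poly_Mapping.lookup (ga_mult G a b) g =
    (\<Sum>x\<in>carrier G. Poly_Mapping.lookup a x * Poly_Mapping.lookup b (inv x \<otimes> g))"
proof -
  have "Poly_Mapping.lookup (ga_mult G a b) g = (\<Sum>x\<in>carrier G. \<Sum>y\<in>carrier G.
      Poly_Mapping.lookup a x * Poly_Mapping.lookup b y when x \<otimes> y = g)"
    using ga_mult_sum[OF fin fin, of a b G] a b by (simp add: group_algebra_def lookup_sum lookup_single)
  also have "\<dots> = (\<Sum>x\<in>carrier G. \<Sum>y\<in>carrier G.
      if y = inv x \<otimes> g then Poly_Mapping.lookup a x * Poly_Mapping.lookup b y else 0)"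
  proof (intro sum.cong refl)
    fix x y assume xy: "x \<in> carrier G" "y \<in> carrier G"
    then have "x \<otimes> y = g \<longleftrightarrow> y = inv x \<otimes> g" using g inv_solve_left[of y x g] by auto
    then show "(Poly_Mapping.lookup a x * Poly_Mapping.lookup b y when x \<otimes> y = g) =
        (if y = inv x \<otimes> g then Poly_Mapping.lookup a x * Poly_Mapping.lookup b y else 0)"
      by (simp add: when_def)
  qed
  also have "\<dots> = (\<Sum>x\<in>carrier G. Poly_Mapping.lookup a x * Poly_Mapping.lookup b (inv x \<otimes> g))"
    using fin g by (intro sum.cong refl) simp
  finally show ?thesis .
qed

text \<open>One direction compares coefficients of the products with a group element \<open>y\<close>, taken at \<open>y x\<close>. For
  the other one, substitute \<open>v = x\<^sup>-\<^sup>1 g\<close> in the convolution: \<open>g v\<^sup>-\<^sup>1\<close> and \<open>v\<^sup>-\<^sup>1 g\<close> are conjugate.\<close>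

lemma ga_centre_iff_class_function:
  assumes fin: "finite (carrier G)" and a: "a \<in> group_algebra G"
  shows "a \<in> ga_centre G \<longleftrightarrow> (\<forall>x\<in>carrier G. \<forall>y\<in>carrier G.
    Poly_Mapping.lookup a (y \<otimes> x \<otimes> inv y) = Poly_Mapping.lookup a x)"
proof
  assume centre: "a \<in> ga_centre G"
  show "\<forall>x\<in>carrier G. \<forall>y\<in>carrier G. Poly_Mapping.lookup a (y \<otimes> x \<otimes> inv y) = Poly_Mapping.lookup a x"
  proof (intro ballI)
    fix x y assume x: "x \<in> carrier G" and y: "y \<in> carrier G"
    let ?b = "Poly_Mapping.single y (1::complex)"
    have b: "?b \<in> group_algebra G" using y by (simp add: group_algebra_def)
    have yx: "y \<otimes> x \<in> carrier G" using x y by simp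
    have "Poly_Mapping.lookup (ga_mult G ?b a) (y \<otimes> x) =
        (\<Sum>w\<in>carrier G. if w = y then Poly_Mapping.lookup a x else 0)"
      unfolding lookup_ga_mult[OF fin b a yx]
      by (intro sum.cong refl) (use x y in \<open>auto simp: lookup_single when_def m_assoc[symmetric]\<close>)
    then have 1: "Poly_Mapping.lookup (ga_mult G ?b a) (y \<otimes> x) = Poly_Mapping.lookup a x"
      using fin y by simp
    have "Poly_Mapping.lookup (ga_mult G a ?b) (y \<otimes> x) =
        (\<Sum>w\<in>carrier G. if w = y \<otimes> x \<otimes> inv y then Poly_Mapping.lookup a w else 0)"
      unfolding lookup_ga_mult[OF fin a b yx]
    proof (intro sum.cong refl)
      fix w assume w: "w \<in> carrier G"
      have "y = inv w \<otimes> (y \<otimes> x) \<longleftrightarrow> w = y \<otimes> x \<otimes> inv y"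
        using w x y inv_solve_left[of y w "y \<otimes> x"] inv_solve_right[of w "y \<otimes> x" y] by auto
      then show "Poly_Mapping.lookup a w * Poly_Mapping.lookup ?b (inv w \<otimes> (y \<otimes> x)) =
          (if w = y \<otimes> x \<otimes> inv y then Poly_Mapping.lookup a w else 0)"
        by (simp add: lookup_single when_def)
    qed
    then have 2: "Poly_Mapping.lookup (ga_mult G a ?b) (y \<otimes> x) = Poly_Mapping.lookup a (y \<otimes> x \<otimes> inv y)"
      using fin x y by simp
    have "ga_mult G a ?b = ga_mult G ?b a" using centre b by (simp add: ga_centre_def)
    then show "Poly_Mapping.lookup a (y \<otimes> x \<otimes> inv y) = Poly_Mapping.lookup a x"
      using 1 2 by simp
  qed
next
  assume cf: "\<forall>x\<in>carrier G. \<forall>y\<in>carrier G.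
    Poly_Mapping.lookup a (y \<otimes> x \<otimes> inv y) = Poly_Mapping.lookup a x"
  have "ga_mult G a b = ga_mult G b a" if b: "b \<in> group_algebra G" for b
  proof (rule poly_mapping_eqI)
    fix g
    show "Poly_Mapping.lookup (ga_mult G a b) g = Poly_Mapping.lookup (ga_mult G b a) g"
    proof (cases "g \<in> carrier G")
      case False
      then show ?thesis using ga_mult_closed[OF a b] ga_mult_closed[OF b a]
        by (simp add: lookup_outside_group_algebra)
    next
      case g: True
      have "(\<Sum>x\<in>carrier G. Poly_Mapping.lookup a x * Poly_Mapping.lookup b (inv x \<otimes> g)) =
          (\<Sum>v\<in>carrier G. Poly_Mapping.lookup b v * Poly_Mapping.lookup a (inv v \<otimes> g))"
      proof (rule sum.reindex_bij_witness[of _ "\<lambda>v. g \<otimes> inv v" "\<lambda>x. inv x \<otimes> g"])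
        fix x assume x: "x \<in> carrier G"
        show *: "g \<otimes> inv (inv x \<otimes> g) = x" using x g by (simp add: inv_mult_group m_assoc[symmetric])
        show "inv x \<otimes> g \<in> carrier G" using x g by simp
        have "inv (inv x \<otimes> g) \<otimes> g = inv g \<otimes> x \<otimes> g"
          using x g by (simp add: inv_mult_group)
        moreover have "inv (inv g) = g" using g by simp
        ultimately have "Poly_Mapping.lookup a (inv (inv x \<otimes> g) \<otimes> g) = Poly_Mapping.lookup a x"
          using bspec[OF bspec[OF cf x] inv_closed[OF g]] by simp
        then show "Poly_Mapping.lookup b (inv x \<otimes> g) * Poly_Mapping.lookup a (inv (inv x \<otimes> g) \<otimes> g) =
            Poly_Mapping.lookup a x * Poly_Mapping.lookup b (inv x \<otimes> g)"
          by (simp add: mult.commute)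
      next
        fix v assume v: "v \<in> carrier G"
        show "inv (g \<otimes> inv v) \<otimes> g = v" using v g by (simp add: inv_mult_group m_assoc)
        show "g \<otimes> inv v \<in> carrier G" using v g by simp
      qed
      then show ?thesis by (simp add: lookup_ga_mult[OF fin a b g] lookup_ga_mult[OF fin b a g])
    qed
  qed
  then show "a \<in> ga_centre G" using a by (simp add: ga_centre_def)
qed

lemma ga_mult_centre_closed:
  assumes fin: "finite (carrier G)" and a: "a \<in> ga_centre G" and b: "b \<in> ga_centre G"
  shows "ga_mult G a b \<in> ga_centre G"
proof -
  have aG: "a \<in> group_algebra G" and bG: "b \<in> group_algebra G" using a b by (auto simp: ga_centre_def)
  note ca = a[unfolded ga_centre_iff_class_function[OF fin aG]]
  note cb = b[unfolded ga_centre_iff_class_function[OF fin bG]]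
  show ?thesis
    unfolding ga_centre_iff_class_function[OF fin ga_mult_closed[OF aG bG]]
  proof (intro ballI)
    fix g y assume g: "g \<in> carrier G" and y: "y \<in> carrier G"
    have gy: "y \<otimes> g \<otimes> inv y \<in> carrier G" using g y by simp
    show "Poly_Mapping.lookup (ga_mult G a b) (y \<otimes> g \<otimes> inv y) = Poly_Mapping.lookup (ga_mult G a b) g"
      unfolding lookup_ga_mult[OF fin aG bG g] lookup_ga_mult[OF fin aG bG gy]
    proof (rule sum.reindex_bij_witness[of _ "\<lambda>x. y \<otimes> x \<otimes> inv y" "\<lambda>x. inv y \<otimes> x \<otimes> y"])
      fix x assume x: "x \<in> carrier G"
      let ?x = "inv y \<otimes> x \<otimes> y"
      show xe: "y \<otimes> ?x \<otimes> inv y = x" using x y by (simp add: m_assoc) (simp add: m_assoc[symmetric])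
      show xG: "?x \<in> carrier G" using x y by simp
      have "inv x \<otimes> (y \<otimes> g \<otimes> inv y) = y \<otimes> (inv ?x \<otimes> g) \<otimes> inv y"
        using x y g by (simp add: inv_mult_group m_assoc) (simp add: m_assoc[symmetric])
      then have "Poly_Mapping.lookup b (inv x \<otimes> (y \<otimes> g \<otimes> inv y)) = Poly_Mapping.lookup b (inv ?x \<otimes> g)"
        using cb xG y g by simp
      moreover have "Poly_Mapping.lookup a x = Poly_Mapping.lookup a ?x"
        using ca xG y xe by metis
      ultimately show "Poly_Mapping.lookup a ?x * Poly_Mapping.lookup b (inv ?x \<otimes> g) =
          Poly_Mapping.lookup a x * Poly_Mapping.lookup b (inv x \<otimes> (y \<otimes> g \<otimes> inv y))" by simp
    next
      fix x assume x: "x \<in> carrier G"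
      show "inv y \<otimes> (y \<otimes> x \<otimes> inv y) \<otimes> y = x"
        using x y by (simp add: m_assoc) (simp add: m_assoc[symmetric])
      show "y \<otimes> x \<otimes> inv y \<in> carrier G" using x y by simp
    qed
  qed
qed

end

text \<open>Group elements are conjugate if and only if they have the same type.\<close>

lemma ga_centre_iff_type:
  assumes m: "m \<ge> 1" and a: "a \<in> group_algebra (Gm1n m n)"
  shows "a \<in> ga_centre (Gm1n m n) \<longleftrightarrow> (\<forall>z\<in>carrier (Gm1n m n). \<forall>z'\<in>carrier (Gm1n m n).
    mat_type m n z = mat_type m n z' \<longrightarrow> Poly_Mapping.lookup a z = Poly_Mapping.lookup a z')"
proof -
  interpret group "Gm1n m n" by (rule group_Gm1n[OF m])
  let ?G = "Gm1n m n"
  have conj: "w * z = z' * w \<longleftrightarrow> z' = w \<otimes>\<^bsub>?G\<^esub> z \<otimes>\<^bsub>?G\<^esub> inv\<^bsub>?G\<^esub> w"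
    if "w \<in> carrier ?G" "z \<in> carrier ?G" "z' \<in> carrier ?G" for w z z'
    using that inv_solve_right[of z' "w \<otimes>\<^bsub>?G\<^esub> z" w] m_closed[of w z] by auto
  show ?thesis
    unfolding ga_centre_iff_class_function[OF finite_Gm1n[OF m] a]
  proof (intro iffI ballI impI)
    fix z z' assume cf: "\<forall>x\<in>carrier ?G. \<forall>y\<in>carrier ?G.
        Poly_Mapping.lookup a (y \<otimes>\<^bsub>?G\<^esub> x \<otimes>\<^bsub>?G\<^esub> inv\<^bsub>?G\<^esub> y) = Poly_Mapping.lookup a x"
      and z: "z \<in> carrier ?G" and z': "z' \<in> carrier ?G" and eq: "mat_type m n z = mat_type m n z'"
    obtain w where w: "w \<in> carrier ?G" "w * z = z' * w"
      using conjugate_of_mat_type_eq[OF m z z' eq] by blast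
    then have "z' = w \<otimes>\<^bsub>?G\<^esub> z \<otimes>\<^bsub>?G\<^esub> inv\<^bsub>?G\<^esub> w" using conj[OF w(1) z z'] by simp
    then show "Poly_Mapping.lookup a z = Poly_Mapping.lookup a z'" using cf w(1) z by metis
  next
    fix x y assume tf: "\<forall>z\<in>carrier ?G. \<forall>z'\<in>carrier ?G.
        mat_type m n z = mat_type m n z' \<longrightarrow> Poly_Mapping.lookup a z = Poly_Mapping.lookup a z'"
      and x: "x \<in> carrier ?G" and y: "y \<in> carrier ?G"
    let ?z = "y \<otimes>\<^bsub>?G\<^esub> x \<otimes>\<^bsub>?G\<^esub> inv\<^bsub>?G\<^esub> y"
    have z: "?z \<in> carrier ?G" using x y m_closed inv_closed by blast
    then have "y * x = ?z * y" using conj[OF y x z] by blast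
    then have "mat_type m n ?z = mat_type m n x" by (rule mat_type_conjugate[OF m y x z])
    then show "Poly_Mapping.lookup a ?z = Poly_Mapping.lookup a x" using tf x z by blast
  qed
qed

lemma ga_centre_eq_of_type:
  assumes m: "m \<ge> 1" and a: "a \<in> ga_centre (Gm1n m n)"
    and z: "z \<in> carrier (Gm1n m n)" "z' \<in> carrier (Gm1n m n)" "mat_type m n z = mat_type m n z'"
  shows "Poly_Mapping.lookup a z = Poly_Mapping.lookup a z'"
proof -
  have "a \<in> group_algebra (Gm1n m n)" using a by (simp add: ga_centre_def)
  from a[unfolded ga_centre_iff_type[OF m this]] show ?thesis using z by blast
qed

lemma ga_centreI_type:
  assumes m: "m \<ge> 1" and a: "a \<in> group_algebra (Gm1n m n)"
    and "\<And>z z'. z \<in> carrier (Gm1n m n) \<Longrightarrow> z' \<in> carrier (Gm1n m n) \<Longrightarrow>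
      mat_type m n z = mat_type m n z' \<Longrightarrow> Poly_Mapping.lookup a z = Poly_Mapping.lookup a z'"
  shows "a \<in> ga_centre (Gm1n m n)"
  unfolding ga_centre_iff_type[OF m a] using assms(3) by blast

section \<open>The isomorphism with polynomials\<close>

text \<open>The linear extension of the map that sends a group element to the monomial of its type. It is
  defined on the whole group algebra, where it can be evaluated on products term by term; on the
  centre it turns out to be \<open>Theta\<close>.\<close>

definition type_map :: "nat \<Rightarrow> nat \<Rightarrow> (complex mat \<Rightarrow>\<^sub>0 complex) \<Rightarrow> ppoly" where
  "type_map m n a = (\<Sum>z\<in>carrier (Gm1n m n). Poly_Mapping.single (mat_type m n z) (Poly_Mapping.lookup a z))"

lemma type_map_add: "type_map m n (a + b) = type_map m n a + type_map m n b"
  by (simp add: type_map_def lookup_add single_add sum.distrib)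

lemma type_map_scale: "type_map m n (c *\<^sub>C a) = c *\<^sub>C type_map m n a"
  by (rule poly_mapping_eqI)
    (simp add: type_map_def lookup_sum lookup_scale lookup_single when_def sum_distrib_left if_distrib cong: if_cong)

lemma lookup_type_map:
  "Poly_Mapping.lookup (type_map m n a) \<mu> =
    (\<Sum>z\<in>carrier (Gm1n m n). if mat_type m n z = \<mu> then Poly_Mapping.lookup a z else 0)"
  by (simp add: type_map_def lookup_sum lookup_single when_def)

definition class_of_type :: "nat \<Rightarrow> nat \<Rightarrow> pmonom \<Rightarrow> complex mat set" where
  "class_of_type m n \<mu> = {z \<in> carrier (Gm1n m n). mat_type m n z = \<mu>}"

lemma finite_class_of_type: "m \<ge> 1 \<Longrightarrow> finite (class_of_type m n \<mu>)"
  by (simp add: class_of_type_def finite_Gm1n)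

lemma lookup_type_map_centre:
  assumes m: "m \<ge> 1" and a: "a \<in> ga_centre (Gm1n m n)" and z: "z \<in> carrier (Gm1n m n)"
  shows "Poly_Mapping.lookup (type_map m n a) (mat_type m n z) =
    of_nat (card (class_of_type m n (mat_type m n z))) * Poly_Mapping.lookup a z"
proof -
  have "Poly_Mapping.lookup (type_map m n a) (mat_type m n z) =
      (\<Sum>x\<in>class_of_type m n (mat_type m n z). Poly_Mapping.lookup a x)"
    unfolding lookup_type_map class_of_type_def using finite_Gm1n[OF m] by (simp add: sum.inter_filter)
  also have "\<dots> = (\<Sum>x\<in>class_of_type m n (mat_type m n z). Poly_Mapping.lookup a z)"
    by (intro sum.cong refl ga_centre_eq_of_type[OF m a _ z]) (auto simp: class_of_type_def)
  finally show ?thesis by simp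
qed

lemma card_class_of_type_nonzero:
  assumes "m \<ge> 1" "z \<in> carrier (Gm1n m n)"
  shows "card (class_of_type m n (mat_type m n z)) \<noteq> 0"
  using assms finite_class_of_type[of m n "mat_type m n z"] by (auto simp: class_of_type_def card_eq_0_iff)

lemma lookup_set_sum:
  assumes "finite X"
  shows "Poly_Mapping.lookup (set_sum X) z = (if z \<in> X then 1 else 0)"
  using assms by (simp add: set_sum_def lookup_sum lookup_single when_def)

lemma set_sum_class_of_type_centre:
  assumes m: "m \<ge> 1"
  shows "set_sum (class_of_type m n \<mu>) \<in> ga_centre (Gm1n m n)"
proof -
  have G: "set_sum (class_of_type m n \<mu>) \<in> group_algebra (Gm1n m n)"
    by (rule group_algebraI) (simp add: lookup_set_sum[OF finite_class_of_type[OF m]], simp add: class_of_type_def)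
  show ?thesis
    by (rule ga_centreI_type[OF m G]) (simp add: lookup_set_sum[OF finite_class_of_type[OF m]], simp add: class_of_type_def)
qed

lemma ga_centre_scale:
  assumes m: "m \<ge> 1" and a: "a \<in> ga_centre (Gm1n m n)"
  shows "c *\<^sub>C a \<in> ga_centre (Gm1n m n)"
proof -
  have aG: "a \<in> group_algebra (Gm1n m n)" using a by (simp add: ga_centre_def)
  have G: "c *\<^sub>C a \<in> group_algebra (Gm1n m n)"
    by (rule group_algebraI) (simp add: lookup_scale lookup_outside_group_algebra[OF aG])
  show ?thesis
    by (rule ga_centreI_type[OF m G]) (metis lookup_scale ga_centre_eq_of_type[OF m a])
qed

lemma ga_centre_add:
  assumes m: "m \<ge> 1" and a: "a \<in> ga_centre (Gm1n m n)" and b: "b \<in> ga_centre (Gm1n m n)"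
  shows "a + b \<in> ga_centre (Gm1n m n)"
proof -
  have aG: "a \<in> group_algebra (Gm1n m n)" and bG: "b \<in> group_algebra (Gm1n m n)"
    using a b by (simp_all add: ga_centre_def)
  have G: "a + b \<in> group_algebra (Gm1n m n)"
    by (rule group_algebraI)
      (simp add: lookup_add lookup_outside_group_algebra[OF aG] lookup_outside_group_algebra[OF bG])
  show ?thesis
    by (rule ga_centreI_type[OF m G])
      (metis lookup_add ga_centre_eq_of_type[OF m a] ga_centre_eq_of_type[OF m b])
qed

lemma conj_class_class_of_type: "m \<ge> 1 \<Longrightarrow> conj_class m n \<Lambda> = class_of_type m n (part_monom m \<Lambda>)"
  by (simp add: conj_class_eq class_of_type_def)

lemma class_avg_centre:
  assumes m: "m \<ge> 1"
  shows "class_avg m n \<Lambda> \<in> ga_centre (Gm1n m n)"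
  unfolding class_avg_def conj_class_class_of_type[OF m]
  by (intro ga_centre_scale[OF m] set_sum_class_of_type_centre[OF m])

lemma lookup_class_avg:
  assumes m: "m \<ge> 1"
  shows "Poly_Mapping.lookup (class_avg m n \<Lambda>) z =
    (if z \<in> class_of_type m n (part_monom m \<Lambda>) then 1 / of_nat (card (class_of_type m n (part_monom m \<Lambda>))) else 0)"
  by (simp add: class_avg_def conj_class_class_of_type[OF m] lookup_scale lookup_set_sum[OF finite_class_of_type[OF m]])

lemma type_map_class_avg:
  assumes m: "m \<ge> 1" and \<Lambda>: "coloured_partition m n \<Lambda>"
  shows "type_map m n (class_avg m n \<Lambda>) = p_part m \<Lambda>"
proof -
  let ?\<mu> = "part_monom m \<Lambda>"
  obtain z where z: "z \<in> carrier (Gm1n m n)" "mat_type m n z = ?\<mu>"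
    using mat_type_surj[OF m coloured_partition_monom[OF \<Lambda>]] by blast
  have ne: "card (class_of_type m n ?\<mu>) \<noteq> 0" using card_class_of_type_nonzero[OF m z(1)] z(2) by simp
  show ?thesis
    unfolding p_part_eq_single
  proof (rule poly_mapping_eqI)
    fix \<nu>
    have "Poly_Mapping.lookup (type_map m n (class_avg m n \<Lambda>)) \<nu> =
        (\<Sum>x\<in>class_of_type m n \<nu>. Poly_Mapping.lookup (class_avg m n \<Lambda>) x)"
      unfolding lookup_type_map class_of_type_def using finite_Gm1n[OF m] by (simp add: sum.inter_filter)
    also have "\<dots> = (\<Sum>x\<in>class_of_type m n \<nu>. if \<nu> = ?\<mu> then 1 / of_nat (card (class_of_type m n ?\<mu>)) else 0)"
      by (intro sum.cong refl) (auto simp: lookup_class_avg[OF m], auto simp: class_of_type_def)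
    also have "\<dots> = Poly_Mapping.lookup (Poly_Mapping.single ?\<mu> 1) \<nu>"
      using ne by (auto simp: lookup_single when_def)
    finally show "Poly_Mapping.lookup (type_map m n (class_avg m n \<Lambda>)) \<nu> =
        Poly_Mapping.lookup (Poly_Mapping.single ?\<mu> 1) \<nu>" .
  qed
qed

text \<open>The coefficient of \<open>type_map a\<close> at a type is the sum of the coefficients of \<open>a\<close> over the class of
  that type, hence the class size times their common value. This determines \<open>a\<close>, and every
  polynomial arises because no class is empty.\<close>

lemma type_map_bij:
  assumes m: "m \<ge> 1"
  shows "bij_betw (type_map m n) (ga_centre (Gm1n m n)) (poly_component m n)"
proof (rule bij_betw_imageI)
  let ?G = "Gm1n m n"
  show "inj_on (type_map m n) (ga_centre ?G)"
  proof (rule inj_onI, rule poly_mapping_eqI)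
    fix a b z assume a: "a \<in> ga_centre ?G" and b: "b \<in> ga_centre ?G" and eq: "type_map m n a = type_map m n b"
    show "Poly_Mapping.lookup a z = Poly_Mapping.lookup b z"
    proof (cases "z \<in> carrier ?G")
      case True
      then show ?thesis
        using lookup_type_map_centre[OF m a True] lookup_type_map_centre[OF m b True]
          card_class_of_type_nonzero[OF m True] eq by simp
    next
      case False
      moreover have "a \<in> group_algebra ?G" "b \<in> group_algebra ?G" using a b by (simp_all add: ga_centre_def)
      ultimately show ?thesis by (simp add: lookup_outside_group_algebra)
    qed
  qed
  show "type_map m n ` ga_centre ?G = poly_component m n"
  proof (intro equalityI subsetI)
    fix f assume "f \<in> type_map m n ` ga_centre ?G"
    then obtain a where f: "f = type_map m n a" by blast
    show "f \<in> poly_component m n"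
      unfolding poly_component_iff
    proof
      fix \<mu> assume "\<mu> \<in> Poly_Mapping.keys f"
      then have "(\<Sum>z\<in>carrier ?G. if mat_type m n z = \<mu> then Poly_Mapping.lookup a z else 0) \<noteq> 0"
        by (simp add: f lookup_type_map in_keys_iff)
      then obtain z where "z \<in> carrier ?G" "(if mat_type m n z = \<mu> then Poly_Mapping.lookup a z else 0) \<noteq> 0"
        by (rule sum.not_neutral_contains_not_neutral)
      then have "z \<in> carrier ?G" "mat_type m n z = \<mu>" by (auto split: if_splits)
      then show "proper_monom m \<mu> \<and> monom_deg \<mu> = n" using mat_type_proper[OF m] by blast
    qed
  next
    fix f assume f: "f \<in> poly_component m n"
    \<comment> \<open>spread each coefficient of \<open>f\<close> evenly over the class of its type\<close>
    define a where "a = (\<Sum>z\<in>carrier ?G. Poly_Mapping.single z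
      (Poly_Mapping.lookup f (mat_type m n z) / of_nat (card (class_of_type m n (mat_type m n z)))))"
    have lookup: "Poly_Mapping.lookup a z = (if z \<in> carrier ?G then
        Poly_Mapping.lookup f (mat_type m n z) / of_nat (card (class_of_type m n (mat_type m n z))) else 0)" for z
      using finite_Gm1n[OF m, of n] by (simp add: a_def lookup_sum lookup_single when_def)
    have aG: "a \<in> group_algebra ?G" by (rule group_algebraI) (simp add: lookup)
    have a: "a \<in> ga_centre ?G" by (rule ga_centreI_type[OF m aG]) (simp add: lookup)
    have "type_map m n a = f"
    proof (rule poly_mapping_eqI)
      fix \<mu>
      show "Poly_Mapping.lookup (type_map m n a) \<mu> = Poly_Mapping.lookup f \<mu>"
      proof (cases "\<exists>z\<in>carrier ?G. mat_type m n z = \<mu>")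
        case True
        then obtain z where z: "z \<in> carrier ?G" "mat_type m n z = \<mu>" by blast
        then show ?thesis
          using lookup_type_map_centre[OF m a z(1)] card_class_of_type_nonzero[OF m z(1)] by (simp add: lookup)
      next
        case False
        then have "\<mu> \<notin> Poly_Mapping.keys f"
          using f mat_type_surj[OF m, of \<mu> n] by (auto simp: poly_component_iff)
        moreover have "Poly_Mapping.lookup (type_map m n a) \<mu> = 0"
          unfolding lookup_type_map using False by (intro sum.neutral) auto
        ultimately show ?thesis by (simp add: in_keys_iff)
      qed
    qed
    then show "f \<in> type_map m n ` ga_centre ?G" using a by blast
  qed
qed

lemma linear_iso_on_type_map: "m \<ge> 1 \<Longrightarrow> linear_iso_on (ga_centre (Gm1n m n)) (poly_component m n) (type_map m n)"
  by (simp add: linear_iso_on_def type_map_bij type_map_add type_map_scale)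

lemma linear_iso_on_sum:
  assumes m: "m \<ge> 1" and \<phi>: "linear_iso_on (ga_centre (Gm1n m n)) W \<phi>"
    and A: "finite A" and f: "\<And>x. x \<in> A \<Longrightarrow> f x \<in> ga_centre (Gm1n m n)"
  shows "\<phi> (\<Sum>x\<in>A. c x *\<^sub>C f x) = (\<Sum>x\<in>A. c x *\<^sub>C \<phi> (f x)) \<and> (\<Sum>x\<in>A. c x *\<^sub>C f x) \<in> ga_centre (Gm1n m n)"
  using A f
proof (induction A rule: finite_induct)
  case empty
  have "0 \<in> ga_centre (Gm1n m n)"
    using ga_centre_scale[OF m set_sum_class_of_type_centre[OF m], where c = 0]
    by (simp add: scale_zero_left)
  then have "\<phi> (0 *\<^sub>C 0) = 0 *\<^sub>C \<phi> 0" using \<phi> by (simp add: linear_iso_on_def)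
  then show ?case using \<open>0 \<in> ga_centre (Gm1n m n)\<close> by (simp add: scale_zero_left)
next
  case (insert x A)
  have 1: "c x *\<^sub>C f x \<in> ga_centre (Gm1n m n)" using insert by (intro ga_centre_scale[OF m]) simp
  have 2: "(\<Sum>x\<in>A. c x *\<^sub>C f x) \<in> ga_centre (Gm1n m n)"
    and 3: "\<phi> (\<Sum>x\<in>A. c x *\<^sub>C f x) = (\<Sum>x\<in>A. c x *\<^sub>C \<phi> (f x))" using insert by auto
  have "\<phi> (c x *\<^sub>C f x + (\<Sum>x\<in>A. c x *\<^sub>C f x)) = c x *\<^sub>C \<phi> (f x) + \<phi> (\<Sum>x\<in>A. c x *\<^sub>C f x)"
    using \<phi> 1 2 insert by (simp add: linear_iso_on_def)
  then show ?case using insert(1,2) ga_centre_add[OF m 1 2] by (simp add: 3)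
qed

text \<open>The map \<open>Theta\<close> is chosen among the linear isomorphisms with prescribed values on the class averages.
  As \<open>type_map\<close> is one of these, such maps exist; as the class averages span the centre, there is only
  one.\<close>

lemma Theta_eq_type_map:
  assumes m: "m \<ge> 1" and a: "a \<in> ga_centre (Gm1n m n)"
  shows "Theta m n a = type_map m n a"
proof -
  let ?G = "Gm1n m n"
  have Theta: "linear_iso_on (ga_centre ?G) (poly_component m n) (Theta m n) \<and>
      (\<forall>\<Lambda>. coloured_partition m n \<Lambda> \<longrightarrow> Theta m n (class_avg m n \<Lambda>) = p_part m \<Lambda>)"
    unfolding Theta_def
    by (rule someI[of _ "type_map m n"]) (use linear_iso_on_type_map[OF m] type_map_class_avg[OF m] in blast)
  have "\<forall>\<mu>. \<exists>\<Lambda>. \<mu> \<in> mat_type m n ` carrier ?G \<longrightarrow> coloured_partition m n \<Lambda> \<and> part_monom m \<Lambda> = \<mu>"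
    using ex_coloured_partition[OF m] by (metis imageE)
  then obtain L where L: "\<And>\<mu>. \<mu> \<in> mat_type m n ` carrier ?G \<Longrightarrow> coloured_partition m n (L \<mu>) \<and> part_monom m (L \<mu>) = \<mu>"
    by metis
  let ?M = "mat_type m n ` carrier ?G"
  have fin: "finite ?M" using finite_Gm1n[OF m] by simp
  have expand: "a = (\<Sum>\<mu>\<in>?M. Poly_Mapping.lookup (type_map m n a) \<mu> *\<^sub>C class_avg m n (L \<mu>))"
  proof (rule poly_mapping_eqI)
    fix z
    have "Poly_Mapping.lookup (\<Sum>\<mu>\<in>?M. Poly_Mapping.lookup (type_map m n a) \<mu> *\<^sub>C class_avg m n (L \<mu>)) z =
        (\<Sum>\<mu>\<in>?M. if z \<in> carrier ?G \<and> \<mu> = mat_type m n z then Poly_Mapping.lookup a z else 0)"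
      unfolding lookup_sum lookup_scale lookup_class_avg[OF m]
    proof (intro sum.cong refl)
      fix \<mu> assume \<mu>: "\<mu> \<in> ?M"
      have "Poly_Mapping.lookup (type_map m n a) \<mu> / of_nat (card (class_of_type m n \<mu>)) = Poly_Mapping.lookup a z"
        if "z \<in> carrier ?G" "\<mu> = mat_type m n z"
        using lookup_type_map_centre[OF m a that(1)] card_class_of_type_nonzero[OF m that(1)] that(2) by simp
      then show "Poly_Mapping.lookup (type_map m n a) \<mu> *
          (if z \<in> class_of_type m n (part_monom m (L \<mu>)) then 1 / of_nat (card (class_of_type m n (part_monom m (L \<mu>)))) else 0) =
          (if z \<in> carrier ?G \<and> \<mu> = mat_type m n z then Poly_Mapping.lookup a z else 0)"
        using L[OF \<mu>] by (auto simp: class_of_type_def)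
    qed
    also have "\<dots> = Poly_Mapping.lookup a z"
    proof (cases "z \<in> carrier ?G")
      case True
      then show ?thesis using fin by simp
    next
      case False
      moreover have "a \<in> group_algebra ?G" using a by (simp add: ga_centre_def)
      ultimately show ?thesis by (simp add: lookup_outside_group_algebra)
    qed
    finally show "Poly_Mapping.lookup a z =
      Poly_Mapping.lookup (\<Sum>\<mu>\<in>?M. Poly_Mapping.lookup (type_map m n a) \<mu> *\<^sub>C class_avg m n (L \<mu>)) z" ..
  qed
  let ?e = "\<Sum>\<mu>\<in>?M. Poly_Mapping.lookup (type_map m n a) \<mu> *\<^sub>C class_avg m n (L \<mu>)"
  have "Theta m n ?e = (\<Sum>\<mu>\<in>?M. Poly_Mapping.lookup (type_map m n a) \<mu> *\<^sub>C Theta m n (class_avg m n (L \<mu>)))"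
    by (rule conjunct1[OF linear_iso_on_sum[OF m conjunct1[OF Theta] fin class_avg_centre[OF m]]])
  also have "\<dots> = (\<Sum>\<mu>\<in>?M. Poly_Mapping.lookup (type_map m n a) \<mu> *\<^sub>C type_map m n (class_avg m n (L \<mu>)))"
    using L Theta type_map_class_avg[OF m] by (intro sum.cong refl) simp
  also have "\<dots> = type_map m n ?e"
    by (rule conjunct1[OF linear_iso_on_sum[OF m linear_iso_on_type_map[OF m] fin class_avg_centre[OF m]], symmetric])
  finally show ?thesis using expand by simp
qed

section \<open>The cut-and-join operators\<close>

lemma type_map_single:
  assumes m: "m \<ge> 1" and z: "z \<in> carrier (Gm1n m n)"
  shows "type_map m n (Poly_Mapping.single z c) = c *\<^sub>C Poly_Mapping.single (mat_type m n z) 1"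
proof (rule poly_mapping_eqI)
  fix \<mu>
  have "Poly_Mapping.lookup (type_map m n (Poly_Mapping.single z c)) \<mu> =
      (\<Sum>x\<in>carrier (Gm1n m n). if x = z then (if mat_type m n z = \<mu> then c else 0) else 0)"
    unfolding lookup_type_map by (intro sum.cong) (auto simp: lookup_single when_def)
  then show "Poly_Mapping.lookup (type_map m n (Poly_Mapping.single z c)) \<mu> =
      Poly_Mapping.lookup (c *\<^sub>C Poly_Mapping.single (mat_type m n z) 1) \<mu>"
    using z finite_Gm1n[OF m] by (simp add: lookup_scale lookup_single when_def)
qed

lemma type_map_eq_sum_scale:
  "type_map m n a = (\<Sum>z\<in>carrier (Gm1n m n). Poly_Mapping.lookup a z *\<^sub>C Poly_Mapping.single (mat_type m n z) 1)"
  unfolding type_map_def by (intro sum.cong refl poly_mapping_eqI) (simp add: lookup_scale lookup_single when_def)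

lemma type_map_sum: "type_map m n (\<Sum>x\<in>A. f x) = (\<Sum>x\<in>A. type_map m n (f x))"
proof -
  have "type_map m n 0 = 0" by (simp add: type_map_def)
  then show ?thesis
    by (induction A rule: infinite_finite_induct) (simp_all add: type_map_add)
qed

lemma scale_sum: "c *\<^sub>C (\<Sum>x\<in>A. f x) = (\<Sum>x\<in>A. c *\<^sub>C f x)"
  by (rule poly_mapping_eqI) (simp add: lookup_scale lookup_sum sum_distrib_left)

text \<open>Multiplication by a sum of group elements, seen through \<open>type_map\<close>, is a statement about the types
  of the products \<open>x z\<close> alone.\<close>

lemma type_map_set_sum_mult:
  assumes m: "m \<ge> 1" and a: "a \<in> group_algebra (Gm1n m n)" and R: "R \<subseteq> carrier (Gm1n m n)"
  shows "type_map m n (ga_mult (Gm1n m n) (set_sum R) a) =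
    (\<Sum>z\<in>carrier (Gm1n m n). Poly_Mapping.lookup a z *\<^sub>C
      (\<Sum>x\<in>R. Poly_Mapping.single (mat_type m n (x * z)) 1))"
proof -
  let ?G = "Gm1n m n"
  have fin: "finite (carrier ?G)" "finite R" using finite_Gm1n[OF m] R finite_subset by auto
  have "ga_mult ?G (set_sum R) a =
      (\<Sum>x\<in>R. \<Sum>z\<in>carrier ?G. Poly_Mapping.single (x * z) (Poly_Mapping.lookup a z))"
  proof (subst ga_mult_sum[OF fin(2,1)])
    show "Poly_Mapping.keys (set_sum R) \<subseteq> R"
      by (auto simp: in_keys_iff lookup_set_sum[OF fin(2)] split: if_splits)
    show "Poly_Mapping.keys a \<subseteq> carrier ?G" using a by (simp add: group_algebra_def)
  qed (simp add: lookup_set_sum[OF fin(2)])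
  also have "\<dots> = (\<Sum>z\<in>carrier ?G. \<Sum>x\<in>R. Poly_Mapping.single (x * z) (Poly_Mapping.lookup a z))"
    by (rule sum.swap)
  also have "type_map m n \<dots> = (\<Sum>z\<in>carrier ?G. \<Sum>x\<in>R.
      Poly_Mapping.lookup a z *\<^sub>C Poly_Mapping.single (mat_type m n (x * z)) 1)"
    unfolding type_map_sum
  proof (intro sum.cong refl type_map_single[OF m])
    fix x z assume "z \<in> carrier ?G" "x \<in> R"
    then show "x * z \<in> carrier ?G"
      using monoid.m_closed[OF group.is_monoid[OF group_Gm1n[OF m]], of x n z] R by auto
  qed
  finally show ?thesis by (simp add: scale_sum)
qed

lemma scale_mult: "c *\<^sub>C (f * g) = f * (c *\<^sub>C g)" for f g :: ppoly
  by (simp add: scale_eq_mult mult_ac)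

lemma scale_add: "c *\<^sub>C (f + g) = c *\<^sub>C f + c *\<^sub>C g"
  by (rule poly_mapping_eqI) (simp add: lookup_scale lookup_add distrib_left)

lemma cut_join_sum_scale:
  "cut_join m n (\<Sum>x\<in>A. c x *\<^sub>C f x) = (\<Sum>x\<in>A. c x *\<^sub>C cut_join m n (f x))"
proof -
  have "cut_term m (\<Sum>x\<in>A. c x *\<^sub>C f x) p + join_term m (\<Sum>x\<in>A. c x *\<^sub>C f x) p =
      (\<Sum>x\<in>A. c x *\<^sub>C (cut_term m (f x) p + join_term m (f x) p))" for p
  proof -
    obtain i j \<alpha> \<gamma> where p: "p = (i, j, \<alpha>, \<gamma>)" by (metis prod.exhaust)
    show ?thesis
      unfolding p cut_term_def join_term_def prod.case
      by (simp only: pdiff_sum pdiff_scale scale_mult scale_add sum_distrib_left sum.distrib)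
  qed
  then have "cut_join m n (\<Sum>x\<in>A. c x *\<^sub>C f x) =
      (\<Sum>p\<in>index_box m n. \<Sum>x\<in>A. c x *\<^sub>C (cut_term m (f x) p + join_term m (f x) p))"
    by (simp only: cut_join_def)
  also have "\<dots> = (\<Sum>x\<in>A. \<Sum>p\<in>index_box m n. c x *\<^sub>C (cut_term m (f x) p + join_term m (f x) p))"
    by (rule sum.swap)
  finally show ?thesis by (simp only: cut_join_def scale_sum)
qed

lemma recolour_sum_scale:
  "recolour m n k (\<Sum>x\<in>A. c x *\<^sub>C f x) = (\<Sum>x\<in>A. c x *\<^sub>C recolour m n k (f x))"
proof -
  have "recolour m n k (\<Sum>x\<in>A. c x *\<^sub>C f x) =
      (\<Sum>p\<in>{1..n} \<times> {..<m}. \<Sum>x\<in>A. c x *\<^sub>C (case p of (i, \<alpha>) \<Rightarrow> of_nat i * (pv ((\<alpha> + k) mod m, i) * pdiff \<alpha> i (f x))))"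
    unfolding recolour_def
    by (intro sum.cong refl) (auto simp: pdiff_sum pdiff_scale scale_mult sum_distrib_left simp del: of_nat_mult)
  also have "\<dots> = (\<Sum>x\<in>A. \<Sum>p\<in>{1..n} \<times> {..<m}. c x *\<^sub>C (case p of (i, \<alpha>) \<Rightarrow> of_nat i * (pv ((\<alpha> + k) mod m, i) * pdiff \<alpha> i (f x))))"
    by (rule sum.swap)
  finally show ?thesis by (simp only: recolour_def scale_sum)
qed

text \<open>The reduction to single group elements: a linear operator \<open>D\<close> that is correct on the monomial of
  each group element \<open>z\<close> is the cut-and-join operator, since every polynomial of degree \<open>n\<close> is the
  image of a central element \<open>\<Sum>\<^sub>z a\<^sub>z z\<close>. The case \<open>R = {}\<close> is that of \<open>n = 1\<close>, where there are no
  transpositions.\<close>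

lemma CJ_eq:
  assumes m: "m \<ge> 1" and f: "f \<in> poly_component m n"
    and R: "refl_sum m n k = set_sum R" "R = class_of_type m n \<mu> \<or> R = {}"
    and D_sum: "\<And>(c :: complex mat \<Rightarrow> complex) h A. D (\<Sum>x\<in>A. c x *\<^sub>C h x) = (\<Sum>x\<in>A. c x *\<^sub>C D (h x))"
    and D: "\<And>z. z \<in> carrier (Gm1n m n) \<Longrightarrow>
      (\<Sum>x\<in>R. Poly_Mapping.single (mat_type m n (x * z)) 1) = D (Poly_Mapping.single (mat_type m n z) 1)"
  shows "CJ m n k f = D f"
proof -
  let ?G = "Gm1n m n" and ?Z = "ga_centre (Gm1n m n)"
  obtain a where a: "a \<in> ?Z" and fa: "type_map m n a = f"
    using f bij_betw_imp_surj_on[OF type_map_bij[OF m]] by (metis imageE)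
  have aG: "a \<in> group_algebra ?G" using a by (simp add: ga_centre_def)
  have "inj_on (Theta m n) ?Z"
    using bij_betw_imp_inj_on[OF type_map_bij[OF m]] Theta_eq_type_map[OF m] by (simp add: inj_on_def)
  then have inv: "the_inv_into ?Z (Theta m n) f = a"
    using a fa Theta_eq_type_map[OF m a] by (metis the_inv_into_f_f)
  have RG: "R \<subseteq> carrier ?G" using R(2) by (auto simp: class_of_type_def)
  have "set_sum R \<in> ?Z"
  proof (cases "R = {}")
    case True
    then show ?thesis
      using ga_centre_scale[OF m set_sum_class_of_type_centre[OF m], of 0 n \<mu>]
      by (simp add: set_sum_def scale_zero_left)
  next
    case False
    then show ?thesis using R(2) set_sum_class_of_type_centre[OF m] by auto
  qed
  then have prod: "ga_mult ?G (set_sum R) a \<in> ?Z"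
    using group.ga_mult_centre_closed[OF group_Gm1n[OF m] finite_Gm1n[OF m] _ a] by blast
  have "CJ m n k f = type_map m n (ga_mult ?G (set_sum R) a)"
    unfolding CJ_def T_op_def inv R(1) by (rule Theta_eq_type_map[OF m prod])
  also have "\<dots> = (\<Sum>z\<in>carrier ?G. Poly_Mapping.lookup a z *\<^sub>C D (Poly_Mapping.single (mat_type m n z) 1))"
    unfolding type_map_set_sum_mult[OF m aG RG] by (intro sum.cong refl) (simp add: D)
  also have "\<dots> = D (type_map m n a)"
    unfolding type_map_eq_sum_scale by (rule D_sum[symmetric])
  finally show ?thesis by (simp add: fa)
qed

theorem theorem3p3:
  fixes m n :: nat
  assumes "m \<ge> 1" and "n \<ge> 1"
  shows "(\<forall>f \<in> poly_component m n.
            CJ m n 0 f =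
              (1 / 2) *\<^sub>C Sum_any (\<lambda>(i, j, \<alpha>, \<gamma>).
                if 1 \<le> i \<and> 1 \<le> j \<and> \<alpha> < m \<and> \<gamma> < m then
                  of_nat (i + j) *\<^sub>C
                    (pvar \<alpha> i * pvar \<gamma> j * pdiff ((\<alpha> + \<gamma>) mod m) (i + j) f) +
                  of_nat (m * i * j) *\<^sub>C
                    (pvar ((\<alpha> + \<gamma>) mod m) (i + j) * pdiff \<alpha> i (pdiff \<gamma> j f))
                else 0)) \<and>
         (\<forall>k \<in> {1..m - 1}. \<forall>f \<in> poly_component m n.
            CJ m n k f =
              Sum_any (\<lambda>(i, \<alpha>).
                if 1 \<le> i \<and> \<alpha> < m then
                  of_nat i *\<^sub>C (pvar ((\<alpha> + k) mod m) i * pdiff \<alpha> i f)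
                else 0))"
proof (intro conjI ballI)
  fix f assume f: "f \<in> poly_component m n"
  have "CJ m n 0 f = (1 / 2) *\<^sub>C cut_join m n f"
  proof (rule CJ_eq[OF assms(1) f, where R = "class_R m n" and D = "\<lambda>f. (1 / 2) *\<^sub>C cut_join m n f"])
    show "refl_sum m n 0 = set_sum (class_R m n)" by (simp add: refl_sum_def)
    show "class_R m n = class_of_type m n (part_monom m ((replicate m {#})[0 := add_mset 2 (replicate_mset (n - 2) 1)])) \<or>
        class_R m n = {}"
      by (simp add: class_R_def conj_class_class_of_type[OF assms(1)])
    show "(1 / 2) *\<^sub>C cut_join m n (\<Sum>x\<in>A. c x *\<^sub>C h x) = (\<Sum>x\<in>A. c x *\<^sub>C ((1 / 2) *\<^sub>C cut_join m n (h x)))"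
      for c :: "complex mat \<Rightarrow> complex" and h A
      unfolding cut_join_sum_scale scale_sum
      by (intro sum.cong refl poly_mapping_eqI) (simp add: lookup_scale)
  qed (rule sum_class_R_product[OF assms])
  then show "CJ m n 0 f =
              (1 / 2) *\<^sub>C Sum_any (\<lambda>(i, j, \<alpha>, \<gamma>).
                if 1 \<le> i \<and> 1 \<le> j \<and> \<alpha> < m \<and> \<gamma> < m then
                  of_nat (i + j) *\<^sub>C
                    (pvar \<alpha> i * pvar \<gamma> j * pdiff ((\<alpha> + \<gamma>) mod m) (i + j) f) +
                  of_nat (m * i * j) *\<^sub>C
                    (pvar ((\<alpha> + \<gamma>) mod m) (i + j) * pdiff \<alpha> i (pdiff \<gamma> j f))
                else 0)"
    unfolding Sum_any_eq_cut_join[OF f] .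
next
  fix k f assume k: "k \<in> {1..m - 1}" and f: "f \<in> poly_component m n"
  then have k': "1 \<le> k" "k < m" by auto
  have "CJ m n k f = recolour m n k f"
  proof (rule CJ_eq[OF assms(1) f, where R = "class_L m n k" and D = "recolour m n k"])
    show "refl_sum m n k = set_sum (class_L m n k)" using k' by (simp add: refl_sum_def)
    show "class_L m n k = class_of_type m n (part_monom m ((replicate m {#})[0 := replicate_mset (n - 1) 1, k := {#1#}])) \<or>
        class_L m n k = {}"
      by (simp add: class_L_def conj_class_class_of_type[OF assms(1)])
  qed (rule recolour_sum_scale sum_class_L_product[OF assms(1) k'])+
  then show "CJ m n k f =
              Sum_any (\<lambda>(i, \<alpha>).
                if 1 \<le> i \<and> \<alpha> < m then
                  of_nat i *\<^sub>C (pvar ((\<alpha> + k) mod m) i * pdiff \<alpha> i f)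
                else 0)"
    unfolding Sum_any_eq_recolour[OF f] .
qed

end
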